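(* Consider the model $$\dot x_i=f(x_i)+\alpha\sum_{j=1}^nA_{ij}H_{ij}(t,x_j-x_i),\qquad i=1,\dots,n,$$ satisfying Assumptions 1 and 2 of the context. Regardless of the values of $\sup_t\|P_{ij}(t)\|\le\delta$, if the perturbations $P_{ij}(t)\in\mathcal{P}$ oscillate fast enough, then for all $\alpha$ satisfying $$\alpha>\frac{\eta}{\lambda_2\gamma}$$ the synchronization manifold $\mathcal{S}$ is locally exponentially stable. Moreover, the decay rate towards synchronization is not affected.
   Context: Network: an undirected, simple, connected graph on $n$ vertices with adjacency matrix $A=(A_{ij})$ ($A_{ij}=1$ if $i$ is connected to $j$ and $0$ otherwise), degrees $g_i=\sum_jA_{ij}$ and Laplacian $L=\operatorname{diag}(g_1,\dots,g_n)-A$, with eigenvalues $0=\lambda_1<\lambda_2\le\dots\le\lambda_n$. Here $x_i\in\mathbb{R}^q$ and $\alpha>0$ is the coupling strength. Norms: on $\mathbb{R}^q$, $\|x\|=\max_j|x_j|$; for matrices $\|C\|=\max_i\sum_j|C_{ij}|$ is the induced operator norm; $\|\cdot\|_2$ is the Euclidean norm. Assumption 1. $f:\mathbb{R}^q\to\mathbb{R}^q$ is continuously differentiable and there exist an inflowing invariant open ball $U\subset\mathbb{R}^q$ and $\varrho>0$ with $\|Df(x)\|\le\varrho$ for all $x\in U$. Assumption 2. $H_{ij}(t,x)=H(x)+P_{ij}(t)x$ with $H_{ij}(t,0)=0$; $H$ is differentiable and $DH(0)=\Gamma$ has eigenvalues $\gamma_1,\dots,\gamma_q$ with $\gamma=\gamma(\Gamma)=\min_i\Re(\gamma_i)>0$;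 the perturbations $P_{ij}$ are continuous $q\times q$ matrix functions with $\sup_{t>0}\|P_{ij}(t)\|\le\delta$ for all $i,j$. Synchronization manifold: $\mathcal{S}=\{x_i\in U\text{ for }i=1,\dots,n:\ x_1=\dots=x_n\}$. It is locally exponentially stable, with decay rate $\nu>0$, if there exist $\rho_0>0$ and $C>0$ such that $\|x_j(t_0)-x_i(t_0)\|_2\le\rho_0$ for all $i,j$ implies $\|x_j(t)-x_i(t)\|_2\le Ce^{-\nu(t-t_0)}\|x_j(t_0)-x_i(t_0)\|_2$ for all $t\ge t_0$ and all $i,j$. The constant $\eta=\eta(f,\Gamma)$ is that of the following persistence theorem: under Assumptions 1 and 2 on a connected network there exist $\eta=\eta(f,\Gamma)$ and $K=K(\Gamma)$ such that if $\alpha>\eta/(\lambda_2\gamma)$ and $\delta<(\lambda_2\gamma-\eta/\alpha)/(K\|L\|)$, then $\mathcal{S}$ is locally exponentially stable with decay rate $\nu=\alpha\lambda_2\gamma-\eta-\delta K\|L\|>0$. Family $\mathcal{P}$: a family of periodic matrix functions of one parameter $\omega$ (called frequency) and with mean value zero. Fast oscillation: $P(t)\in\mathcal{P}$ oscillates fast if for any $c,h>0$ there is a frequency $\omega_0=\omega_0(c,h)$ such that for all $\omega>\omega_0$, $$\Big\|\int_{t_1}^{t_2}P(\omega t)\,dt\Big\|\le c\quad\text{for any }t_1<t_2<t_1+h.$$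
   Formalization: Stability bounds each difference by the largest initial difference, not that pair's own (false on a 3-node path); the persistence rate has αδK‖L‖ for δK‖L‖ (printed rate fails as α→∞); "fast enough" may depend on α (a uniform threshold is false). *)

theory Defs
  imports "HOL-Analysis.Analysis" "Jordan_Normal_Form.Char_Poly"
begin

text \<open>
  Nodes are the numbers below \<open>n\<close>, so that the size of the network can be quantified over inside a
  formula (a constant depending on \<open>f\<close> and \<open>\<Gamma>\<close> only must serve all networks).  Graph matrices are
  matrices of Jordan-Normal-Form; the \<open>q\<close>-dimensional state space is \<open>real ^ 'q\<close>.
\<close>

no_notation vec_index (infixl "$" 100)

subsection \<open>Networks\<close>

text \<open>\<open>2 \<le> n\<close> is what makes \<open>\<lambda>\<^sub>2\<close> meaningful.\<close>

definition network :: "nat \<Rightarrow> real mat \<Rightarrow> bool" where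
  "network n A \<longleftrightarrow> 2 \<le> n \<and> A \<in> carrier_mat n n
     \<and> (\<forall>i<n. \<forall>j<n. A $$ (i, j) \<in> {0, 1} \<and> A $$ (i, j) = A $$ (j, i))
     \<and> (\<forall>i<n. A $$ (i, i) = 0)
     \<and> (\<forall>i<n. \<forall>j<n. (i, j) \<in> {(k, l). k < n \<and> l < n \<and> A $$ (k, l) = 1}\<^sup>*)"

definition laplacian :: "real mat \<Rightarrow> real mat" where
  "laplacian A = Matrix.mat (dim_row A) (dim_row A)
     (\<lambda>(i, j). (if i = j then (\<Sum>k<dim_row A. A $$ (i, k)) else 0) - A $$ (i, j))"

text \<open>The eigenvalues of the Laplacian in increasing order, with multiplicity; the paper's
  \<open>\<lambda>\<^sub>2\<close> has index 1.  The Laplacian is symmetric, so all roots of its characteristic polynomial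
  are real.\<close>

definition laplacian_eigenvalues :: "real mat \<Rightarrow> real list" where
  "laplacian_eigenvalues A = sorted_list_of_multiset (proots (char_poly (laplacian A)))"

definition lambda2 :: "real mat \<Rightarrow> real" where
  "lambda2 A = laplacian_eigenvalues A ! 1"

text \<open>The operator norm induced by the max norm, for both kinds of matrices.\<close>

definition row_sum_norm_mat :: "real mat \<Rightarrow> real" where
  "row_sum_norm_mat C = Max ((\<lambda>i. \<Sum>j<dim_col C. \<bar>C $$ (i, j)\<bar>) ` {..<dim_row C})"

definition row_sum_norm :: "real ^ 'q ^ 'q \<Rightarrow> real" where
  "row_sum_norm C = Max (range (\<lambda>i. \<Sum>j\<in>UNIV. \<bar>C $ i $ j\<bar>))"

subsection \<open>Node dynamics and coupling\<close>

text \<open>The ball is Euclidean, and the vector field points strictly inwards on its boundary.\<close>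

definition inflowing_invariant_ball :: "(real ^ 'q \<Rightarrow> real ^ 'q) \<Rightarrow> (real ^ 'q) set \<Rightarrow> bool" where
  "inflowing_invariant_ball f U \<longleftrightarrow>
     (\<exists>c r. r > 0 \<and> U = ball c r \<and> (\<forall>x\<in>sphere c r. inner (f x) (x - c) < 0))"

definition node_dynamics :: "(real ^ 'q \<Rightarrow> real ^ 'q) \<Rightarrow> (real ^ 'q) set \<Rightarrow> real \<Rightarrow> bool" where
  "node_dynamics f U \<rho> \<longleftrightarrow>
     (\<forall>x. f differentiable (at x)) \<and> continuous_on UNIV (\<lambda>x. jacobian f (at x))
     \<and> inflowing_invariant_ball f U
     \<and> \<rho> > 0 \<and> (\<forall>x\<in>U. row_sum_norm (jacobian f (at x)) \<le> \<rho>)"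

definition complex_eigenvalues :: "real ^ 'q ^ 'q \<Rightarrow> complex set" where
  "complex_eigenvalues \<Gamma> =
     {z. \<exists>v :: complex ^ 'q. v \<noteq> 0 \<and> (\<chi> i j. complex_of_real (\<Gamma> $ i $ j)) *v v = z *s v}"

definition spectral_min :: "real ^ 'q ^ 'q \<Rightarrow> real" where
  "spectral_min \<Gamma> = Min (Re ` complex_eigenvalues \<Gamma>)"

definition coupling ::
    "(real ^ 'q \<Rightarrow> real ^ 'q) \<Rightarrow> (nat \<Rightarrow> nat \<Rightarrow> real \<Rightarrow> real ^ 'q ^ 'q)
     \<Rightarrow> nat \<Rightarrow> nat \<Rightarrow> real \<Rightarrow> real ^ 'q \<Rightarrow> real ^ 'q" where
  "coupling H P i j t x = H x + P i j t *v x"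

definition coupling_assumption ::
    "nat \<Rightarrow> (real ^ 'q \<Rightarrow> real ^ 'q) \<Rightarrow> real ^ 'q ^ 'q
     \<Rightarrow> (nat \<Rightarrow> nat \<Rightarrow> real \<Rightarrow> real ^ 'q ^ 'q) \<Rightarrow> real \<Rightarrow> bool" where
  "coupling_assumption n H \<Gamma> P \<delta> \<longleftrightarrow>
     (\<forall>i<n. \<forall>j<n. \<forall>t. coupling H P i j t 0 = 0)
     \<and> (\<forall>x. H differentiable (at x)) \<and> jacobian H (at 0) = \<Gamma>
     \<and> spectral_min \<Gamma> > 0
     \<and> (\<forall>i<n. \<forall>j<n. continuous_on UNIV (P i j) \<and> (\<forall>t>0. row_sum_norm (P i j t) \<le> \<delta>))"

definition network_solution ::
    "nat \<Rightarrow> real mat \<Rightarrow> (real ^ 'q \<Rightarrow> real ^ 'q) \<Rightarrow> (real ^ 'q \<Rightarrow> real ^ 'q)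
     \<Rightarrow> (nat \<Rightarrow> nat \<Rightarrow> real \<Rightarrow> real ^ 'q ^ 'q) \<Rightarrow> real
     \<Rightarrow> real set \<Rightarrow> (nat \<Rightarrow> real \<Rightarrow> real ^ 'q) \<Rightarrow> bool" where
  "network_solution n A f H P \<alpha> I x \<longleftrightarrow>
     (\<forall>i<n. \<forall>t\<in>I. (x i has_vector_derivative
        (f (x i t) + \<alpha> *\<^sub>R (\<Sum>j<n. A $$ (i, j) *\<^sub>R coupling H P i j t (x j t - x i t))))
        (at t within I))"

subsection \<open>Local exponential stability of the synchronization manifold\<close>

text \<open>
  A solution on \<open>[t0, \<infinity>)\<close> restricts to every \<open>[t0, T)\<close>, so the estimate covers global solutions;
  demanding it on each interval of existence also excludes a blow-up of the differences.

  The right-hand side carries the largest initial difference.  With the initial difference of the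
  same pair \<open>(i, j)\<close> the notion would fail on any network in which two nodes that start in the same
  state can be driven apart by a third node (e.g. the path 1-2-3 with \<open>x\<^sub>1 = x\<^sub>2 \<noteq> x\<^sub>3\<close>).
\<close>

definition spread :: "nat \<Rightarrow> (nat \<Rightarrow> real ^ 'q) \<Rightarrow> real" where
  "spread n y = Max {norm (y j - y i) | i j. i < n \<and> j < n}"

definition sync_locally_exp_stable ::
    "nat \<Rightarrow> real mat \<Rightarrow> (real ^ 'q \<Rightarrow> real ^ 'q) \<Rightarrow> (real ^ 'q) set \<Rightarrow> (real ^ 'q \<Rightarrow> real ^ 'q)
     \<Rightarrow> (nat \<Rightarrow> nat \<Rightarrow> real \<Rightarrow> real ^ 'q ^ 'q) \<Rightarrow> real \<Rightarrow> real \<Rightarrow> bool" where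
  "sync_locally_exp_stable n A f U H P \<alpha> \<nu> \<longleftrightarrow> \<nu> > 0 \<and>
     (\<exists>\<rho>\<^sub>0>0. \<exists>C>0. \<forall>t\<^sub>0\<ge>0. \<forall>T. \<forall>x.
        network_solution n A f H P \<alpha> {t\<^sub>0..<T} x
        \<and> (\<forall>i<n. x i t\<^sub>0 \<in> U)
        \<and> (\<forall>i<n. \<forall>j<n. norm (x j t\<^sub>0 - x i t\<^sub>0) \<le> \<rho>\<^sub>0)
        \<longrightarrow> (\<forall>t\<in>{t\<^sub>0..<T}. \<forall>i<n. \<forall>j<n.
              norm (x j t - x i t) \<le> C * exp (- \<nu> * (t - t\<^sub>0)) * spread n (\<lambda>k. x k t\<^sub>0)))"

text \<open>
  \<open>\<eta>\<close> and \<open>K\<close> are constants for which the persistence theorem holds, for the given \<open>f\<close>, \<open>U\<close> and \<open>\<Gamma>\<close>,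
  on all networks and for all couplings with linearization \<open>\<Gamma>\<close>.  The decay rate carries
  \<open>\<alpha> \<delta> K \<parallel>L\<parallel>\<close>: the perturbation enters the equations with the factor \<open>\<alpha>\<close>, and the bound
  on \<open>\<delta>\<close> says precisely that this rate is positive.
\<close>

definition persistence_constants ::
    "(real ^ 'q \<Rightarrow> real ^ 'q) \<Rightarrow> (real ^ 'q) set \<Rightarrow> real ^ 'q ^ 'q \<Rightarrow> real \<Rightarrow> real \<Rightarrow> bool" where
  "persistence_constants f U \<Gamma> \<eta> K \<longleftrightarrow> K > 0 \<and>
     (\<forall>n A H P \<delta> \<alpha>.
        network n A \<and> coupling_assumption n H \<Gamma> P \<delta> \<and> \<alpha> > 0
        \<and> \<alpha> > \<eta> / (lambda2 A * spectral_min \<Gamma>)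
        \<and> \<delta> < (lambda2 A * spectral_min \<Gamma> - \<eta> / \<alpha>) / (K * row_sum_norm_mat (laplacian A))
        \<longrightarrow> sync_locally_exp_stable n A f U H P \<alpha>
              (\<alpha> * lambda2 A * spectral_min \<Gamma> - \<eta>
                - \<alpha> * \<delta> * K * row_sum_norm_mat (laplacian A)))"

subsection \<open>Fast oscillation\<close>

definition zero_mean_periodic :: "(real \<Rightarrow> real ^ 'q ^ 'q) \<Rightarrow> bool" where
  "zero_mean_periodic P \<longleftrightarrow> (\<exists>p>0. (\<forall>t. P (t + p) = P t) \<and> (P has_integral 0) {0..p})"

definition oscillates_fast :: "(real \<Rightarrow> real ^ 'q ^ 'q) \<Rightarrow> bool" where
  "oscillates_fast P \<longleftrightarrow>
     (\<forall>c>0. \<forall>h>0. \<exists>\<omega>\<^sub>0. \<forall>\<omega>>\<omega>\<^sub>0. \<forall>t\<^sub>1 t\<^sub>2. t\<^sub>1 < t\<^sub>2 \<and> t\<^sub>2 < t\<^sub>1 + h \<longrightarrow>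
        row_sum_norm (integral {t\<^sub>1..t\<^sub>2} (\<lambda>t. P (\<omega> * t))) \<le> c)"

end

theory Submission
  imports Defs
begin

text \<open>
  The persistence theorem is assumed for every coupling function \<open>H\<close> with \<open>DH(0) = \<Gamma>\<close>, and \<open>H\<close> need
  only be differentiable.  This makes its decay rate \<open>\<nu>\<close> (at \<open>\<delta> = 0\<close>) strictly pessimistic: if there
  were, for every time \<open>\<tau>\<close>, nearly synchronous trajectories of the linearly coupled network that
  decay no faster than \<open>exp (-\<nu> \<tau>)\<close>, then weakening the coupling by \<open>2\<^sup>-\<^sup>m x\<close> on the \<open>m\<close>-th of a
  sequence of rapidly shrinking scales, which does not change \<open>DH(0)\<close>, would multiply the
  eigenmodes of the \<open>m\<close>-th such trajectory by arbitrarily large factors and refute the bound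
  \<open>C exp (-\<nu> t)\<close> for every \<open>C\<close>.  Hence over some time \<open>\<tau>\<close> the linearly coupled network contracts by
  \<open>exp (-\<nu> \<tau>) / 2\<close>, robustly under small errors.

  With perturbations of high frequency, the trajectories stay within a small multiple of the initial
  spread of curves that satisfy the unperturbed equations up to such errors, because the integrals
  of the perturbations are small.  The factor \<open>1/2\<close> absorbs the difference, so the spread is
  multiplied by at most \<open>exp (-\<nu> \<tau>)\<close> in each period \<open>\<tau>\<close>.
\<close>

subsection \<open>Gronwall's inequality and global solutions\<close>

text \<open>The obstacle is the exact rate. Stability of the unperturbed network with a constant
  \<open>C\<close> contracts over one period only by \<open>C * exp (- \<nu> * \<tau>)\<close>;
  iterating that, or absorbing averaging errors in it, costs part of \<nu>. The constants \<eta> and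
  \<open>K\<close> are known only through the statement that they serve every admissible coupling,
  so a better factor can be extracted only by choosing the coupling. The weakening is a multiple of
  the identity because this commutes with the Jacobians and with \<Gamma>: whatever the linearised
  flow along the trajectory does, mode \<open>k\<close> gains the scalar factor
  \<open>exp (\<alpha> * \<epsilon> * \<mu> k * \<tau>)\<close>. With \<epsilon> equal to
  \<open>2^-m\<close> and \<tau> of order \<open>(m + 1) * 2^m\<close> this gain is unbounded in
  \<open>m\<close>. The hypothetical slow trajectories must be allowed small defects, since
  averaging produces only approximate solutions; this is the reason for the predicate
  \<open>shadowing\<close>.\<close>

lemma gronwall_family:
  fixes w w' :: "'k \<Rightarrow> real \<Rightarrow> 'a::banach" and a b c t :: real
  assumes K: "finite K" and b: "b > 0" and c: "c \<ge> 0" and t: "a \<le> t"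
    and der: "\<And>k s. k \<in> K \<Longrightarrow> s \<in> {a..t} \<Longrightarrow>
      (w k has_vector_derivative w' k s) (at s within {a..t})"
    and bnd: "\<And>k s. k \<in> K \<Longrightarrow> s \<in> {a..t} \<Longrightarrow>
      norm (w' k s) \<le> b * (\<Sum>l\<in>K. norm (w l s)) + c"
  shows "(\<Sum>k\<in>K. norm (w k t))
    \<le> ((\<Sum>k\<in>K. norm (w k a)) + c / b) * exp (card K * b * (t - a))"
proof (cases "a = t")
  case True
  then show ?thesis using b c by simp
next
  case False
  then have at: "a < t" using t by simp
  define S where "S = (\<lambda>s. \<Sum>k\<in>K. norm (w k s))"
  define N where "N = real (card K)"
  \<comment> \<open>Norms need not be differentiable, so the estimate runs through the integral
    \<open>Y\<close> of the majorant, which bounds the increment of every member of the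
    family.\<close>
  define Y where "Y = (\<lambda>s. integral {a..s} (\<lambda>r. b * S r + c))"
  have N0: "N \<ge> 0" unfolding N_def by simp
  have contw: "continuous_on {a..t} (w k)" if "k \<in> K" for k
    using der[OF that] has_vector_derivative_continuous by (fastforce simp: continuous_on_eq_continuous_within)
  have contS: "continuous_on {a..t} S"
    unfolding S_def by (intro continuous_intros contw)
  have contb: "continuous_on {a..t} (\<lambda>r. b * S r + c)"
    by (intro continuous_intros contS)
  have Yder: "(Y has_real_derivative b * S s + c) (at s within {a..t})" if "s \<in> {a..t}" for s
    unfolding Y_def using integral_has_real_derivative[OF contb that] .
  have contY: "continuous_on {a..t} Y"
    using Yder DERIV_continuous by (fastforce simp: continuous_on_eq_continuous_within)
  have atI: "at s within {a..t} = at s" if "a < s" "s < t" for s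
    using that by (intro at_within_interior) auto
  have Ya: "Y a = 0" unfolding Y_def by simp
  have wk: "norm (w k s - w k a) \<le> Y s" if "k \<in> K" "s \<in> {a..t}" for k s
  proof (cases "s = a")
    case True then show ?thesis by (simp add: Ya)
  next
    case False
    then have as: "a < s" using that by simp
    have "norm (w k s - w k a) \<le> Y s - Y a"
    proof (rule differentiable_bound_general[OF as, where f' = "w' k" and \<phi>' = "\<lambda>s. b * S s + c"])
      show "continuous_on {a..s} (w k)" "continuous_on {a..s} Y"
        using contw[OF that(1)] contY that(2) by (auto elim: continuous_on_subset)
      fix x assume x: "a < x" "x < s"
      then have x': "x \<in> {a..t}" "a < x" "x < t" using that by auto
      show "(w k has_vector_derivative w' k x) (at x)"
        using der[OF that(1) x'(1)] atI[OF x'(2,3)] by simp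
      show "(Y has_vector_derivative b * S x + c) (at x)"
        using Yder[OF x'(1)] atI[OF x'(2,3)] by (simp add: has_real_derivative_iff_has_vector_derivative)
      show "norm (w' k x) \<le> b * S x + c"
        using bnd[OF that(1) x'(1)] unfolding S_def .
    qed
    then show ?thesis by (simp add: Ya)
  qed
  have SY: "S s \<le> S a + N * Y s" if "s \<in> {a..t}" for s
  proof -
    have "S s \<le> (\<Sum>k\<in>K. norm (w k a) + Y s)"
      unfolding S_def
    proof (rule sum_mono)
      fix k assume "k \<in> K"
      then show "norm (w k s) \<le> norm (w k a) + Y s"
        using wk[OF _ that, of k] norm_triangle_sub[of "w k s" "w k a"] by simp
    qed
    then show ?thesis by (simp add: sum.distrib S_def N_def)
  qed
  \<comment> \<open>The shift by \<open>c / b\<close> makes the inequality homogeneous: in the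
    derivative of \<open>V\<close> the terms with \<open>c\<close> cancel, and \<open>SY\<close>
    shows that the rest is nonpositive.\<close>
  define V where "V = (\<lambda>s. (S a + N * Y s + c / b) * exp (- (N * b * (s - a))))"
  have "V t \<le> V a"
  proof (rule DERIV_nonpos_imp_decreasing_open[OF t])
    show "continuous_on {a..t} V"
      unfolding V_def by (intro continuous_intros contY)
    fix x assume x: "a < x" "x < t"
    then have x': "x \<in> {a..t}" by auto
    have Yd: "(Y has_real_derivative b * S x + c) (at x)"
      using Yder[OF x'] atI[OF x] by simp
    have "(V has_real_derivative
        (N * (b * S x + c) - N * b * (S a + N * Y x + c / b)) * exp (- (N * b * (x - a)))) (at x)"
      unfolding V_def
      by (rule derivative_eq_intros Yd refl | simp)+ (simp add: algebra_simps)
    moreover have "N * (b * S x + c) - N * b * (S a + N * Y x + c / b) \<le> 0"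
    proof -
      have "N * b * S x \<le> N * b * (S a + N * Y x)"
        using SY[OF x'] N0 b by (intro mult_left_mono) auto
      moreover have "N * b * (c / b) = N * c" using b by simp
      ultimately show ?thesis by (simp add: algebra_simps)
    qed
    ultimately show "\<exists>y. DERIV V x :> y \<and> y \<le> 0"
      by (meson exp_ge_zero mult_nonpos_nonneg)
  qed
  then have "(S a + N * Y t + c / b) * exp (- (N * b * (t - a))) \<le> S a + c / b"
    unfolding V_def by (simp add: Ya)
  then have "(S a + N * Y t + c / b) * exp (- (N * b * (t - a))) * exp (N * b * (t - a))
      \<le> (S a + c / b) * exp (N * b * (t - a))"
    by (rule mult_right_mono) simp
  then have "S a + N * Y t + c / b \<le> (S a + c / b) * exp (N * b * (t - a))"
    by (simp add: mult.assoc flip: exp_add)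
  moreover have "S t \<le> S a + N * Y t" using SY t by auto
  moreover have "c / b \<ge> 0" using b c by simp
  ultimately have "S t \<le> (S a + c / b) * exp (N * b * (t - a))" by linarith
  then show ?thesis unfolding S_def N_def .
qed

section \<open>Picard iteration on the half-line\<close>

lemma integral_ivl_has_vector_derivative:
  fixes h :: "real \<Rightarrow> 'a::banach"
  assumes "continuous_on {0..} h" "t \<ge> 0"
  shows "((\<lambda>u. integral {0..u} h) has_vector_derivative h t) (at t within {0..})"
proof -
  have "((\<lambda>u. integral {0..u} h) has_vector_derivative h t) (at t within {0..t + 1})"
    using assms by (intro integral_has_vector_derivative) (auto elim: continuous_on_subset)
  moreover have "at t within {0..t + 1} = at t within {0..}"
    by (rule at_within_nhd[of _ "{t - 1<..<t + 1}"]) auto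
  ultimately show ?thesis by simp
qed

text \<open>In the norm weighted by \<open>exp (- (L * t))\<close>, integration from 0 has norm at
  most \<open>1 / L\<close>. A large weight therefore makes the Picard operator contract on the
  whole half-line at once.\<close>

lemma integral_exp_growth_bound:
  fixes h :: "real \<Rightarrow> 'a::banach"
  assumes L: "L > 0" and h: "continuous_on {0..} h" and t: "t \<ge> 0"
    and bnd: "\<And>s. s \<ge> 0 \<Longrightarrow> norm (h s) \<le> B * exp (L * s)"
  shows "norm (exp (- (L * t)) *\<^sub>R integral {0..t} h) \<le> B / L"
proof -
  have B: "B \<ge> 0" using order_trans[OF norm_ge_zero bnd[of 0]] by simp
  have "((\<lambda>s. B * exp (L * s)) has_integral (B * exp (L * t) / L - B * exp (L * 0) / L)) {0..t}"
    using L t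
    by (intro fundamental_theorem_of_calculus)
      (auto intro!: derivative_eq_intros simp flip: has_real_derivative_iff_has_vector_derivative)
  then have I: "integral {0..t} (\<lambda>s. B * exp (L * s)) = B * exp (L * t) / L - B * exp (L * 0) / L"
    "(\<lambda>s. B * exp (L * s)) integrable_on {0..t}"
    by (rule integral_unique, rule has_integral_integrable)
  have "h integrable_on {0..t}"
    using h by (intro integrable_continuous_real) (auto elim: continuous_on_subset)
  then have "norm (integral {0..t} h) \<le> integral {0..t} (\<lambda>s. B * exp (L * s))"
    using I(2) bnd by (intro Henstock_Kurzweil_Integration.integral_norm_bound_integral) auto
  then have "norm (integral {0..t} h) \<le> B * exp (L * t) / L"
    unfolding I(1) using divide_nonneg_pos[OF B L] by simp
  then have "exp (- (L * t)) * norm (integral {0..t} h) \<le> exp (- (L * t)) * (B * exp (L * t) / L)"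
    by (rule mult_left_mono) simp
  also have "\<dots> = B / L" by (simp add: exp_minus)
  finally show ?thesis by simp
qed

text \<open>Picard iteration for the rescaled curve \<open>exp (- (M * t)) *\<^sub>R x t\<close>,
  which ranges over the bounded continuous functions. The fixed point lives on all nonnegative
  times, so there is no continuation argument.\<close>

lemma lipschitz_ode_global_solution:
  fixes F :: "'a::banach \<Rightarrow> 'a"
  assumes lip: "\<And>x y. norm (F x - F y) \<le> L * norm (x - y)"
  obtains x where "x 0 = x0"
    "\<And>t. t \<ge> 0 \<Longrightarrow> (x has_vector_derivative F (x t)) (at t within {0..})"
proof -
  \<comment> \<open>Twice a Lipschitz constant yields the contraction factor 1/2;
    \<open>max L 1\<close> keeps the weight positive whatever \<open>L\<close> is.\<close>
  define M where "M = 2 * max L 1"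
  have M: "M > 0" unfolding M_def by simp
  have lipM: "norm (F x - F y) \<le> M / 2 * norm (x - y)" for x y
    using lip[of x y] mult_right_mono[of L "M / 2" "norm (x - y)"] unfolding M_def by fastforce
  have contF: "continuous_on UNIV F"
    using lipM M by (intro lipschitz_on_continuous_on[of "M / 2"] lipschitz_onI) (auto simp: dist_norm)
  define h where "h = (\<lambda>(y :: real \<Rightarrow>\<^sub>C 'a) s. F (exp (M * s) *\<^sub>R y s))"
  have conth: "continuous_on S (h y)" for y S
    unfolding h_def by (intro continuous_intros continuous_on_compose2[OF contF]) auto
  have hbnd: "norm (h y s) \<le> (norm (F 0) + M / 2 * norm y) * exp (M * s)" if "s \<ge> 0" for y s
  proof -
    have "norm (h y s) \<le> norm (F 0) + M / 2 * (exp (M * s) * norm (y s))"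
      using lipM[of "exp (M * s) *\<^sub>R y s" 0] norm_triangle_sub[of "h y s" "F 0"]
      unfolding h_def by simp
    also have "\<dots> \<le> norm (F 0) * exp (M * s) + M / 2 * (exp (M * s) * norm y)"
      using M that norm_bounded[of y s]
      by (intro add_mono mult_left_mono) (auto simp: mult_le_cancel_left1)
    finally show ?thesis by (simp add: algebra_simps)
  qed
  define G where "G = (\<lambda>(y :: real \<Rightarrow>\<^sub>C 'a) t. exp (- (M * t)) *\<^sub>R (x0 + integral {0..t} (h y)))"
  have contG: "continuous_on {0..} (G y)" for y
    unfolding G_def
    using integral_ivl_has_vector_derivative[OF conth] has_vector_derivative_continuous
    by (intro continuous_intros) (fastforce simp: continuous_on_eq_continuous_within)
  have Gbnd: "norm (G y t) \<le> norm x0 + (norm (F 0) + M / 2 * norm y) / M" if "t \<ge> 0" for y t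
  proof -
    have "norm (G y t) \<le> exp (- (M * t)) * norm x0
        + norm (exp (- (M * t)) *\<^sub>R integral {0..t} (h y))"
      unfolding G_def scaleR_add_right by (rule norm_triangle_le) simp
    moreover have "exp (- (M * t)) * norm x0 \<le> norm x0"
      using M that by (intro mult_left_le_one_le) auto
    ultimately show ?thesis
      using integral_exp_growth_bound[OF M conth that hbnd, of y] by simp
  qed
  \<comment> \<open>Bounded continuous functions are defined on the whole line, so the image is
    extended to negative times by its value at 0.\<close>
  define T where "T = (\<lambda>y. Bcontfun (\<lambda>t. G y (max 0 t)))"
  have T: "apply_bcontfun (T y) t = G y (max 0 t)" for y t
  proof -
    have "(\<lambda>t. G y (max 0 t)) \<in> bcontfun"
      by (rule bcontfun_normI[OF _ Gbnd])
        (auto intro!: continuous_on_compose2[OF contG] continuous_intros)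
    then show ?thesis unfolding T_def by (simp add: Bcontfun_inverse)
  qed
  have "dist (T y) (T y') \<le> 1 / 2 * dist y y'" for y y'
  proof (rule dist_bound)
    fix t :: real
    define s where "s = max 0 t"
    have s: "s \<ge> 0" unfolding s_def by simp
    have "G y s - G y' s = exp (- (M * s)) *\<^sub>R integral {0..s} (\<lambda>r. h y r - h y' r)"
      unfolding G_def
      by (subst integral_diff)
        (auto intro!: integrable_continuous_real conth simp: algebra_simps)
    moreover have "norm (exp (- (M * s)) *\<^sub>R integral {0..s} (\<lambda>r. h y r - h y' r))
        \<le> (M / 2 * dist y y') / M"
    proof (rule integral_exp_growth_bound[OF M _ s])
      show "continuous_on {0..} (\<lambda>r. h y r - h y' r)" by (intro continuous_intros conth)
      fix r :: real
      have "norm (h y r - h y' r) \<le> M / 2 * norm (exp (M * r) *\<^sub>R (y r - y' r))"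
        using lipM unfolding h_def scaleR_diff_right .
      also have "\<dots> \<le> M / 2 * (exp (M * r) * dist y y')"
        using M dist_bounded[of y r y'] by (auto simp: dist_norm intro!: mult_left_mono)
      finally show "norm (h y r - h y' r) \<le> M / 2 * dist y y' * exp (M * r)"
        by (simp add: mult_ac)
    qed
    ultimately show "dist (apply_bcontfun (T y) t) (apply_bcontfun (T y') t) \<le> 1 / 2 * dist y y'"
      using M unfolding T s_def[symmetric] dist_norm by simp
  qed
  then obtain y where y: "T y = y"
    using banach_fix_type[of "1 / 2" T] by auto
  define x where "x = (\<lambda>t. x0 + integral {0..t} (h y))"
  have xy: "x t = exp (M * t) *\<^sub>R y t" if "t \<ge> 0" for t
    using T[of y t] that unfolding y G_def x_def by (simp add: max_def exp_minus)
  show thesis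
  proof
    show "x 0 = x0" unfolding x_def by simp
    fix t :: real assume t: "t \<ge> 0"
    have "(x has_vector_derivative h y t) (at t within {0..})"
      unfolding x_def
      by (rule derivative_eq_intros integral_ivl_has_vector_derivative[OF conth t] refl | simp)+
    then show "(x has_vector_derivative F (x t)) (at t within {0..})"
      using xy[OF t] unfolding h_def by simp
  qed
qed

subsection \<open>The spectrum of the Laplacian\<close>

text \<open>\<open>r\<close> is the matrix of the orthogonal projection onto the complement of the
  \<open>e k\<close>. Being symmetric and idempotent, it has its trace \<open>n - m\<close> as
  squared Frobenius norm. For \<open>m < n\<close> this yields a further orthogonal vector, for
  \<open>m = n\<close> completeness.\<close>

lemma orthonormal_residual:
  fixes e :: "nat \<Rightarrow> nat \<Rightarrow> real"
  assumes on: "\<And>k l. k < m \<Longrightarrow> l < m \<Longrightarrow> (\<Sum>i<n. e k i * e l i) = of_bool (k = l)"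
  defines "r \<equiv> \<lambda>i j. of_bool (i = j) - (\<Sum>k<m. e k i * e k j)"
  shows "i < n \<Longrightarrow> l < m \<Longrightarrow> (\<Sum>j<n. r i j * e l j) = 0"
    and "(\<Sum>i<n. \<Sum>j<n. (r i j)\<^sup>2) = real n - real m"
proof -
  show orth: "(\<Sum>j<n. r i j * e l j) = 0" if "i < n" "l < m" for i l
  proof -
    have "(\<Sum>j<n. r i j * e l j)
        = (\<Sum>j<n. of_bool (i = j) * e l j) - (\<Sum>j<n. \<Sum>k<m. e k i * (e k j * e l j))"
      unfolding r_def by (simp add: left_diff_distrib sum_subtractf sum_distrib_right mult.assoc)
    also have "(\<Sum>j<n. of_bool (i = j) * e l j) = e l i"
      using that by (simp add: of_bool_def if_distrib[of "\<lambda>x. x * _"] cong: if_cong)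
    also have "(\<Sum>j<n. \<Sum>k<m. e k i * (e k j * e l j)) = (\<Sum>k<m. e k i * of_bool (k = l))"
      using on[OF _ that(2)] by (subst sum.swap) (simp flip: sum_distrib_left)
    also have "\<dots> = e l i"
      using that by (simp add: of_bool_def if_distrib[of "\<lambda>x. _ * x"] cong: if_cong)
    finally show ?thesis by simp
  qed
  have "(\<Sum>j<n. (r i j)\<^sup>2) = r i i" if "i < n" for i
  proof -
    have "(\<Sum>j<n. (r i j)\<^sup>2) = (\<Sum>j<n. r i j * of_bool (i = j)) - (\<Sum>j<n. \<Sum>k<m. e k i * (r i j * e k j))"
      unfolding power2_eq_square
      by (subst (2) r_def)
        (simp add: right_diff_distrib sum_subtractf sum_distrib_left mult_ac)
    also have "(\<Sum>j<n. \<Sum>k<m. e k i * (r i j * e k j)) = 0"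
      using orth[OF that] by (subst sum.swap) (simp flip: sum_distrib_left)
    also have "(\<Sum>j<n. r i j * of_bool (i = j)) = r i i"
      using that by (simp add: of_bool_def if_distrib[of "\<lambda>x. _ * x"] cong: if_cong)
    finally show ?thesis by simp
  qed
  then have "(\<Sum>i<n. \<Sum>j<n. (r i j)\<^sup>2) = (\<Sum>i<n. r i i)" by simp
  also have "\<dots> = real n - (\<Sum>i<n. \<Sum>k<m. e k i * e k i)"
    unfolding r_def by (simp add: sum_subtractf)
  also have "(\<Sum>i<n. \<Sum>k<m. e k i * e k i) = real m"
    using on by (subst sum.swap) simp
  finally show "(\<Sum>i<n. \<Sum>j<n. (r i j)\<^sup>2) = real n - real m" .
qed

lemma exists_unit_orthogonal:
  fixes e :: "nat \<Rightarrow> nat \<Rightarrow> real"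
  assumes on: "\<And>k l. k < m \<Longrightarrow> l < m \<Longrightarrow> (\<Sum>i<n. e k i * e l i) = of_bool (k = l)"
    and "m < n"
  obtains v where "(\<Sum>i<n. (v i)\<^sup>2) = 1" "\<And>k. k < m \<Longrightarrow> (\<Sum>i<n. v i * e k i) = 0"
    "\<And>i. i \<ge> n \<Longrightarrow> v i = 0"
proof -
  define r where "r = (\<lambda>i j. of_bool (i = j) - (\<Sum>k<m. e k i * e k j))"
  have R: "(\<Sum>j<n. r i j * e l j) = 0" if "i < n" "l < m" for i l
    unfolding r_def using that by (intro orthonormal_residual(1) on)
  have R2: "(\<Sum>i<n. \<Sum>j<n. (r i j)\<^sup>2) = real n - real m"
    unfolding r_def by (intro orthonormal_residual(2) on)
  have "\<exists>i<n. (\<Sum>j<n. (r i j)\<^sup>2) > 0"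
  proof (rule ccontr)
    assume "\<not> ?thesis"
    then have "(\<Sum>j<n. (r i j)\<^sup>2) \<le> 0" if "i < n" for i
      using that by (meson not_less)
    then have "(\<Sum>i<n. \<Sum>j<n. (r i j)\<^sup>2) \<le> 0"
      by (rule sum_nonpos) auto
    then show False using R2 \<open>m < n\<close> by simp
  qed
  then obtain i where i: "i < n" and s: "(\<Sum>j<n. (r i j)\<^sup>2) > 0" by blast
  define s where "s = (\<Sum>j<n. (r i j)\<^sup>2)"
  define v where "v = (\<lambda>j. if j < n then r i j / sqrt s else 0)"
  have s0: "s > 0" using s unfolding s_def .
  show thesis
  proof
    show "(\<Sum>i<n. (v i)\<^sup>2) = 1"
      using s0 unfolding v_def by (simp add: power_divide flip: sum_divide_distrib s_def)
    show "(\<Sum>i<n. v i * e k i) = 0" if "k < m" for k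
      using R[OF i that] unfolding v_def by (simp flip: sum_divide_distrib)
    show "v j = 0" if "j \<ge> n" for j using that unfolding v_def by simp
  qed
qed

text \<open>The dimension \<open>n\<close> is a variable, hence vectors are functions that vanish
  from \<open>n\<close> on. The sphere is closed inside a product of compact intervals, which is
  compact by Tychonoff.\<close>

lemma compact_orthogonal_sphere:
  fixes e :: "nat \<Rightarrow> nat \<Rightarrow> real"
  shows "compact {v :: nat \<Rightarrow> real. (\<forall>i\<ge>n. v i = 0) \<and> (\<Sum>i<n. (v i)\<^sup>2) = 1
    \<and> (\<forall>k<m. (\<Sum>i<n. v i * e k i) = 0)}" (is "compact ?K")
proof -
  let ?B = "\<lambda>i. if i < n then {-1..1} else {0::real}"
  have "compactin (product_topology (\<lambda>_. euclidean) UNIV) (PiE UNIV ?B)"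
    by (subst compactin_PiE) auto
  then have comp: "compact (PiE UNIV ?B)"
    by (simp add: euclidean_product_topology)
  have cont: "continuous_on UNIV (\<lambda>v :: nat \<Rightarrow> real. v i)" for i
    by (rule continuous_on_product_coordinates)
  have "closed ({v :: nat \<Rightarrow> real. (\<Sum>i<n. (v i)\<^sup>2) = 1}
    \<inter> (\<Inter>k\<in>{..<m}. {v. (\<Sum>i<n. v i * e k i) = 0}))"
    by (intro closed_Int closed_INT ballI closed_Collect_eq continuous_intros cont)
  from compact_Int_closed[OF comp this] have "compact (PiE UNIV ?B \<inter> ({v. (\<Sum>i<n. (v i)\<^sup>2) = 1}
    \<inter> (\<Inter>k\<in>{..<m}. {v. (\<Sum>i<n. v i * e k i) = 0})))" .
  also have "PiE UNIV ?B \<inter> ({v. (\<Sum>i<n. (v i)\<^sup>2) = 1}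
    \<inter> (\<Inter>k\<in>{..<m}. {v. (\<Sum>i<n. v i * e k i) = 0})) = ?K"
  proof -
    have "\<bar>v i\<bar> \<le> 1" if "(\<Sum>i<n. (v i)\<^sup>2) = 1" "i < n" for v :: "nat \<Rightarrow> real" and i
    proof -
      have "(v i)\<^sup>2 \<le> (\<Sum>i<n. (v i)\<^sup>2)"
        using that(2) by (intro member_le_sum) auto
      then show ?thesis using that(1) by (simp add: abs_square_le_1)
    qed
    then show ?thesis by (auto simp: PiE_iff abs_le_iff split: if_splits)
  qed
  finally show ?thesis .
qed

text \<open>The next eigenvector maximises the quadratic form on the unit sphere of the complement
  of the previous ones; the first-order condition at a maximiser is the eigenvalue equation.\<close>

lemma symmetric_orthonormal_eigenvectors:
  fixes B :: "nat \<Rightarrow> nat \<Rightarrow> real"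
  assumes sym: "\<And>i j. i < n \<Longrightarrow> j < n \<Longrightarrow> B i j = B j i"
  shows "m \<le> n \<Longrightarrow> \<exists>e \<mu>. (\<forall>k<m. \<forall>l<m. (\<Sum>i<n. e k i * e l i) = of_bool (k = l))
    \<and> (\<forall>k<m. \<forall>i<n. (\<Sum>j<n. B i j * e k j) = \<mu> k * e k i)"
proof (induction m)
  case 0
  then show ?case by simp
next
  case (Suc m)
  then obtain e \<mu> where
    "\<forall>k<m. \<forall>l<m. (\<Sum>i<n. e k i * e l i) = of_bool (k = l)"
    "\<forall>k<m. \<forall>i<n. (\<Sum>j<n. B i j * e k j) = \<mu> k * e k i"
    by auto
  then have on: "\<And>k l. k < m \<Longrightarrow> l < m \<Longrightarrow> (\<Sum>i<n. e k i * e l i) = of_bool (k = l)"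
    and ev: "\<And>k i. k < m \<Longrightarrow> i < n \<Longrightarrow> (\<Sum>j<n. B i j * e k j) = \<mu> k * e k i"
    by blast+
  have mn: "m < n" using Suc.prems by simp
  define K where "K = {v :: nat \<Rightarrow> real. (\<forall>i\<ge>n. v i = 0) \<and> (\<Sum>i<n. (v i)\<^sup>2) = 1
    \<and> (\<forall>k<m. (\<Sum>i<n. v i * e k i) = 0)}"
  define Q where "Q = (\<lambda>v :: nat \<Rightarrow> real. \<Sum>i<n. v i * (\<Sum>j<n. B i j * v j))"
  have "K \<noteq> {}"
    using exists_unit_orthogonal[OF on mn] unfolding K_def by (smt (verit) empty_iff mem_Collect_eq)
  moreover have "continuous_on K Q"
  proof -
    have "continuous_on UNIV (\<lambda>v :: nat \<Rightarrow> real. v i)" for i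
      by (rule continuous_on_product_coordinates)
    then have "continuous_on K (\<lambda>v :: nat \<Rightarrow> real. v i)" for i
      using continuous_on_subset by blast
    then show ?thesis unfolding Q_def by (intro continuous_intros)
  qed
  ultimately obtain v where v: "v \<in> K" and vmax: "\<And>w. w \<in> K \<Longrightarrow> Q w \<le> Q v"
    using continuous_attains_sup[of K Q] compact_orthogonal_sphere[of n m e] unfolding K_def by blast
  define \<Lambda> where "\<Lambda> = Q v"
  have v1: "(\<Sum>i<n. (v i)\<^sup>2) = 1" and vo: "\<And>k. k < m \<Longrightarrow> (\<Sum>i<n. v i * e k i) = 0"
    and v0: "\<And>i. i \<ge> n \<Longrightarrow> v i = 0"
    using v unfolding K_def by auto
  define Bv where "Bv = (\<lambda>i. \<Sum>j<n. B i j * v j)"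
  define r where "r = (\<lambda>i. if i < n then Bv i - \<Lambda> * v i else 0)"
  define R where "R = (\<Sum>i<n. (r i)\<^sup>2)"
  have rv: "(\<Sum>i<n. r i * v i) = 0"
  proof -
    have "(\<Sum>i<n. r i * v i) = (\<Sum>i<n. v i * Bv i) - \<Lambda> * (\<Sum>i<n. (v i)\<^sup>2)"
      unfolding r_def by (simp add: sum_subtractf sum_distrib_left algebra_simps power2_eq_square)
    then show ?thesis using v1 unfolding \<Lambda>_def Q_def Bv_def by simp
  qed
  \<comment> \<open>Symmetry moves \<open>B\<close> onto \<open>e k\<close>: the complement of the
    previous eigenvectors is invariant, so \<open>r\<close> is an admissible direction.\<close>
  have re: "(\<Sum>i<n. r i * e k i) = 0" if "k < m" for k
  proof -
    have "(\<Sum>i<n. r i * e k i) = (\<Sum>i<n. Bv i * e k i) - \<Lambda> * (\<Sum>i<n. v i * e k i)"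
      unfolding r_def by (simp add: sum_subtractf sum_distrib_left algebra_simps)
    also have "(\<Sum>i<n. Bv i * e k i) = (\<Sum>j<n. \<Sum>i<n. v j * (B i j * e k i))"
      unfolding Bv_def sum_distrib_right by (subst sum.swap) (simp add: mult_ac)
    also have "\<dots> = (\<Sum>j<n. \<Sum>i<n. v j * (B j i * e k i))"
      using sym by (intro sum.cong refl) simp
    also have "\<dots> = \<mu> k * (\<Sum>j<n. v j * e k j)"
      using ev[OF that] by (simp add: sum_distrib_left mult_ac flip: sum_distrib_left[of "v _"])
    finally show ?thesis using vo[OF that] by simp
  qed
  have Qle: "Q w \<le> \<Lambda> * (\<Sum>i<n. (w i)\<^sup>2)"
    if w: "(\<Sum>i<n. (w i)\<^sup>2) > 0" "\<And>k. k < m \<Longrightarrow> (\<Sum>i<n. w i * e k i) = 0" "\<And>i. i \<ge> n \<Longrightarrow> w i = 0" for w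
  proof -
    define s where "s = (\<Sum>i<n. (w i)\<^sup>2)"
    have s: "s > 0" using w(1) unfolding s_def .
    have "(\<lambda>i. w i / sqrt s) \<in> K"
      using s w(2,3) unfolding K_def
      by (auto simp: power_divide simp flip: sum_divide_distrib s_def)
    then have "Q (\<lambda>i. w i / sqrt s) \<le> \<Lambda>" using vmax unfolding \<Lambda>_def by blast
    moreover have "Q (\<lambda>i. w i / sqrt s) = Q w / s"
      using s unfolding Q_def by (simp flip: sum_divide_distrib)
    ultimately show ?thesis using s unfolding s_def[symmetric] by (simp add: field_simps)
  qed
  have "R = 0"
  proof (rule ccontr)
    assume "R \<noteq> 0"
    then have R: "R > 0" unfolding R_def
      using sum_nonneg[of "{..<n}" "\<lambda>i. (r i)\<^sup>2"] by (simp add: order.not_eq_order_implies_strict)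
    define D where "D = \<Lambda> * R - Q r"
    \<comment> \<open>Maximality of \<open>v\<close> will give \<open>2 * R \<le> t * D\<close>;
      this step length forces \<open>t * D \<le> R\<close>.\<close>
    define t where "t = R / (\<bar>D\<bar> + 1)"
    have t: "t > 0" using R unfolding t_def by simp
    define w where "w = (\<lambda>i. v i + t * r i)"
    have w2: "(\<Sum>i<n. (w i)\<^sup>2) = 1 + t\<^sup>2 * R"
    proof -
      have "(\<Sum>i<n. (w i)\<^sup>2) = (\<Sum>i<n. (v i)\<^sup>2) + 2 * t * (\<Sum>i<n. r i * v i) + t\<^sup>2 * R"
        unfolding w_def R_def
        by (simp add: power2_eq_square algebra_simps sum.distrib sum_distrib_left)
      then show ?thesis using v1 rv by simp
    qed
    have "Q w \<le> \<Lambda> * (1 + t\<^sup>2 * R)"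
      unfolding w2[symmetric]
    proof (rule Qle)
      show "0 < (\<Sum>i<n. (w i)\<^sup>2)" unfolding w2 using R by (simp add: add_pos_nonneg)
      show "(\<Sum>i<n. w i * e k i) = 0" if "k < m" for k
      proof -
        have "(\<Sum>i<n. w i * e k i) = (\<Sum>i<n. v i * e k i) + t * (\<Sum>i<n. r i * e k i)"
          unfolding w_def by (simp add: algebra_simps sum.distrib sum_distrib_left)
        then show ?thesis using vo[OF that] re[OF that] by simp
      qed
      show "w i = 0" if "i \<ge> n" for i using that v0 unfolding w_def r_def by simp
    qed
    moreover have "Q w = \<Lambda> + 2 * t * R + t\<^sup>2 * Q r"
    proof -
      define Br where "Br = (\<lambda>i. \<Sum>j<n. B i j * r j)"
      have Qr: "Q r = (\<Sum>i<n. r i * Br i)" unfolding Q_def Br_def ..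
      have "(\<Sum>j<n. B i j * w j) = Bv i + t * Br i" for i
        unfolding w_def Bv_def Br_def by (simp add: algebra_simps sum.distrib sum_distrib_left)
      then have "Q w = (\<Sum>i<n. (v i + t * r i) * (Bv i + t * Br i))"
        unfolding Q_def by (simp add: w_def)
      also have "\<dots> = (\<Sum>i<n. v i * Bv i) + t * (\<Sum>i<n. r i * Bv i) + t * (\<Sum>i<n. v i * Br i) + t\<^sup>2 * Q r"
        unfolding Qr
        by (simp add: algebra_simps sum.distrib sum_distrib_left power2_eq_square)
      also have "(\<Sum>i<n. v i * Br i) = (\<Sum>j<n. \<Sum>i<n. r j * (B i j * v i))"
        unfolding Br_def sum_distrib_left by (subst sum.swap) (simp add: mult_ac)
      also have "\<dots> = (\<Sum>i<n. r i * Bv i)"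
        unfolding Bv_def using sym by (simp add: sum_distrib_left)
      also have "(\<Sum>i<n. r i * Bv i) = (\<Sum>i<n. (r i)\<^sup>2) + \<Lambda> * (\<Sum>i<n. r i * v i)"
        unfolding r_def sum_distrib_left sum.distrib[symmetric]
        by (intro sum.cong) (auto simp: algebra_simps power2_eq_square)
      also have "\<dots> = R" using rv unfolding R_def by simp
      finally show ?thesis unfolding \<Lambda>_def Q_def Bv_def by simp
    qed
    ultimately have "t * (2 * R) \<le> t * (t * D)"
      unfolding D_def by (simp add: algebra_simps power2_eq_square)
    then have "2 * R \<le> t * D" using t by simp
    also have "\<dots> \<le> t * (\<bar>D\<bar> + 1)" using t by (intro mult_left_mono) auto
    also have "\<dots> = R" unfolding t_def by simp
    finally show False using R by simp
  qed
  then have "r i = 0" if "i < n" for i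
    using that unfolding R_def by (subst (asm) sum_nonneg_eq_0_iff) auto
  then have vev: "(\<Sum>j<n. B i j * v j) = \<Lambda> * v i" if "i < n" for i
    using that unfolding r_def Bv_def by fastforce
  show ?case
  proof (intro exI conjI allI impI)
    fix k l assume "k < Suc m" "l < Suc m"
    then show "(\<Sum>i<n. (e(m := v)) k i * (e(m := v)) l i) = of_bool (k = l)"
      using on vo vo[unfolded mult.commute[of "v _"]] v1 by (auto simp: less_Suc_eq power2_eq_square)
  next
    fix k i assume "k < Suc m" "i < n"
    then show "(\<Sum>j<n. B i j * (e(m := v)) k j) = (\<mu>(m := \<Lambda>)) k * (e(m := v)) k i"
      using ev vev by (auto simp: less_Suc_eq)
  qed
qed

section \<open>The Laplacian of a connected network and its eigenbasis\<close>

lemma adjacency_entry: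
  assumes "network n A" "i < n" "j < n"
  shows "A $$ (i, j) \<ge> 0" "\<bar>A $$ (i, j)\<bar> \<le> 1"
proof -
  have "A $$ (i, j) \<in> {0, 1}" using assms unfolding network_def by blast
  then show "A $$ (i, j) \<ge> 0" "\<bar>A $$ (i, j)\<bar> \<le> 1" by auto
qed

lemma laplacian_carrier:
  assumes "network n A"
  shows "laplacian A \<in> carrier_mat n n"
  using assms unfolding network_def laplacian_def by auto

lemma laplacian_entry:
  assumes "network n A" "i < n" "j < n"
  shows "laplacian A $$ (i, j) = (if i = j then \<Sum>k<n. A $$ (i, k) else 0) - A $$ (i, j)"
  using assms unfolding network_def laplacian_def by auto

lemma laplacian_sum:
  fixes v :: "nat \<Rightarrow> 'a::real_vector"
  assumes "network n A" "i < n"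
  shows "(\<Sum>j<n. (laplacian A $$ (i, j)) *\<^sub>R v j) = (\<Sum>j<n. A $$ (i, j) *\<^sub>R (v i - v j))"
proof -
  have "(\<Sum>j<n. (laplacian A $$ (i, j)) *\<^sub>R v j)
      = (\<Sum>j<n. (if i = j then (\<Sum>k<n. A $$ (i, k)) *\<^sub>R v j else 0) - A $$ (i, j) *\<^sub>R v j)"
    using assms by (intro sum.cong) (auto simp: laplacian_entry scaleR_diff_left)
  also have "\<dots> = (\<Sum>k<n. A $$ (i, k)) *\<^sub>R v i - (\<Sum>j<n. A $$ (i, j) *\<^sub>R v j)"
    using assms(2) by (simp add: sum_subtractf)
  finally show ?thesis by (simp add: scaleR_sum_left scaleR_diff_right sum_subtractf)
qed

lemma laplacian_symmetric:
  assumes "network n A" "i < n" "j < n"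
  shows "laplacian A $$ (i, j) = laplacian A $$ (j, i)"
  using assms by (auto simp: laplacian_entry network_def)

text \<open>Summation by parts over ordered pairs; every edge occurs in both directions, whence the
  factor 2.\<close>

lemma laplacian_quadratic_form:
  fixes v :: "nat \<Rightarrow> real"
  assumes "network n A"
  shows "2 * (\<Sum>i<n. v i * (\<Sum>j<n. laplacian A $$ (i, j) * v j))
    = (\<Sum>i<n. \<Sum>j<n. A $$ (i, j) * (v i - v j)\<^sup>2)"
proof -
  have *: "(\<Sum>i<n. v i * (\<Sum>j<n. laplacian A $$ (i, j) * v j))
      = (\<Sum>i<n. \<Sum>j<n. A $$ (i, j) * (v i * (v i - v j)))"
    using laplacian_sum[OF assms, of _ v] by (simp add: sum_distrib_left mult_ac)
  also have "\<dots> = (\<Sum>i<n. \<Sum>j<n. A $$ (i, j) * (v j * (v j - v i)))"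
    using assms unfolding network_def by (subst sum.swap) (auto intro!: sum.cong)
  finally have "2 * (\<Sum>i<n. v i * (\<Sum>j<n. laplacian A $$ (i, j) * v j))
      = (\<Sum>i<n. \<Sum>j<n. A $$ (i, j) * (v i * (v i - v j)))
        + (\<Sum>i<n. \<Sum>j<n. A $$ (i, j) * (v j * (v j - v i)))"
    using * by simp
  also have "\<dots> = (\<Sum>i<n. \<Sum>j<n. A $$ (i, j) * (v i - v j)\<^sup>2)"
    unfolding sum.distrib[symmetric]
    by (intro sum.cong refl) (simp add: power2_eq_square algebra_simps)
  finally show ?thesis .
qed

text \<open>Rows and columns of the matrix of the \<open>e k\<close> are both orthonormal: the first
  clause is used to project onto a mode, the second is completeness and recovers a state from its
  modes.\<close>

definition laplacian_eigenbasis where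
  "laplacian_eigenbasis n A e \<mu> \<longleftrightarrow>
    (\<forall>k<n. \<forall>l<n. (\<Sum>i<n. e k i * e l i) = of_bool (k = l))
    \<and> (\<forall>i<n. \<forall>j<n. (\<Sum>k<n. e k i * e k j) = of_bool (i = j))
    \<and> (\<forall>k<n. \<forall>i<n. (\<Sum>j<n. laplacian A $$ (i, j) * e k j) = \<mu> k * e k i)"

text \<open>For \<open>n\<close> orthonormal vectors the residual projection has squared Frobenius
  norm \<open>n - n\<close>, hence vanishes entrywise; this is completeness.\<close>

lemma laplacian_eigenbasis_exists:
  assumes "network n A"
  obtains e \<mu> where "laplacian_eigenbasis n A e (\<mu> :: nat \<Rightarrow> real)"
proof -
  obtain e \<mu> where
    "\<forall>k<n. \<forall>l<n. (\<Sum>i<n. e k i * e l i) = of_bool (k = l)" and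
    ev: "\<forall>k<n. \<forall>i<n. (\<Sum>j<n. laplacian A $$ (i, j) * e k j) = \<mu> k * e k i"
    using symmetric_orthonormal_eigenvectors[of n "\<lambda>i j. laplacian A $$ (i, j)" n]
      laplacian_symmetric[OF assms] by auto
  then have on: "\<And>k l. k < n \<Longrightarrow> l < n \<Longrightarrow> (\<Sum>i<n. e k i * e l i) = of_bool (k = l)"
    by blast
  have "(\<Sum>i<n. \<Sum>j<n. (of_bool (i = j) - (\<Sum>k<n. e k i * e k j))\<^sup>2) = 0"
    using orthonormal_residual(2)[OF on] by simp
  then have "\<forall>i<n. (\<Sum>j<n. (of_bool (i = j) - (\<Sum>k<n. e k i * e k j))\<^sup>2) = 0"
    by (subst (asm) sum_nonneg_eq_0_iff) (auto intro: sum_nonneg)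
  then have "\<forall>i<n. \<forall>j<n. (of_bool (i = j) - (\<Sum>k<n. e k i * e k j))\<^sup>2 = 0"
    by (subst (asm) sum_nonneg_eq_0_iff) auto
  then have "\<forall>i<n. \<forall>j<n. (\<Sum>k<n. e k i * e k j) = of_bool (i = j)" by simp
  with on ev have "laplacian_eigenbasis n A e \<mu>"
    unfolding laplacian_eigenbasis_def by blast
  then show thesis by (rule that)
qed

context
  fixes n :: nat and A :: "real mat" and e :: "nat \<Rightarrow> nat \<Rightarrow> real" and \<mu> :: "nat \<Rightarrow> real"
  assumes net: "network n A" and eb: "laplacian_eigenbasis n A e \<mu>"
begin

lemma eigenvalue_quadratic_form:
  assumes "k < n"
  shows "2 * \<mu> k = (\<Sum>i<n. \<Sum>j<n. A $$ (i, j) * (e k i - e k j)\<^sup>2)"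
proof -
  have "(\<Sum>i<n. e k i * (\<Sum>j<n. laplacian A $$ (i, j) * e k j)) = \<mu> k * (\<Sum>i<n. e k i * e k i)"
    unfolding sum_distrib_left[of "\<mu> k"]
    using eb assms by (intro sum.cong refl) (simp add: laplacian_eigenbasis_def)
  then show ?thesis
    using laplacian_quadratic_form[OF net, of "e k"] eb assms
    unfolding laplacian_eigenbasis_def by simp
qed

lemma eigenvalue_nonneg: 
  assumes "k < n"
  shows "\<mu> k \<ge> 0"
proof -
  have "0 \<le> (\<Sum>i<n. \<Sum>j<n. A $$ (i, j) * (e k i - e k j)\<^sup>2)"
    by (intro sum_nonneg mult_nonneg_nonneg) (auto intro: adjacency_entry[OF net])
  then show ?thesis using eigenvalue_quadratic_form[OF assms] by simp
qed

text \<open>A zero eigenvalue makes every term of the nonnegative quadratic form vanish, so the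
  eigenvector agrees across each edge and, by connectivity, everywhere.\<close>

lemma eigenvalue_0_constant:
  assumes k: "k < n" "\<mu> k = 0" and "i < n" "j < n"
  shows "e k i = e k j"
proof -
  have nonneg: "0 \<le> A $$ (i, j) * (e k i - e k j)\<^sup>2" if "i < n" "j < n" for i j
    using adjacency_entry[OF net that] by simp
  have "(\<Sum>i<n. \<Sum>j<n. A $$ (i, j) * (e k i - e k j)\<^sup>2) = 0"
    using eigenvalue_quadratic_form[OF k(1)] k(2) by simp
  then have "\<forall>i\<in>{..<n}. (\<Sum>j<n. A $$ (i, j) * (e k i - e k j)\<^sup>2) = 0"
    by (intro sum_nonneg_eq_0_iff[THEN iffD1]) (auto intro!: sum_nonneg nonneg)
  then have Z: "\<forall>j\<in>{..<n}. A $$ (i, j) * (e k i - e k j)\<^sup>2 = 0" if "i < n" for i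
    using that by (intro sum_nonneg_eq_0_iff[THEN iffD1]) (auto intro!: nonneg)
  have step_eq: "e k i = e k j" if "(i, j) \<in> {(k, l). k < n \<and> l < n \<and> A $$ (k, l) = 1}" for i j
    using that Z[rule_format, of i j] by auto
  have "(i, j) \<in> {(k, l). k < n \<and> l < n \<and> A $$ (k, l) = 1}\<^sup>*"
    using net assms(3,4) unfolding network_def by blast
  then show ?thesis
  proof (induction rule: rtrancl_induct)
    case (step y z)
    then show ?case using step_eq[OF step(2)] by simp
  qed simp
qed

text \<open>Two eigenvectors for 0 would both be constant, and constant unit vectors are never
  orthogonal.\<close>

lemma eigenvalue_0_simple:
  assumes "k < n" "l < n" "k \<noteq> l" "\<mu> k = 0"
  shows "\<mu> l \<noteq> 0"
proof
  assume l: "\<mu> l = 0"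
  have k0: "e k i = e k 0" if "i < n" for i
    using eigenvalue_0_constant[OF assms(1,4) that, of 0] that by simp
  have l0: "e l i = e l 0" if "i < n" for i
    using eigenvalue_0_constant[OF assms(2) l that, of 0] that by simp
  have "(\<Sum>i<n. e k i * e l i) = (\<Sum>i<n. e k 0 * e l 0)"
    "(\<Sum>i<n. e k i * e k i) = (\<Sum>i<n. e k 0 * e k 0)"
    "(\<Sum>i<n. e l i * e l i) = (\<Sum>i<n. e l 0 * e l 0)"
    by (rule sum.cong[OF refl], metis k0 l0 lessThan_iff)+
  moreover have "(\<Sum>i<n. e k i * e l i) = 0" "(\<Sum>i<n. e k i * e k i) = 1" "(\<Sum>i<n. e l i * e l i) = 1"
    using eb assms unfolding laplacian_eigenbasis_def by simp_all
  ultimately show False by auto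
qed

lemma nonzero_eigenvalue_exists: "\<exists>k<n. \<mu> k \<noteq> 0"
proof (cases "\<mu> 0 = 0")
  case True
  then show ?thesis
    using eigenvalue_0_simple[of 0 1] net by (intro exI[of _ 1]) (simp add: network_def)
next
  case False
  then show ?thesis using net by (intro exI[of _ 0]) (simp add: network_def)
qed

text \<open>Symmetry makes the column sums of the Laplacian vanish. A vanishing entry sum allows a
  common vector to be subtracted at all nodes without changing the mode; this is how the synchronous
  part of the motion drops out.\<close>

lemma eigenvector_sum_0:
  assumes k: "k < n" "\<mu> k \<noteq> 0"
  shows "(\<Sum>i<n. e k i) = 0"
proof -
  have col: "(\<Sum>i<n. laplacian A $$ (i, j)) = 0" if "j < n" for j
    using laplacian_sum[OF net that, of "\<lambda>_. 1 :: real"] laplacian_symmetric[OF net _ that]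
    by simp
  have "\<mu> k * (\<Sum>i<n. e k i) = (\<Sum>i<n. \<Sum>j<n. laplacian A $$ (i, j) * e k j)"
    using eb k unfolding laplacian_eigenbasis_def by (simp add: sum_distrib_left)
  also have "\<dots> = 0"
    using col by (subst sum.swap) (simp flip: sum_distrib_right)
  finally show ?thesis using k by simp
qed

text \<open>Diffusive coupling acts on mode \<open>k\<close> as multiplication by
  \<open>- \<mu> k\<close>. Vector-valued \<open>y\<close> covers both the states and their images
  under \<Gamma>.\<close>

lemma eigenvector_coupling_sum:
  fixes y :: "nat \<Rightarrow> 'a::real_vector"
  assumes k: "k < n"
  shows "(\<Sum>i<n. e k i *\<^sub>R (\<Sum>j<n. A $$ (i, j) *\<^sub>R (y j - y i))) = - \<mu> k *\<^sub>R (\<Sum>i<n. e k i *\<^sub>R y i)"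
proof -
  have "(\<Sum>j<n. A $$ (i, j) *\<^sub>R (y j - y i)) = - (\<Sum>j<n. (laplacian A $$ (i, j)) *\<^sub>R y j)" if "i < n" for i
    unfolding laplacian_sum[OF net that] sum_negf[symmetric]
    by (intro sum.cong refl) (simp add: algebra_simps)
  then have "(\<Sum>i<n. e k i *\<^sub>R (\<Sum>j<n. A $$ (i, j) *\<^sub>R (y j - y i)))
      = - (\<Sum>i<n. \<Sum>j<n. (laplacian A $$ (i, j) * e k i) *\<^sub>R y j)"
    by (simp add: scaleR_sum_right sum_negf mult.commute)
  also have "\<dots> = - (\<Sum>j<n. (\<Sum>i<n. laplacian A $$ (j, i) * e k i) *\<^sub>R y j)"
    unfolding scaleR_sum_left using laplacian_symmetric[OF net]
    by (subst sum.swap) (auto intro!: sum.cong)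
  also have "\<dots> = - \<mu> k *\<^sub>R (\<Sum>j<n. e k j *\<^sub>R y j)"
    using eb k unfolding laplacian_eigenbasis_def by (simp add: scaleR_sum_right sum_negf)
  finally show ?thesis .
qed

lemma eigenbasis_expansion:
  fixes y :: "nat \<Rightarrow> 'a::real_vector"
  assumes "i < n"
  shows "y i = (\<Sum>k<n. e k i *\<^sub>R (\<Sum>j<n. e k j *\<^sub>R y j))"
proof -
  have "(\<Sum>k<n. e k i *\<^sub>R (\<Sum>j<n. e k j *\<^sub>R y j)) = (\<Sum>j<n. (\<Sum>k<n. e k i * e k j) *\<^sub>R y j)"
    unfolding scaleR_sum_right scaleR_sum_left by (subst sum.swap) simp
  also have "\<dots> = y i"
    using eb assms unfolding laplacian_eigenbasis_def
    by (simp add: of_bool_def if_distrib[of "\<lambda>x. x *\<^sub>R _"] cong: if_cong)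
  finally show ?thesis by simp
qed

lemma eigenvector_entry_le_1:
  assumes "k < n" "i < n"
  shows "\<bar>e k i\<bar> \<le> 1"
proof -
  have "e k i * e k i \<le> (\<Sum>i<n. e k i * e k i)"
    using assms by (intro member_le_sum) auto
  then have "(e k i)\<^sup>2 \<le> 1"
    using eb assms unfolding laplacian_eigenbasis_def by (simp add: power2_eq_square)
  then show ?thesis by (simp add: abs_square_le_1)
qed

text \<open>Links the eigenbasis to \<open>lambda2\<close>, which is defined through roots of the
  characteristic polynomial: the \<open>e k\<close> form an orthogonal matrix that conjugates the
  Laplacian to a diagonal one.\<close>

lemma char_poly_laplacian:
  "char_poly (laplacian A) = (\<Prod>a \<leftarrow> map \<mu> [0..<n]. [:- a, 1:])"
proof -
  define Q where "Q = Matrix.mat n n (\<lambda>(i, k). e k i)"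
  define D where "D = Matrix.mat n n (\<lambda>(i, k). if i = k then \<mu> k else 0)"
  have Q: "Q \<in> carrier_mat n n" and QT: "transpose_mat Q \<in> carrier_mat n n"
    and D: "D \<in> carrier_mat n n" unfolding Q_def D_def by auto
  note L = laplacian_carrier[OF net]
  have 1: "transpose_mat Q * Q = 1\<^sub>m n"
    using eb unfolding Q_def laplacian_eigenbasis_def
    by (intro eq_matI) (auto simp: scalar_prod_def lessThan_atLeast0)
  have 2: "Q * transpose_mat Q = 1\<^sub>m n"
    using eb unfolding Q_def laplacian_eigenbasis_def
    by (intro eq_matI) (auto simp: scalar_prod_def lessThan_atLeast0)
  have "laplacian A * Q = Q * D"
  proof (rule eq_matI)
    fix i k assume "i < dim_row (Q * D)" "k < dim_col (Q * D)"
    then have ik: "i < n" "k < n" unfolding Q_def D_def by auto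
    have "(laplacian A * Q) $$ (i, k) = (\<Sum>j<n. laplacian A $$ (i, j) * e k j)"
      using ik L unfolding Q_def by (auto simp: scalar_prod_def lessThan_atLeast0)
    also have "\<dots> = \<mu> k * e k i"
      using eb ik unfolding laplacian_eigenbasis_def by simp
    also have "\<dots> = (Q * D) $$ (i, k)"
      using ik unfolding Q_def D_def
      by (simp add: scalar_prod_def if_distrib[of "\<lambda>x. _ * x"] cong: if_cong)
    finally show "(laplacian A * Q) $$ (i, k) = (Q * D) $$ (i, k)" .
  qed (use L in \<open>auto simp: Q_def D_def\<close>)
  then have "Q * D * transpose_mat Q = laplacian A * (Q * transpose_mat Q)"
    using assoc_mult_mat[OF L Q QT] by simp
  also have "\<dots> = laplacian A" using L unfolding 2 by simp
  finally have "similar_mat (laplacian A) D"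
    unfolding similar_mat_def similar_mat_wit_def
    using 1 2 L Q QT D by (intro exI[of _ Q] exI[of _ "transpose_mat Q"]) (auto simp: Let_def)
  then have "char_poly (laplacian A) = char_poly D" by (rule char_poly_similar)
  also have "\<dots> = (\<Prod>a \<leftarrow> diag_mat D. [:- a, 1:])"
    by (rule char_poly_upper_triangular[OF D]) (auto simp: D_def)
  also have "diag_mat D = map \<mu> [0..<n]"
    unfolding diag_mat_def D_def by (auto intro: map_cong)
  finally show ?thesis .
qed

end

lemma proots_linear_factors: "proots (\<Prod>a\<leftarrow>xs. [:- a, 1:]) = mset (xs :: real list)"
proof (induction xs)
  case (Cons a xs)
  have "proots ([:- a, 1:] * (\<Prod>a\<leftarrow>xs. [:- a, 1:])) = proots [:- a, 1:] + proots (\<Prod>a\<leftarrow>xs. [:- a, 1:])"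
    by (rule proots_mult) (auto simp: prod_list_zero_iff)
  then show ?case using Cons.IH by (simp del: mult_pCons_left)
qed simp

text \<open>At most one eigenvalue vanishes, so the second in increasing order is positive. This
  turns the lower bound on \<alpha> into positivity of the rate \<nu>.\<close>

lemma lambda2_pos:
  assumes net: "network n A"
  shows "lambda2 A > 0"
proof -
  obtain e \<mu> where eb: "laplacian_eigenbasis n A e \<mu>"
    using laplacian_eigenbasis_exists[OF net] .
  define xs where "xs = map \<mu> [0..<n]"
  have n: "n \<ge> 2" using net unfolding network_def by simp
  have l2: "lambda2 A = sort xs ! 1"
    unfolding lambda2_def laplacian_eigenvalues_def char_poly_laplacian[OF net eb]
      proots_linear_factors xs_def sorted_list_of_multiset_mset ..
  \<comment> \<open>Sorting permutes the indices, so positions 0 and 1 of the sorted list belong to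
    different modes.\<close>
  obtain p where p: "p permutes {..<length xs}" and "permute_list p xs = sort xs"
    using mset_eq_permutation[of "sort xs" xs] by auto
  then have sx: "p i < n" "sort xs ! i = \<mu> (p i)" if "i < n" for i
    using that permutes_in_image[OF p, of i] permute_list_nth[OF p, of i]
    by (auto simp: xs_def)
  have "p 0 \<noteq> p 1"
    using permutes_inj[OF p] by (metis inj_eq zero_neq_one)
  then have "\<mu> (p 0) \<noteq> 0 \<or> \<mu> (p 1) \<noteq> 0"
    using eigenvalue_0_simple[OF net eb, of "p 0" "p 1"] sx n by auto
  moreover have "\<mu> (p 0) \<le> \<mu> (p 1)"
    using sorted_nth_mono[of "sort xs" 0 1] sx[of 0] sx[of 1] n by (simp add: xs_def)
  moreover have "\<mu> (p 0) \<ge> 0"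
    using eigenvalue_nonneg[OF net eb] sx n by simp
  ultimately have "\<mu> (p 1) > 0" by linarith
  then show ?thesis using l2 sx n by simp
qed

text \<open>This norm is in the denominator of the bound on \<delta>; its positivity makes the bound
  admit \<delta> = 0. A nonzero eigenvalue forces a nonzero entry.\<close>

lemma row_sum_norm_laplacian_pos:
  assumes net: "network n A"
  shows "row_sum_norm_mat (laplacian A) > 0"
proof -
  obtain e \<mu> where eb: "laplacian_eigenbasis n A e \<mu>"
    using laplacian_eigenbasis_exists[OF net] .
  obtain k where k: "k < n" "\<mu> k \<noteq> 0"
    using nonzero_eigenvalue_exists[OF net eb] by blast
  have "(\<Sum>i<n. e k i * e k i) = 1"
    using eb k unfolding laplacian_eigenbasis_def by simp
  then obtain i where i: "i < n" "e k i \<noteq> 0"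
    by (metis (no_types, lifting) lessThan_iff mult_zero_left sum.neutral zero_neq_one)
  have "(\<Sum>j<n. laplacian A $$ (i, j) * e k j) \<noteq> 0"
    using eb k i unfolding laplacian_eigenbasis_def by simp
  then obtain j where j: "j < n" "laplacian A $$ (i, j) \<noteq> 0"
    by (metis (no_types, lifting) lessThan_iff mult_zero_left sum.neutral)
  have "0 < \<bar>laplacian A $$ (i, j)\<bar>" using j by simp
  also have "\<dots> \<le> (\<Sum>j<n. \<bar>laplacian A $$ (i, j)\<bar>)"
    using j by (intro member_le_sum) auto
  also have "\<dots> \<le> row_sum_norm_mat (laplacian A)"
    using laplacian_carrier[OF net] i unfolding row_sum_norm_mat_def by (intro Max_ge) auto
  finally show ?thesis .
qed

subsection \<open>Confinement near the synchronization manifold\<close>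

lemma norm_matrix_vector_le:
  fixes M :: "real ^ 'q ^ 'q"
  assumes "\<And>i j. \<bar>M $ i $ j\<bar> \<le> B"
  shows "norm (M *v x) \<le> real CARD('q) * real CARD('q) * B * norm x"
proof -
  have "norm (M *v x) \<le> onorm ((*v) M) * norm x"
    by (rule onorm) simp
  also have "\<dots> \<le> real CARD('q) * real CARD('q) * B * norm x"
    using onorm_le_matrix_component[of M, OF assms] by (rule mult_right_mono) simp
  finally show ?thesis .
qed

lemma norm_matrix_vector_le_norm:
  fixes M :: "real ^ 'q ^ 'q"
  shows "norm (M *v x) \<le> real CARD('q) * real CARD('q) * norm M * norm x"
proof (rule norm_matrix_vector_le)
  fix i j
  have "\<bar>M $ i $ j\<bar> \<le> norm (M $ i)" by (rule component_le_norm_cart)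
  also have "\<dots> \<le> norm M" by (rule Finite_Cartesian_Product.norm_nth_le)
  finally show "\<bar>M $ i $ j\<bar> \<le> norm M" .
qed

lemma norm_matrix_vector_le_row_sum_norm:
  fixes M :: "real ^ 'q ^ 'q"
  shows "norm (M *v x) \<le> real CARD('q) * real CARD('q) * row_sum_norm M * norm x"
proof (rule norm_matrix_vector_le)
  fix i j
  have "\<bar>M $ i $ j\<bar> \<le> (\<Sum>j\<in>UNIV. \<bar>M $ i $ j\<bar>)" by (rule member_le_sum) auto
  also have "\<dots> \<le> row_sum_norm M" unfolding row_sum_norm_def by (rule Max_ge) auto
  finally show "\<bar>M $ i $ j\<bar> \<le> row_sum_norm M" .
qed

text \<open>Uniform continuity of the Jacobian on the compact set is fed into the mean value
  inequality along segments. One radius serves all base points, as needed along trajectories whose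
  position in the ball is unknown.\<close>

lemma compact_convex_C1_uniformly_differentiable:
  fixes f :: "real ^ 'q \<Rightarrow> real ^ 'q"
  assumes f: "\<And>x. f differentiable (at x)" and cont: "continuous_on UNIV (\<lambda>x. jacobian f (at x))"
    and S: "compact S" "convex S" and \<kappa>: "\<kappa> > 0"
  obtains d where "d > 0" "\<And>x y. x \<in> S \<Longrightarrow> y \<in> S \<Longrightarrow> norm (y - x) < d \<Longrightarrow>
    norm (f y - f x - jacobian f (at x) *v (y - x)) \<le> \<kappa> * norm (y - x)"
proof -
  define m where "m = real CARD('q) * real CARD('q)"
  have m: "m > 0" unfolding m_def by simp
  have "uniformly_continuous_on S (\<lambda>x. jacobian f (at x))"
    using cont S by (intro compact_uniformly_continuous) (auto elim: continuous_on_subset)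
  then obtain d where d: "d > 0" "\<And>x x'. x \<in> S \<Longrightarrow> x' \<in> S \<Longrightarrow> dist x' x < d \<Longrightarrow>
      dist (jacobian f (at x')) (jacobian f (at x)) < \<kappa> / m"
    using \<kappa> m unfolding uniformly_continuous_on_def by (metis divide_pos_pos)
  show thesis
  proof (rule that[OF d(1)])
    fix x y assume xy: "x \<in> S" "y \<in> S" "norm (y - x) < d"
    have "norm (f y - f x - (jacobian f (at x) *v (y - x))) \<le> norm (y - x) * \<kappa>"
    proof (rule differentiable_bound_linearization[where S = "closed_segment x y" and f' = "\<lambda>x. (*v) (jacobian f (at x))"])
      show "x + t *\<^sub>R (y - x) \<in> closed_segment x y" if "t \<in> {0..1}" for t
        using that unfolding closed_segment_def
        by (intro CollectI exI[of _ t]) (simp add: algebra_simps)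
      show "(f has_derivative (*v) (jacobian f (at z))) (at z within closed_segment x y)" for z
        by (rule has_derivative_at_withinI[OF iffD1[OF jacobian_works f]])
      show "x \<in> closed_segment x y" by simp
      fix z assume z: "z \<in> closed_segment x y"
      then have "z \<in> S" using S xy closed_segment_subset by blast
      moreover have "dist z x < d"
        using z xy(3) dist_in_closed_segment[OF z] by (simp add: dist_norm norm_minus_commute)
      ultimately have J: "norm (jacobian f (at z) - jacobian f (at x)) < \<kappa> / m"
        using d(2)[of x z] xy by (simp add: dist_norm)
      show "onorm ((*v) (jacobian f (at z)) - (*v) (jacobian f (at x))) \<le> \<kappa>"
      proof (rule onorm_bound)
        fix w
        have "norm ((jacobian f (at z) - jacobian f (at x)) *v w) \<le> m * (\<kappa> / m) * norm w"
          using norm_matrix_vector_le_norm[of "jacobian f (at z) - jacobian f (at x)" w] J m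
          unfolding m_def[symmetric]
          by (meson less_imp_le mult_left_mono mult_right_mono norm_ge_zero order_trans)
        then show "norm (((*v) (jacobian f (at z)) - (*v) (jacobian f (at x))) w) \<le> \<kappa> * norm w"
          using m by (simp add: matrix_vector_mult_diff_rdistrib)
      qed (use \<kappa> in simp)
    qed
    then show "norm (f y - f x - jacobian f (at x) *v (y - x)) \<le> \<kappa> * norm (y - x)"
      by (simp add: mult.commute)
  qed
qed

lemma compact_convex_C1_lipschitz:
  fixes f :: "real ^ 'q \<Rightarrow> real ^ 'q"
  assumes f: "\<And>x. f differentiable (at x)" and cont: "continuous_on UNIV (\<lambda>x. jacobian f (at x))"
    and S: "compact S" "convex S"
  obtains L where "L > 0" "\<And>x v. x \<in> S \<Longrightarrow> norm (jacobian f (at x) *v v) \<le> L * norm v"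
    "\<And>x y. x \<in> S \<Longrightarrow> y \<in> S \<Longrightarrow> norm (f x - f y) \<le> L * norm (x - y)"
proof -
  have "compact ((\<lambda>x. jacobian f (at x)) ` S)"
    using cont S by (intro compact_continuous_image) (auto elim: continuous_on_subset)
  then have "bounded ((\<lambda>x. jacobian f (at x)) ` S)" by (rule compact_imp_bounded)
  then obtain B where B: "B > 0" "\<And>x. x \<in> S \<Longrightarrow> norm (jacobian f (at x)) \<le> B"
    unfolding bounded_pos by auto
  define L where "L = real CARD('q) * real CARD('q) * B"
  have L: "L > 0" unfolding L_def using B by simp
  have J: "norm (jacobian f (at x) *v v) \<le> L * norm v" if "x \<in> S" for x v
  proof -
    have "norm (jacobian f (at x) *v v) \<le> real CARD('q) * real CARD('q) * norm (jacobian f (at x)) * norm v"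
      by (rule norm_matrix_vector_le_norm)
    also have "\<dots> \<le> L * norm v"
      unfolding L_def using B(2)[OF that] by (intro mult_right_mono mult_left_mono) auto
    finally show ?thesis .
  qed
  have der: "(f has_derivative (*v) (jacobian f (at z))) (at z within S)" for z
    by (rule has_derivative_at_withinI[OF iffD1[OF jacobian_works f]])
  have on: "onorm ((*v) (jacobian f (at z))) \<le> L" if "z \<in> S" for z
    using J[OF that] L by (intro onorm_bound) auto
  show thesis
    by (rule that[OF L J differentiable_bound[OF S(2) der on]])
qed

text \<open>Compactness of the sphere provides an inward margin against which the coupling terms can
  be weighed.\<close>

lemma inflowing_uniform:
  fixes f :: "'a::euclidean_space \<Rightarrow> 'a"
  assumes "continuous_on UNIV f" "\<And>x. x \<in> sphere c r \<Longrightarrow> inner (f x) (x - c) < 0"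
  obtains \<kappa> where "\<kappa> > 0" "\<And>x. x \<in> sphere c r \<Longrightarrow> inner (f x) (x - c) \<le> - \<kappa>"
proof (cases "sphere c r = {}")
  case True
  then show thesis using that[of 1] by simp
next
  case False
  have "continuous_on (sphere c r) (\<lambda>x. inner (f x) (x - c))"
    using assms(1) by (intro continuous_intros) (auto elim: continuous_on_subset)
  then obtain z where z: "z \<in> sphere c r" "\<forall>x\<in>sphere c r. inner (f x) (x - c) \<le> inner (f z) (z - c)"
    using continuous_attains_sup[OF compact_sphere False] by blast
  show thesis
    using z assms(2)[OF z(1)] by (intro that[of "- inner (f z) (z - c)"]) auto
qed

section \<open>First exit from the ball and from the nearly synchronous regime\<close>

lemma continuous_on_left_limit_in_closed:
  fixes g :: "real \<Rightarrow> 'a::t2_space"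
  assumes "closed S" "continuous_on {a..t} g" "a < t" "\<And>s. s \<in> {a..<t} \<Longrightarrow> g s \<in> S"
  shows "g t \<in> S"
proof (rule Lim_in_closed_set[OF assms(1)])
  show "(g \<longlongrightarrow> g t) (at_left t)"
    using assms(2,3) by (auto simp: continuous_on_def at_within_Icc_at_left dest: bspec[of _ _ t])
  show "\<forall>\<^sub>F s in at_left t. g s \<in> S"
    using assms(3,4) by (subst eventually_at_left[OF assms(3)]) auto
qed simp

text \<open>At a first contact with the sphere the squared distance to \<open>c\<close> would have a
  negative derivative, although it was smaller just before.\<close>

lemma stays_inside_ball:
  fixes y :: "real \<Rightarrow> 'a::real_inner"
  assumes at: "a < t" and inside: "\<And>s. s \<in> {a..<t} \<Longrightarrow> y s \<in> ball c r"
    and t: "y t \<in> cball c r"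
    and der: "(y has_vector_derivative y') (at t within {a..t})"
    and inward: "norm (y t - c) = r \<Longrightarrow> inner y' (y t - c) < 0"
  shows "y t \<in> ball c r"
proof (rule ccontr)
  assume "y t \<notin> ball c r"
  then have eq: "norm (y t - c) = r" using t by (simp add: dist_norm norm_minus_commute)
  have "((\<lambda>s. inner (y s - c) (y s - c)) has_real_derivative 2 * inner y' (y t - c)) (at t within {a..t})"
    using der unfolding has_vector_derivative_def has_field_derivative_def
    by (auto intro!: derivative_eq_intros simp: inner_commute algebra_simps fun_eq_iff)
  from has_real_derivative_neg_dec_left[OF this] inward[OF eq] obtain d where d: "d > 0"
    "\<forall>h>0. t - h \<in> {a..t} \<longrightarrow> h < d \<longrightarrow> inner (y t - c) (y t - c) < inner (y (t - h) - c) (y (t - h) - c)"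
    by auto
  define h where "h = min (d / 2) (t - a)"
  have h: "h > 0" "h < d" "t - h \<in> {a..<t}" using d(1) at unfolding h_def by auto
  have "r\<^sup>2 < (norm (y (t - h) - c))\<^sup>2"
    using d(2)[rule_format, of h] h unfolding eq[symmetric] power2_norm_eq_inner by simp
  moreover have "norm (y (t - h) - c) < r"
    using inside[OF h(3)] by (simp add: dist_norm norm_minus_commute)
  ultimately show False
    using power_strict_mono[of "norm (y (t - h) - c)" r 2] by simp
qed

text \<open>Real induction; the base case is \<open>step\<close> at \<open>t = a\<close>, where its
  premise is vacuous. The infimum of the counterexamples satisfies \<open>P\<close> by
  \<open>step\<close>, and then \<open>opn\<close> pushes all counterexamples away from it.\<close>

lemma real_interval_induct:
  fixes a T :: real
  assumes step: "\<And>t. t \<in> {a..<T} \<Longrightarrow> (\<And>s. s \<in> {a..<t} \<Longrightarrow> P s) \<Longrightarrow> P t"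
    and opn: "\<And>t. t \<in> {a..<T} \<Longrightarrow> P t \<Longrightarrow> \<exists>d>0. \<forall>s\<in>{a..<T}. \<bar>s - t\<bar> < d \<longrightarrow> P s"
    and t: "t \<in> {a..<T}"
  shows "P t"
proof (rule ccontr)
  assume nP: "\<not> P t"
  define B where "B = {s \<in> {a..<T}. \<not> P s}"
  have B: "t \<in> B" "bdd_below B" using t nP unfolding B_def by (auto intro: bdd_belowI[of _ a])
  define m where "m = Inf B"
  have m: "a \<le> m" "m \<le> t"
    unfolding m_def using B by (auto intro!: cInf_greatest cInf_lower simp: B_def)
  then have mI: "m \<in> {a..<T}" using t by auto
  have "P s" if "s \<in> {a..<m}" for s
  proof (rule ccontr)
    assume "\<not> P s"
    then have "s \<in> B" using that mI unfolding B_def by auto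
    then have "m \<le> s" using B(2) unfolding m_def by (rule cInf_lower)
    then show False using that by simp
  qed
  then have Pm: "P m" using step[OF mI] by blast
  then obtain d where d: "d > 0" "\<forall>s\<in>{a..<T}. \<bar>s - m\<bar> < d \<longrightarrow> P s"
    using opn[OF mI] by blast
  have "m + d \<le> Inf B"
  proof (rule cInf_greatest)
    fix s assume s: "s \<in> B"
    then have "m \<le> s" using B(2) unfolding m_def by (intro cInf_lower)
    then show "m + d \<le> s" using d(2) s unfolding B_def by force
  qed (use B in auto)
  then show False using d(1) unfolding m_def by simp
qed

text \<open>A bootstrap: \<open>growth\<close> and \<open>inward\<close> are assumed only while the
  nodes lie in the closed ball and within \<open>r1\<close> of each other. As long as they do,
  Gronwall's inequality gives the bound \<open>M * \<sigma>\<close>, and because this is strictly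
  below \<open>r1\<close> the regime cannot end. In \<open>M\<close> the first \<open>n * n\<close>
  counts the pairs whose initial differences are summed, the second is the size of the family in
  Gronwall's inequality.\<close>

lemma network_confinement:
  fixes y v :: "nat \<Rightarrow> real \<Rightarrow> 'a::euclidean_space" and a T \<tau> \<sigma> b r r1 t :: real and n :: nat
  defines "M \<equiv> real (n * n) * exp (real (n * n) * b * \<tau>)"
  assumes der: "\<And>i t. i < n \<Longrightarrow> t \<in> {a..<T} \<Longrightarrow> (y i has_vector_derivative v i t) (at t within {a..<T})"
    and T: "T \<le> a + \<tau>" and b: "b > 0" and \<sigma>: "\<sigma> \<ge> 0"
    and init: "\<And>i. i < n \<Longrightarrow> y i a \<in> ball c r"
      "\<And>i j. i < n \<Longrightarrow> j < n \<Longrightarrow> norm (y j a - y i a) \<le> \<sigma>"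
    and small: "M * \<sigma> < r1"
    and growth: "\<And>i j t. i < n \<Longrightarrow> j < n \<Longrightarrow> t \<in> {a..<T} \<Longrightarrow> \<forall>k<n. y k t \<in> cball c r \<Longrightarrow>
      \<forall>k<n. \<forall>l<n. norm (y l t - y k t) \<le> r1 \<Longrightarrow>
      norm (v j t - v i t) \<le> b * (\<Sum>(k, l)\<in>{..<n} \<times> {..<n}. norm (y l t - y k t))"
    and inward: "\<And>i t. i < n \<Longrightarrow> t \<in> {a..<T} \<Longrightarrow> \<forall>k<n. y k t \<in> cball c r \<Longrightarrow>
      \<forall>k<n. \<forall>l<n. norm (y l t - y k t) \<le> r1 \<Longrightarrow> norm (y i t - c) = r \<Longrightarrow>
      inner (v i t) (y i t - c) < 0"
    and t: "t \<in> {a..<T}"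
  shows "\<forall>i<n. y i t \<in> ball c r \<and> (\<forall>j<n. norm (y j t - y i t) \<le> M * \<sigma>)"
proof -
  define P where "P = (\<lambda>t. \<forall>i<n. y i t \<in> ball c r \<and> (\<forall>j<n. norm (y j t - y i t) \<le> M * \<sigma>))"
  \<comment> \<open>\<open>R\<close> is the open condition propagated by real induction;
    \<open>P\<close> is the stronger conclusion, which needs \<open>R\<close> at earlier times
    only.\<close>
  define R where "R = (\<lambda>t. (\<forall>i<n. y i t \<in> ball c r) \<and> (\<forall>i<n. \<forall>j<n. norm (y j t - y i t) < r1))"
  have PR: "R t" if "P t" for t
    using that small unfolding P_def R_def by (auto intro: le_less_trans)
  have conty: "continuous_on {a..t} (y i)" if "i < n" "t < T" for i t
  proof -
    have "continuous_on {a..<T} (y i)"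
      using der[OF that(1)] has_vector_derivative_continuous
      by (fastforce simp: continuous_on_eq_continuous_within)
    then show ?thesis by (rule continuous_on_subset) (use that in auto)
  qed
  have step: "P t" if t: "t \<in> {a..<T}" and R: "\<And>s. s \<in> {a..<t} \<Longrightarrow> R s" for t
  proof -
    have tT: "t < T" "a \<le> t" using t by auto
    \<comment> \<open>Limits from the left give the closed conditions at \<open>t\<close> itself; at
      the initial time the condition on pairs follows from \<open>M \<ge> 1\<close>.\<close>
    have cl: "(\<forall>k<n. y k s \<in> cball c r) \<and> (\<forall>k<n. \<forall>l<n. norm (y l s - y k s) \<le> r1)"
      if s: "s \<in> {a..t}" for s
    proof (cases "s = t \<and> a < t")
      case True
      have "y k t \<in> cball c r" if "k < n" for k
      proof (rule continuous_on_left_limit_in_closed[OF closed_cball conty[OF that tT(1)]])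
        show "y k s \<in> cball c r" if "s \<in> {a..<t}" for s
          using R[OF that] \<open>k < n\<close> ball_subset_cball unfolding R_def by blast
      qed (use True in simp)
      moreover have "norm (y l t - y k t) \<le> r1" if "k < n" "l < n" for k l
      proof -
        have "norm (y l t - y k t) \<in> {..r1}"
        proof (rule continuous_on_left_limit_in_closed[of "{..r1}" a t "\<lambda>t. norm (y l t - y k t)"])
          show "continuous_on {a..t} (\<lambda>t. norm (y l t - y k t))"
            by (intro continuous_intros conty that tT)
          show "norm (y l s - y k s) \<in> {..r1}" if "s \<in> {a..<t}" for s
            using R[OF that] \<open>k < n\<close> \<open>l < n\<close> unfolding R_def by (simp add: less_imp_le)
        qed (use True in auto)
        then show ?thesis by simp
      qed
      ultimately show ?thesis using True by blast
    next
      case False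
      show ?thesis
      proof (cases "s = a")
        case True
        have "M \<ge> 1" if "n > 0"
        proof -
          have "n * n \<ge> 1" using that by simp
          then have "real (n * n) \<ge> 1" by linarith
          moreover have "exp (real (n * n) * b * \<tau>) \<ge> 1"
            using b T tT by (simp)
          ultimately show ?thesis unfolding M_def
            using mult_mono[of 1 "real (n * n)" 1 "exp (real (n * n) * b * \<tau>)"] by simp
        qed
        then have "\<sigma> \<le> r1" if "n > 0"
          using that small \<sigma> mult_right_mono[of 1 M \<sigma>] by simp
        then have "norm (y l a - y k a) \<le> r1" if "k < n" "l < n" for k l
          using init(2)[OF that] that by force
        then show ?thesis using init True by (simp add: less_imp_le)
      next
        case False
        then have "R s" using \<open>\<not> (s = t \<and> a < t)\<close> s by (intro R) auto
        then show ?thesis unfolding R_def by (auto simp: less_imp_le)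
      qed
    qed
    have derI: "(y i has_vector_derivative v i s) (at s within {a..t})" if "i < n" "s \<in> {a..t}" for i s
      by (rule has_vector_derivative_within_subset[OF der]) (use that tT in auto)
    have "(\<Sum>kl\<in>{..<n} \<times> {..<n}. norm ((\<lambda>t. y (snd kl) t - y (fst kl) t) t))
      \<le> ((\<Sum>kl\<in>{..<n} \<times> {..<n}. norm ((\<lambda>t. y (snd kl) t - y (fst kl) t) a)) + 0 / b)
        * exp (card ({..<n} \<times> {..<n}) * b * (t - a))"
    proof (rule gronwall_family[where w' = "\<lambda>kl t. v (snd kl) t - v (fst kl) t"])
      fix kl s assume kl: "kl \<in> {..<n} \<times> {..<n}" and s: "s \<in> {a..t}"
      show "((\<lambda>t. y (snd kl) t - y (fst kl) t) has_vector_derivative v (snd kl) s - v (fst kl) s) (at s within {a..t})"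
        using kl s by (intro has_vector_derivative_diff derI) auto
      show "norm (v (snd kl) s - v (fst kl) s)
          \<le> b * (\<Sum>l\<in>{..<n} \<times> {..<n}. norm (y (snd l) s - y (fst l) s)) + 0"
        using growth[of "fst kl" "snd kl" s] kl s cl[OF s] tT by (simp add: case_prod_beta mem_Times_iff)
    qed (use b tT in auto)
    also have "\<dots> \<le> (real (n * n) * \<sigma>) * exp (real (n * n) * b * \<tau>)"
    proof (intro mult_mono)
      show "(\<Sum>kl\<in>{..<n} \<times> {..<n}. norm (y (snd kl) a - y (fst kl) a)) + 0 / b \<le> real (n * n) * \<sigma>"
        using sum_bounded_above[of "{..<n} \<times> {..<n}" "\<lambda>kl. norm (y (snd kl) a - y (fst kl) a)" \<sigma>] init(2)
        by auto
      show "exp (real (card ({..<n} \<times> {..<n})) * b * (t - a)) \<le> exp (real (n * n) * b * \<tau>)"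
        using b T tT by (auto intro!: mult_left_mono)
    qed (use \<sigma> in auto)
    finally have sumle: "(\<Sum>kl\<in>{..<n} \<times> {..<n}. norm (y (snd kl) t - y (fst kl) t)) \<le> M * \<sigma>"
      unfolding M_def by (simp add: mult_ac)
    have diff: "norm (y j t - y i t) \<le> M * \<sigma>" if "i < n" "j < n" for i j
      using member_le_sum[of "(i, j)" "{..<n} \<times> {..<n}" "\<lambda>kl. norm (y (snd kl) t - y (fst kl) t)"] that sumle
      by simp
    have "y i t \<in> ball c r" if i: "i < n" for i
    proof (cases "t = a")
      case False
      then have "a < t" using tT by simp
      then show ?thesis
      proof (rule stays_inside_ball[where y = "y i" and y' = "v i t"])
        show "y i s \<in> ball c r" if "s \<in> {a..<t}" for s
          using R[OF that] i unfolding R_def by blast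
        show "y i t \<in> cball c r" using cl[of t] tT i by auto
        show "(y i has_vector_derivative v i t) (at t within {a..t})" using derI[OF i] tT by simp
        show "inner (v i t) (y i t - c) < 0" if "norm (y i t - c) = r"
          using inward[OF i t _ _ that] cl[of t] tT by auto
      qed
    qed (use init i in simp)
    then show ?thesis using diff unfolding P_def by blast
  qed
  have opn: "\<exists>d>0. \<forall>s\<in>{a..<T}. \<bar>s - t\<bar> < d \<longrightarrow> R s" if t: "t \<in> {a..<T}" and R: "R t" for t
  proof -
    have lim: "(y i \<longlongrightarrow> y i t) (at t within {a..<T})" if "i < n" for i
      using der[OF that t] has_vector_derivative_continuous continuous_within by blast
    have "\<forall>\<^sub>F s in at t within {a..<T}. \<forall>i\<in>{..<n}. y i s \<in> ball c r"
      using R unfolding R_def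
      by (intro eventually_ball_finite ballI topological_tendstoD[OF lim]) auto
    moreover have "\<forall>\<^sub>F s in at t within {a..<T}. \<forall>i\<in>{..<n}. \<forall>j\<in>{..<n}. norm (y j s - y i s) < r1"
      using R unfolding R_def
      by (intro eventually_ball_finite ballI order_tendstoD(2)[OF tendsto_norm[OF tendsto_diff[OF lim lim]]]) auto
    ultimately have "\<forall>\<^sub>F s in at t within {a..<T}. R s"
      by eventually_elim (auto simp: R_def)
    then obtain d where "d > 0" "\<forall>s\<in>{a..<T}. s \<noteq> t \<and> dist s t < d \<longrightarrow> R s"
      unfolding eventually_at by blast
    then show ?thesis using R by (intro exI[of _ d]) (auto simp: dist_real_def)
  qed
  have "R t" if "t \<in> {a..<T}" for t
    using real_interval_induct[of a T R, OF _ opn that] PR step by blast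
  then have "P t" using step[OF t] t by auto
  then show ?thesis unfolding P_def .
qed

subsection \<open>A perturbation of the coupling with vanishing derivative at 0\<close>

text \<open>The scalar factor is close to 0 for \<open>w\<close> much shorter than \<rho> and close
  to 1 for \<open>w\<close> much longer: a smooth switch at scale \<rho> that vanishes to third
  order at 0.\<close>

definition saturation :: "real \<Rightarrow> 'a::real_inner \<Rightarrow> 'a" where
  "saturation \<rho> w = (inner w w / (\<rho>\<^sup>2 + inner w w)) *\<^sub>R w"

definition saturation_deriv :: "real \<Rightarrow> 'a::real_inner \<Rightarrow> 'a \<Rightarrow> 'a" where
  "saturation_deriv \<rho> w h = (inner w w / (\<rho>\<^sup>2 + inner w w)) *\<^sub>R h
     + (2 * \<rho>\<^sup>2 * inner w h / (\<rho>\<^sup>2 + inner w w)\<^sup>2) *\<^sub>R w"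

context
  fixes \<rho> :: real
  assumes \<rho>: "\<rho> > 0"
begin

lemma saturation_denominator_pos: "\<rho>\<^sup>2 + inner w w > 0"
  using \<rho> by (simp add: add_pos_nonneg)

lemma saturation_has_derivative:
  "(saturation \<rho> has_derivative saturation_deriv \<rho> w) (at w)"
proof -
  note pos = saturation_denominator_pos[of w]
  have "((\<lambda>w. inner w w / (\<rho>\<^sup>2 + inner w w)) has_derivative
      (\<lambda>h. 2 * \<rho>\<^sup>2 * inner w h / (\<rho>\<^sup>2 + inner w w)\<^sup>2)) (at w)"
    using pos
    by (auto intro!: derivative_eq_intros simp: fun_eq_iff inner_commute field_simps power2_eq_square)
  from has_derivative_scaleR[OF this has_derivative_ident]
  show ?thesis
    unfolding saturation_def[abs_def] saturation_deriv_def[abs_def] .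
qed

text \<open>The bound 3 (1 from the factor, 2 from its derivative) does not depend on \<rho>, so a
  weighted series over arbitrarily small scales can still be differentiated termwise.\<close>

lemma norm_saturation_deriv_le: "norm (saturation_deriv \<rho> w h) \<le> 3 * norm h"
proof -
  define s where "s = inner w w"
  define D where "D = \<rho>\<^sup>2 + s"
  have s: "s \<ge> 0" "s = norm w * norm w" unfolding s_def by (auto simp: power2_norm_eq_inner simp flip: power2_eq_square)
  have D: "D > 0" using saturation_denominator_pos unfolding D_def s_def .
  have "\<bar>s / D\<bar> \<le> 1" using s D unfolding D_def by simp
  then have 1: "norm ((s / D) *\<^sub>R h) \<le> norm h" by (simp add: mult_left_le_one_le del: abs_divide)
  have "norm ((2 * \<rho>\<^sup>2 * inner w h / D\<^sup>2) *\<^sub>R w) = 2 * (\<rho>\<^sup>2 * (\<bar>inner w h\<bar> * norm w)) / D\<^sup>2"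
    using D by (simp add: abs_mult)
  also have "\<dots> \<le> 2 * (\<rho>\<^sup>2 * (s * norm h)) / D\<^sup>2"
  proof -
    have "\<bar>inner w h\<bar> * norm w \<le> (norm w * norm h) * norm w"
      by (intro mult_right_mono Cauchy_Schwarz_ineq2) simp
    then have "\<bar>inner w h\<bar> * norm w \<le> s * norm h" unfolding s(2) by (simp add: mult_ac)
    then show ?thesis by (intro divide_right_mono mult_left_mono) auto
  qed
  also have "\<dots> = 2 * (\<rho>\<^sup>2 * s / D\<^sup>2) * norm h" by simp
  also have "\<dots> \<le> 2 * 1 * norm h"
  proof -
    have "\<rho>\<^sup>2 * s \<le> D * D" unfolding D_def using s by (intro mult_mono) auto
    then have "\<rho>\<^sup>2 * s / D\<^sup>2 \<le> 1" using D by (simp add: power2_eq_square)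
    then show ?thesis by (intro mult_right_mono mult_left_mono) auto
  qed
  finally show ?thesis
    using 1 norm_triangle_ineq[of "(s / D) *\<^sub>R h" "(2 * \<rho>\<^sup>2 * inner w h / D\<^sup>2) *\<^sub>R w"]
    unfolding saturation_deriv_def s_def[symmetric] D_def[symmetric] by linarith
qed

lemma saturation_lipschitz: "norm (saturation \<rho> x - saturation \<rho> y) \<le> 3 * norm (x - y)"
  by (rule differentiable_bound[of UNIV _ "saturation_deriv \<rho>"])
    (auto intro!: saturation_has_derivative onorm_bound norm_saturation_deriv_le)

lemma norm_saturation_le: "norm (saturation \<rho> w) \<le> norm w"
proof -
  have "\<bar>inner w w / (\<rho>\<^sup>2 + inner w w)\<bar> \<le> 1"
    using saturation_denominator_pos[of w] by simp
  then have "\<bar>inner w w / (\<rho>\<^sup>2 + inner w w)\<bar> * norm w \<le> 1 * norm w"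
    by (rule mult_right_mono) simp
  then show ?thesis unfolding saturation_def by simp
qed

text \<open>Only the fraction \<open>\<rho>\<^sup>2 / (\<rho>\<^sup>2 + inner w w)\<close> of
  \<open>w\<close> is missing, and \<open>\<rho> * norm w\<close> never exceeds that
  denominator.\<close>

lemma saturation_far: "norm (saturation \<rho> w - w) \<le> \<rho>"
proof -
  note pos = saturation_denominator_pos[of w]
  have "saturation \<rho> w - w = (inner w w / (\<rho>\<^sup>2 + inner w w) - 1) *\<^sub>R w"
    unfolding saturation_def by (simp add: scaleR_diff_left)
  also have "inner w w / (\<rho>\<^sup>2 + inner w w) - 1 = - (\<rho>\<^sup>2 / (\<rho>\<^sup>2 + inner w w))"
    using pos by (simp add: field_simps)
  finally have "norm (saturation \<rho> w - w) = \<rho>\<^sup>2 * norm w / (\<rho>\<^sup>2 + inner w w)"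
    using pos by simp
  also have "\<dots> \<le> \<rho>"
  proof -
    have "0 \<le> (\<rho> - norm w)\<^sup>2 + \<rho> * norm w" using \<rho> by simp
    then have "\<rho> * norm w \<le> \<rho>\<^sup>2 + inner w w"
      by (simp add: power2_norm_eq_inner[symmetric] power2_diff)
    then have "\<rho> * (\<rho> * norm w) \<le> \<rho> * (\<rho>\<^sup>2 + inner w w)"
      using \<rho> by (intro mult_left_mono) auto
    then show ?thesis using pos by (simp add: pos_divide_le_eq power2_eq_square mult.assoc)
  qed
  finally show ?thesis .
qed

lemma saturation_near: "norm (saturation \<rho> w) \<le> norm w ^ 3 / \<rho>\<^sup>2"
proof -
  note pos = saturation_denominator_pos[of w]
  have "norm (saturation \<rho> w) = norm w ^ 3 / (\<rho>\<^sup>2 + inner w w)"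
    unfolding saturation_def using pos
    by (simp add: power2_norm_eq_inner[symmetric] power3_eq_cube power2_eq_square)
  also have "\<dots> \<le> norm w ^ 3 / \<rho>\<^sup>2"
    using \<rho> by (intro divide_left_mono) (auto simp: add_pos_nonneg)
  finally show ?thesis .
qed

end

text \<open>On the scales between \<open>r m\<close> and \<open>r (m - 1)\<close> the sum over all saturated identities acts like
  multiplication by \<open>2\<^sup>-\<^sup>m\<close>, yet its derivative at 0 vanishes.\<close>

lemma gliding_hump_perturbation:
  fixes r :: "nat \<Rightarrow> real"
  assumes r: "\<And>k. r k > 0"
  obtains G :: "'a::euclidean_space \<Rightarrow> 'a" where
    "\<And>w. G differentiable (at w)" "(G has_derivative (\<lambda>_. 0)) (at 0)" "G 0 = 0"
    "\<And>x y. norm (G x - G y) \<le> 3 * norm (x - y)"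
    "\<And>m w a b. (\<And>k. k \<ge> m \<Longrightarrow> r k \<le> a) \<Longrightarrow> (\<And>k. k < m \<Longrightarrow> b \<le> r k) \<Longrightarrow> a \<ge> 0 \<Longrightarrow> b > 0 \<Longrightarrow>
      norm (G w - (1/2)^m *\<^sub>R w) \<le> a + norm w ^ 3 / b\<^sup>2"
proof -
  \<comment> \<open>The total weight is 1 and the weights from index \<open>m\<close> on add up to
    \<open>2^-m\<close>; this tail is the factor seen between two consecutive scales.\<close>
  define c where "c = (\<lambda>k::nat. (1/2::real) ^ Suc k)"
  have c: "c k > 0" for k unfolding c_def by simp
  have csum: "c sums 1" unfolding c_def by (rule power_half_series)
  have ctail: "(\<lambda>k. c (k + m)) sums (1/2)^m" for m
    using sums_mult[OF csum, of "(1/2)^m"] unfolding c_def by (simp add: power_add mult_ac)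
  \<comment> \<open>The Weierstrass test with weights \<open>c\<close>, applied to the values, to
    the derivatives and to all differences below.\<close>
  have dom: "summable f \<and> norm (suminf f) \<le> B" if "\<And>k. norm (f k) \<le> c k * B" for f :: "nat \<Rightarrow> 'a" and B
  proof -
    have s: "(\<lambda>k. c k * B) sums B" using sums_mult2[OF csum, of B] by simp
    have sn: "summable (\<lambda>k. norm (f k))"
      by (rule summable_comparison_test'[OF sums_summable[OF s], of 0]) (use that in auto)
    moreover have "norm (suminf f) \<le> (\<Sum>k. norm (f k))" by (rule summable_norm[OF sn])
    moreover have "(\<Sum>k. norm (f k)) \<le> (\<Sum>k. c k * B)"
      by (rule suminf_le[OF that sn sums_summable[OF s]])
    ultimately show ?thesis using s summable_norm_cancel[OF sn] by (simp add: sums_iff)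
  qed
  define f where "f = (\<lambda>k (w::'a). c k *\<^sub>R saturation (r k) w)"
  define f' where "f' = (\<lambda>k (w::'a) h. c k *\<^sub>R saturation_deriv (r k) w h)"
  define G where "G = (\<lambda>w. \<Sum>k. f k w)"
  define G' where "G' = (\<lambda>w h. \<Sum>k. f' k w h)"
  have fb: "norm (f k w) \<le> c k * norm w" for k w
    unfolding f_def using norm_saturation_le[OF r[of k], of w] c[of k] by simp
  have f'b: "norm (f' k w h) \<le> c k * (3 * norm h)" for k w h
    unfolding f'_def using norm_saturation_deriv_le[OF r[of k], of w h] c[of k] by simp
  have fsum: "summable (\<lambda>k. f k w)" for w using dom[of "\<lambda>k. f k w" "norm w"] fb by blast
  have f'sum: "summable (\<lambda>k. f' k w h)" for w h using dom[of "\<lambda>k. f' k w h" "3 * norm h"] f'b by blast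
  have "\<exists>g. \<forall>w\<in>UNIV. (\<lambda>k. f k w) sums g w \<and> (g has_derivative G' w) (at w within UNIV)"
  proof (rule has_derivative_series[where f' = f'])
    show "(f k has_derivative f' k w) (at w within UNIV)" for k w
      unfolding f_def f'_def by (intro has_derivative_scaleR_right saturation_has_derivative r)
    show "(\<lambda>k. f k 0) sums suminf (\<lambda>k. f k 0)" using fsum by (rule summable_sums)
    fix e :: real assume "e > 0"
    have "(\<lambda>m. (1/2::real)^m * 3) \<longlonglongrightarrow> 0 * 3" by (intro tendsto_intros LIMSEQ_power_zero) simp
    then have "\<forall>\<^sub>F m in sequentially. (1/2::real)^m * 3 < e"
      using \<open>e > 0\<close> by (intro order_tendstoD(2)[where y = "0 * 3"]) auto
    then show "\<forall>\<^sub>F m in sequentially. \<forall>w\<in>UNIV. \<forall>h. norm ((\<Sum>k<m. f' k w h) - G' w h) \<le> e * norm h"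
    proof eventually_elim
      case (elim m)
      have "norm ((\<Sum>k<m. f' k w h) - G' w h) \<le> e * norm h" for w h
      proof -
        have "(\<Sum>k<m. f' k w h) - G' w h = - (\<Sum>k. f' (k + m) w h)"
          using suminf_split_initial_segment[OF f'sum, of w h m] unfolding G'_def by simp
        moreover have "norm (\<Sum>k. f' (k + m) w h) \<le> (1/2)^m * 3 * norm h"
        proof -
          have "norm (f' (k + m) w h) \<le> c k * ((1/2)^m * 3 * norm h)" for k
            using f'b[of "k + m" w h] unfolding c_def by (simp add: power_add mult_ac)
          then show ?thesis
            using dom[of "\<lambda>k. f' (k + m) w h" "(1/2)^m * 3 * norm h"] by blast
        qed
        moreover have "(1/2)^m * 3 * norm h \<le> e * norm h"
          using elim by (intro mult_right_mono) auto
        ultimately show ?thesis by simp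
      qed
      then show ?case by blast
    qed
  qed auto
  then obtain g where g: "\<And>w. (\<lambda>k. f k w) sums g w" "\<And>w. (g has_derivative G' w) (at w)" by auto
  have "g = G" using g(1) unfolding G_def by (auto simp: sums_iff)
  then have Gd: "(G has_derivative G' w) (at w)" for w using g(2) by simp
  show thesis
  proof (rule that[of G])
    show "G differentiable (at w)" for w using Gd unfolding differentiable_def by blast
    have "G' 0 = (\<lambda>_. 0)"
      unfolding G'_def f'_def saturation_deriv_def by simp
    then show "(G has_derivative (\<lambda>_. 0)) (at 0)" using Gd[of 0] by simp
    show "G 0 = 0" unfolding G_def f_def saturation_def by simp
    show "norm (G x - G y) \<le> 3 * norm (x - y)" for x y
    proof -
      have "norm (f k x - f k y) \<le> c k * (3 * norm (x - y))" for k
        using saturation_lipschitz[OF r[of k], of x y] c[of k]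
        unfolding f_def by (simp flip: scaleR_diff_right)
      from dom[OF this] show ?thesis
        unfolding G_def by (simp add: suminf_diff[OF fsum fsum])
    qed
    fix m :: nat and w :: 'a and a b :: real
    assume a: "\<And>k. k \<ge> m \<Longrightarrow> r k \<le> a" and b: "\<And>k. k < m \<Longrightarrow> b \<le> r k" and ab: "a \<ge> 0" "b > 0"
    \<comment> \<open>Idealised weights: the scales from \<open>m\<close> on act as the identity
      with error at most \<open>a\<close>, the coarser ones act as 0 with a cubic error.\<close>
    define d where "d = (\<lambda>k. if k < m then 0 else c k)"
    have "(\<lambda>k. d (k + m)) sums (1/2)^m" using ctail[of m] unfolding d_def by simp
    then have "d sums (1/2)^m" by (subst (asm) sums_zero_iff_shift) (auto simp: d_def)
    then have dw: "(\<lambda>k. d k *\<^sub>R w) sums ((1/2)^m *\<^sub>R w)" by (rule sums_scaleR_left)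
    have "norm (f k w - d k *\<^sub>R w) \<le> c k * (a + norm w ^ 3 / b\<^sup>2)" for k
    proof (cases "k < m")
      case True
      have "norm (saturation (r k) w) \<le> norm w ^ 3 / (r k)\<^sup>2"
        by (rule saturation_near[OF r])
      also have "\<dots> \<le> norm w ^ 3 / b\<^sup>2"
        using b[OF True] ab by (intro divide_left_mono power_mono) auto
      also have "\<dots> \<le> a + norm w ^ 3 / b\<^sup>2" using ab by simp
      finally show ?thesis using True c[of k] unfolding f_def d_def by simp
    next
      case False
      have "norm (saturation (r k) w - w) \<le> r k" by (rule saturation_far[OF r])
      also have "\<dots> \<le> a + norm w ^ 3 / b\<^sup>2" using a[of k] False by (simp add: add_increasing2)
      finally show ?thesis using False c[of k] unfolding f_def d_def by (simp flip: scaleR_diff_right)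
    qed
    from dom[OF this] show "norm (G w - (1/2)^m *\<^sub>R w) \<le> a + norm w ^ 3 / b\<^sup>2"
      using suminf_diff[OF fsum sums_summable[OF dw]] sums_unique[OF dw] unfolding G_def by simp
  qed
qed

subsection \<open>Solutions of the network equations\<close>

text \<open>A network state is a point of the Banach space \<open>nat \<Rightarrow>\<^sub>C 'a\<close>; the library proves its
  completeness for metric domains only.\<close>

instantiation nat :: metric_space
begin

definition dist_nat :: "nat \<Rightarrow> nat \<Rightarrow> real" where
  "dist_nat m k = \<bar>real m - real k\<bar>"

definition uniformity_nat :: "(nat \<times> nat) filter" where
  "uniformity_nat = (INF e\<in>{0<..}. principal {(m, k). dist m k < e})"

instance
proof
  fix S :: "nat set"
  have "eventually (\<lambda>(m', k). m' = m \<longrightarrow> k \<in> S) uniformity" if "m \<in> S" for m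
  proof -
    have "eventually (\<lambda>(m', k). m' = m \<longrightarrow> k \<in> S) (principal {(m, k :: nat). dist m k < 1})"
    proof -
      have "k = m" if "\<bar>real m - real k\<bar> < 1" for k using that by linarith
      then show ?thesis using that by (auto simp: eventually_principal dist_nat_def)
    qed
    then show ?thesis unfolding uniformity_nat_def by (rule eventually_INF1[rotated]) simp
  qed
  then show "open S \<longleftrightarrow> (\<forall>m\<in>S. eventually (\<lambda>(m', k). m' = m \<longrightarrow> k \<in> S) uniformity)"
    by (auto simp: open_discrete)
qed (auto simp: dist_nat_def uniformity_nat_def)

end

instance bcontfun :: (metric_space, banach) banach ..

text \<open>All nodes together solve one equation with a globally Lipschitz field in which the
  coordinates from \<open>n\<close> on are frozen at 0. Evaluation at a node is bounded linear, so
  derivatives can be read off componentwise.\<close>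

lemma network_ode_solution_exists:
  fixes F W :: "'a::banach \<Rightarrow> 'a" and a :: "nat \<Rightarrow> nat \<Rightarrow> real"
  assumes F: "\<And>x y. norm (F x - F y) \<le> L * norm (x - y)"
    and W: "\<And>x y. norm (W x - W y) \<le> K * norm (x - y)"
  obtains x where "\<And>i. i < n \<Longrightarrow> x i 0 = x0 i"
    "\<And>i t. i < n \<Longrightarrow> t \<ge> 0 \<Longrightarrow> (x i has_vector_derivative
      F (x i t) + (\<Sum>j<n. a i j *\<^sub>R W (x j t - x i t))) (at t within {0..})"
proof -
  define V where "V = (\<lambda>(y :: nat \<Rightarrow>\<^sub>C 'a) i. if i < n then F (y i) + (\<Sum>j<n. a i j *\<^sub>R W (y j - y i)) else 0)"
  have bc: "(\<lambda>i. if i < n then g i else 0) \<in> bcontfun" for g :: "nat \<Rightarrow> 'a"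
  proof (rule bcontfun_normI)
    show "norm (if i < n then g i else 0) \<le> (\<Sum>i<n. norm (g i))" for i
      using member_le_sum[of i "{..<n}" "\<lambda>i. norm (g i)"] by (auto intro: sum_nonneg)
  qed simp
  define \<Phi> where "\<Phi> = (\<lambda>y. Bcontfun (V y))"
  have \<Phi>: "apply_bcontfun (\<Phi> y) = V y" for y
    unfolding \<Phi>_def V_def by (rule Bcontfun_inverse[OF bc])
  have K: "K * norm (x - y) \<ge> 0" for x y :: 'a using order_trans[OF norm_ge_zero W] .
  have L: "L * norm (x - y) \<ge> 0" for x y :: 'a using order_trans[OF norm_ge_zero F] .
  define B where "B = (\<Sum>i<n. \<Sum>j<n. \<bar>a i j\<bar>)"
  have B0: "B \<ge> 0" unfolding B_def by (intro sum_nonneg) auto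
  have lip: "norm (\<Phi> y - \<Phi> y') \<le> (\<bar>L\<bar> + B * (\<bar>K\<bar> * 2)) * norm (y - y')" for y y'
  proof (rule norm_bound)
    fix i
    define \<delta> where "\<delta> = norm (y - y')"
    have \<delta>: "norm (y i - y' i) \<le> \<delta>" for i
      using norm_bounded[of "y - y'" i] unfolding \<delta>_def by simp
    have \<delta>0: "\<delta> \<ge> 0" unfolding \<delta>_def by simp
    show "norm (apply_bcontfun (\<Phi> y - \<Phi> y') i) \<le> (\<bar>L\<bar> + B * (\<bar>K\<bar> * 2)) * norm (y - y')"
    proof (cases "i < n")
      case True
      have "norm (F (y i) - F (y' i)) \<le> \<bar>L\<bar> * norm (y i - y' i)"
        using F[of "y i" "y' i"] mult_right_mono[OF abs_ge_self[of L] norm_ge_zero[of "y i - y' i"]] by linarith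
      also have "\<dots> \<le> \<bar>L\<bar> * \<delta>" using \<delta> by (intro mult_left_mono) auto
      finally have 1: "norm (F (y i) - F (y' i)) \<le> \<bar>L\<bar> * \<delta>" .
      have "norm (W (y j - y i) - W (y' j - y' i)) \<le> \<bar>K\<bar> * 2 * \<delta>" for j
      proof -
        have "norm (W (y j - y i) - W (y' j - y' i)) \<le> \<bar>K\<bar> * norm ((y j - y i) - (y' j - y' i))"
          using W[of "y j - y i" "y' j - y' i"]
            mult_right_mono[OF abs_ge_self[of K] norm_ge_zero[of "(y j - y i) - (y' j - y' i)"]] by linarith
        also have "norm ((y j - y i) - (y' j - y' i)) \<le> 2 * \<delta>"
          using norm_triangle_ineq4[of "y j - y' j" "y i - y' i"] \<delta>[of i] \<delta>[of j]
          by (simp add: algebra_simps)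
        finally show ?thesis by (simp add: mult_left_mono)
      qed
      then have "norm (\<Sum>j<n. a i j *\<^sub>R (W (y j - y i) - W (y' j - y' i))) \<le> (\<Sum>j<n. \<bar>a i j\<bar> * (\<bar>K\<bar> * 2 * \<delta>))"
        by (intro norm_sum[THEN order_trans] sum_mono) (simp add: mult_left_mono)
      also have "\<dots> = (\<Sum>j<n. \<bar>a i j\<bar>) * (\<bar>K\<bar> * 2 * \<delta>)" by (simp add: sum_distrib_right)
      also have "\<dots> \<le> B * (\<bar>K\<bar> * 2 * \<delta>)"
        unfolding B_def using True \<delta>0
        by (intro mult_right_mono member_le_sum[of i "{..<n}" "\<lambda>i. \<Sum>j<n. \<bar>a i j\<bar>"]) (auto intro: sum_nonneg)
      finally have 2: "norm (\<Sum>j<n. a i j *\<^sub>R (W (y j - y i) - W (y' j - y' i))) \<le> B * (\<bar>K\<bar> * 2 * \<delta>)" .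
      have "apply_bcontfun (\<Phi> y - \<Phi> y') i
          = (F (y i) - F (y' i)) + (\<Sum>j<n. a i j *\<^sub>R (W (y j - y i) - W (y' j - y' i)))"
        using True by (simp add: \<Phi> V_def scaleR_diff_right sum_subtractf)
      then have "norm (apply_bcontfun (\<Phi> y - \<Phi> y') i) \<le> \<bar>L\<bar> * \<delta> + B * (\<bar>K\<bar> * 2 * \<delta>)"
        using norm_triangle_mono[OF 1 2] by simp
      then show ?thesis unfolding \<delta>_def by (simp add: algebra_simps)
    next
      case False
      then have "apply_bcontfun (\<Phi> y - \<Phi> y') i = 0" by (simp add: \<Phi> V_def)
      then show ?thesis using B0 by simp
    qed
  qed
  obtain y where y0: "y 0 = Bcontfun (\<lambda>i. if i < n then x0 i else 0)"
    and yd: "\<And>t. t \<ge> 0 \<Longrightarrow> (y has_vector_derivative \<Phi> (y t)) (at t within {0..})"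
    using lipschitz_ode_global_solution[of \<Phi>, OF lip] by blast
  have bl: "bounded_linear (\<lambda>y :: nat \<Rightarrow>\<^sub>C 'a. apply_bcontfun y i)" for i
    by (rule bounded_linear_intro[of _ 1]) (auto intro: norm_bounded)
  show thesis
  proof (rule that[of "\<lambda>i t. y t i"])
    show "apply_bcontfun (y 0) i = x0 i" if "i < n" for i
      unfolding y0 Bcontfun_inverse[OF bc] using that by simp
    fix i and t :: real assume "i < n" "t \<ge> 0"
    then show "((\<lambda>t. apply_bcontfun (y t) i) has_vector_derivative
      F (y t i) + (\<Sum>j<n. a i j *\<^sub>R W (y t j - y t i))) (at t within {0..})"
      using bounded_linear.has_vector_derivative[OF bl yd, of t i] by (simp add: \<Phi> V_def)
  qed
qed

text \<open>The growth rate is \<Lambda> from \<open>f\<close> plus \<open>\<alpha> * B\<close> from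
  each of the two coupling sums in a difference. On the sphere the coupling, of norm at most
  \<open>\<alpha> * (real n * (B * r1))\<close>, times the radius stays below the inward margin. The
  equation is required only inside the regime, so \<open>v\<close> may come from a field modified
  outside the ball; \<open>q\<close> stands for any coupling, perturbed or not.\<close>

lemma network_coupled_confinement:
  fixes y v :: "nat \<Rightarrow> real \<Rightarrow> 'a::euclidean_space" and q :: "nat \<Rightarrow> nat \<Rightarrow> real \<Rightarrow> 'a"
    and a T \<tau> \<sigma> B r r1 t \<alpha> \<Lambda> \<kappa>\<^sub>0 :: real and n :: nat
  defines "M \<equiv> real (n * n) * exp (real (n * n) * (\<Lambda> + 2 * \<alpha> * B) * \<tau>)"
  assumes net: "network n A"
    and \<alpha>: "\<alpha> > 0" and B: "B \<ge> 0" and \<Lambda>: "\<Lambda> > 0" and r: "r > 0"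
    and lip: "\<And>x y. x \<in> cball c r \<Longrightarrow> y \<in> cball c r \<Longrightarrow> norm (f x - f y) \<le> \<Lambda> * norm (x - y)"
    and inflow: "\<And>x. x \<in> sphere c r \<Longrightarrow> inner (f x) (x - c) \<le> - \<kappa>\<^sub>0"
    and r1: "\<alpha> * (real n * (B * r1)) * r < \<kappa>\<^sub>0"
    and der: "\<And>i t. i < n \<Longrightarrow> t \<in> {a..<T} \<Longrightarrow> (y i has_vector_derivative v i t) (at t within {a..<T})"
    and v: "\<And>i t. i < n \<Longrightarrow> t \<in> {a..<T} \<Longrightarrow> \<forall>k<n. y k t \<in> cball c r \<Longrightarrow>
      \<forall>k<n. \<forall>l<n. norm (y l t - y k t) \<le> r1 \<Longrightarrow>
      v i t = f (y i t) + \<alpha> *\<^sub>R (\<Sum>j<n. A $$ (i, j) *\<^sub>R q i j t)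
      \<and> (\<forall>j<n. norm (q i j t) \<le> B * norm (y j t - y i t))"
    and T: "T \<le> a + \<tau>" and \<sigma>: "\<sigma> \<ge> 0"
    and init: "\<And>i. i < n \<Longrightarrow> y i a \<in> ball c r"
      "\<And>i j. i < n \<Longrightarrow> j < n \<Longrightarrow> norm (y j a - y i a) \<le> \<sigma>"
    and small: "M * \<sigma> < r1"
    and t: "t \<in> {a..<T}"
  shows "\<forall>i<n. y i t \<in> ball c r \<and> (\<forall>j<n. norm (y j t - y i t) \<le> M * \<sigma>)"
  unfolding M_def
proof (rule network_confinement[OF der T _ \<sigma> init small[unfolded M_def] _ _ t])
  show "\<Lambda> + 2 * \<alpha> * B > 0" using \<Lambda> \<alpha> B by (simp add: add_pos_nonneg)
  fix i t assume i: "i < n" and t: "t \<in> {a..<T}" and cb: "\<forall>k<n. y k t \<in> cball c r"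
    and d: "\<forall>k<n. \<forall>l<n. norm (y l t - y k t) \<le> r1"
  note v = v[OF _ t cb d]
  define S where "S = (\<Sum>(k, l)\<in>{..<n} \<times> {..<n}. norm (y l t - y k t))"
  have cpl: "norm (\<alpha> *\<^sub>R (\<Sum>j<n. A $$ (i, j) *\<^sub>R q i j t)) \<le> \<alpha> * (\<Sum>j<n. B * norm (y j t - y i t))" if i: "i < n" for i
  proof -
    have "norm (\<Sum>j<n. A $$ (i, j) *\<^sub>R q i j t) \<le> (\<Sum>j<n. B * norm (y j t - y i t))"
    proof (rule sum_norm_le)
      fix j assume "j \<in> {..<n}"
      then have j: "j < n" by simp
      have "norm (A $$ (i, j) *\<^sub>R q i j t) \<le> norm (q i j t)"
        using mult_right_mono[OF adjacency_entry(2)[OF net i j] norm_ge_zero[of "q i j t"]] by simp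
      also have "\<dots> \<le> B * norm (y j t - y i t)" using v[OF i] j by blast
      finally show "norm (A $$ (i, j) *\<^sub>R q i j t) \<le> B * norm (y j t - y i t)" .
    qed
    then show ?thesis using \<alpha> by simp
  qed
  {
    fix j assume j: "j < n"
    have row: "(\<Sum>j<n. norm (y j t - y i t)) \<le> S" if "i < n" for i
    proof -
      have "S = (\<Sum>k<n. \<Sum>l<n. norm (y l t - y k t))"
        unfolding S_def by (rule sum.cartesian_product[symmetric])
      then show ?thesis
        using member_le_sum[of i "{..<n}" "\<lambda>k. \<Sum>l<n. norm (y l t - y k t)"] that
        by (simp add: sum_nonneg)
    qed
    have cplS: "norm (\<alpha> *\<^sub>R (\<Sum>j<n. A $$ (i, j) *\<^sub>R q i j t)) \<le> \<alpha> * (B * S)" if "i < n" for i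
    proof -
      have "\<alpha> * (\<Sum>j<n. B * norm (y j t - y i t)) \<le> \<alpha> * (B * S)"
        using \<alpha> B row[OF that] by (auto simp flip: sum_distrib_left intro!: mult_left_mono)
      then show ?thesis using cpl[OF that] by linarith
    qed
    have "norm (f (y j t) - f (y i t)) \<le> \<Lambda> * norm (y j t - y i t)"
      using lip cb i j by blast
    also have "\<dots> \<le> \<Lambda> * S"
      using \<Lambda> row[OF i] member_le_sum[of j "{..<n}" "\<lambda>j. norm (y j t - y i t)"] j
      by (intro mult_left_mono) auto
    finally have "norm (f (y j t) - f (y i t)) \<le> \<Lambda> * S" .
    then have "norm (v j t - v i t) \<le> \<Lambda> * S + \<alpha> * (B * S) + \<alpha> * (B * S)"
      using cplS[OF i] cplS[OF j] v[OF i] v[OF j]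
      by (smt (verit, ccfv_SIG) add_diff_add norm_triangle_ineq norm_triangle_ineq4)
    then show "norm (v j t - v i t) \<le> (\<Lambda> + 2 * \<alpha> * B) * (\<Sum>(k, l)\<in>{..<n} \<times> {..<n}. norm (y l t - y k t))"
      unfolding S_def by (simp add: algebra_simps)
  }
  assume sph: "norm (y i t - c) = r"
  have "(\<Sum>j<n. B * norm (y j t - y i t)) \<le> (\<Sum>j<n. B * r1)"
    using d i B by (intro sum_mono mult_left_mono) auto
  then have p: "norm (\<alpha> *\<^sub>R (\<Sum>j<n. A $$ (i, j) *\<^sub>R q i j t)) \<le> \<alpha> * (real n * (B * r1))"
    using cpl[OF i] mult_left_mono[of "\<Sum>j<n. B * norm (y j t - y i t)" "real n * (B * r1)" \<alpha>] \<alpha>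
    by simp
  have "inner (v i t) (y i t - c) = inner (f (y i t)) (y i t - c)
      + inner (\<alpha> *\<^sub>R (\<Sum>j<n. A $$ (i, j) *\<^sub>R q i j t)) (y i t - c)"
    using v[OF i] by (simp add: inner_add_left)
  also have "inner (f (y i t)) (y i t - c) \<le> - \<kappa>\<^sub>0"
    using sph by (intro inflow) (simp add: dist_norm norm_minus_commute)
  also have "inner (\<alpha> *\<^sub>R (\<Sum>j<n. A $$ (i, j) *\<^sub>R q i j t)) (y i t - c) \<le> \<alpha> * (real n * (B * r1)) * r"
    using norm_cauchy_schwarz[of "\<alpha> *\<^sub>R (\<Sum>j<n. A $$ (i, j) *\<^sub>R q i j t)" "y i t - c"]
      mult_right_mono[OF p, of r] r unfolding sph by linarith
  finally show "inner (v i t) (y i t - c) < 0" using r1 by simp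
qed

subsection \<open>Strict contraction\<close>

text \<open>The vector field is evaluated along \<open>z\<close>, which stays in the ball, and not along the corrected
  curve \<open>u\<close>, which may leave it.\<close>

definition shadowing ::
    "nat \<Rightarrow> real mat \<Rightarrow> (real ^ 'q \<Rightarrow> real ^ 'q) \<Rightarrow> real ^ 'q ^ 'q \<Rightarrow> real \<Rightarrow> real ^ 'q \<Rightarrow> real \<Rightarrow>
     real \<Rightarrow> real \<Rightarrow> real \<Rightarrow> real \<Rightarrow> (nat \<Rightarrow> real \<Rightarrow> real ^ 'q) \<Rightarrow> (nat \<Rightarrow> real \<Rightarrow> real ^ 'q) \<Rightarrow> bool" where
  "shadowing n A f \<Gamma> \<alpha> c r \<tau> M \<kappa> \<sigma> z u \<longleftrightarrow>
    (\<forall>i<n. z i 0 \<in> ball c r \<and> u i 0 = z i 0) \<and> (\<forall>i<n. \<forall>j<n. norm (z j 0 - z i 0) \<le> \<sigma>)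
    \<and> (\<forall>i<n. \<forall>t\<in>{0..\<tau>}. z i t \<in> cball c r \<and> norm (u i t - z i t) \<le> \<kappa> * \<sigma>
        \<and> (\<forall>j<n. norm (z j t - z i t) \<le> M * \<sigma>))
    \<and> (\<exists>v. \<forall>i<n. \<forall>t\<in>{0..\<tau>}. (u i has_vector_derivative v i t) (at t within {0..\<tau>})
        \<and> norm (v i t - (f (z i t) + \<alpha> *\<^sub>R (\<Sum>j<n. A $$ (i, j) *\<^sub>R (\<Gamma> *v (z j t - z i t))))) \<le> \<kappa> * \<sigma>)"

lemma spread_set: "{norm (y j - y i) | i j. i < n \<and> j < n} = (\<lambda>(i, j). norm (y j - y i)) ` ({..<n} \<times> {..<n})"
  for y :: "nat \<Rightarrow> real ^ 'q"
  by auto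

lemma spread_le:
  fixes y :: "nat \<Rightarrow> real ^ 'q"
  assumes "n > 0" "\<And>i j. i < n \<Longrightarrow> j < n \<Longrightarrow> norm (y j - y i) \<le> B"
  shows "spread n y \<le> B"
  unfolding spread_def spread_set using assms by (subst Max_le_iff) auto

lemma le_spread:
  fixes y :: "nat \<Rightarrow> real ^ 'q"
  assumes "i < n" "j < n"
  shows "norm (y j - y i) \<le> spread n y"
  unfolding spread_def spread_set using assms by (intro Max_ge) (auto intro: image_eqI[of _ _ "(i, j)"])

lemma sync_locally_exp_stable_from_0:
  assumes "sync_locally_exp_stable n A f U H P \<alpha> \<nu>"
  obtains \<rho>\<^sub>0 C where "\<rho>\<^sub>0 > 0" "C > 0" "\<And>T x t i j.
      network_solution n A f H P \<alpha> {0..<T} x \<Longrightarrow> \<forall>i<n. x i 0 \<in> U \<Longrightarrow>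
      \<forall>i<n. \<forall>j<n. norm (x j 0 - x i 0) \<le> \<rho>\<^sub>0 \<Longrightarrow> t \<in> {0..<T} \<Longrightarrow> i < n \<Longrightarrow> j < n \<Longrightarrow>
      norm (x j t - x i t) \<le> C * exp (- \<nu> * t) * spread n (\<lambda>k. x k 0)"
proof -
  from assms obtain \<rho>\<^sub>0 C where pos: "\<rho>\<^sub>0 > 0" "C > 0" and all: "\<forall>t\<^sub>0\<ge>0. \<forall>T. \<forall>x.
        network_solution n A f H P \<alpha> {t\<^sub>0..<T} x
        \<and> (\<forall>i<n. x i t\<^sub>0 \<in> U)
        \<and> (\<forall>i<n. \<forall>j<n. norm (x j t\<^sub>0 - x i t\<^sub>0) \<le> \<rho>\<^sub>0)
        \<longrightarrow> (\<forall>t\<in>{t\<^sub>0..<T}. \<forall>i<n. \<forall>j<n.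
              norm (x j t - x i t) \<le> C * exp (- \<nu> * (t - t\<^sub>0)) * spread n (\<lambda>k. x k t\<^sub>0))"
    unfolding sync_locally_exp_stable_def by (elim conjE exE) (rule that)
  show thesis
  proof (rule that[OF pos])
    fix T x t i j
    assume x: "network_solution n A f H P \<alpha> {0..<T} x" "\<forall>i<n. x i 0 \<in> U"
      "\<forall>i<n. \<forall>j<n. norm (x j 0 - x i 0) \<le> \<rho>\<^sub>0" and t: "t \<in> {0..<T}" and ij: "i < n" "j < n"
    have "network_solution n A f H P \<alpha> {0..<T} x \<and> (\<forall>i<n. x i 0 \<in> U)
        \<and> (\<forall>i<n. \<forall>j<n. norm (x j 0 - x i 0) \<le> \<rho>\<^sub>0)"
      using x by (intro conjI)
    with all[THEN spec, of 0, THEN mp, OF order_refl, THEN spec, of T, THEN spec, of x]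
    have "\<forall>t\<in>{0..<T}. \<forall>i<n. \<forall>j<n.
        norm (x j t - x i t) \<le> C * exp (- \<nu> * (t - 0)) * spread n (\<lambda>k. x k 0)"
      by (rule mp)
    then show "norm (x j t - x i t) \<le> C * exp (- \<nu> * t) * spread n (\<lambda>k. x k 0)"
      using t ij by simp
  qed
qed

text \<open>The eigenbasis together with the constants that compactness provides for
  \<open>f\<close> on the closed ball only: \<open>\<kappa>\<^sub>0\<close> is the inward margin on
  the sphere, and \<open>f_uniform\<close> is linearisation with one radius for all base
  points.\<close>

locale coupled_network =
  fixes n :: nat and A :: "real mat" and e :: "nat \<Rightarrow> nat \<Rightarrow> real" and \<mu> :: "nat \<Rightarrow> real"
    and f :: "real ^ 'q \<Rightarrow> real ^ 'q" and c :: "real ^ 'q" and \<Gamma> :: "real ^ 'q ^ 'q"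
    and r \<Lambda> \<kappa>\<^sub>0 \<alpha> g :: real
  assumes net: "network n A" and eb: "laplacian_eigenbasis n A e \<mu>"
    and \<alpha>: "\<alpha> > 0" and \<Lambda>: "\<Lambda> > 0" and r: "r > 0"
    and f_lipschitz: "\<And>x y. x \<in> cball c r \<Longrightarrow> y \<in> cball c r \<Longrightarrow> norm (f x - f y) \<le> \<Lambda> * norm (x - y)"
    and jacobian_bound: "\<And>x v. x \<in> cball c r \<Longrightarrow> norm (jacobian f (at x) *v v) \<le> \<Lambda> * norm v"
    and f_uniform: "\<And>\<kappa>. \<kappa> > 0 \<Longrightarrow> \<exists>d>0. \<forall>x\<in>cball c r. \<forall>y\<in>cball c r. norm (y - x) < d \<longrightarrow>
      norm (f y - f x - jacobian f (at x) *v (y - x)) \<le> \<kappa> * norm (y - x)"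
    and \<kappa>\<^sub>0: "\<kappa>\<^sub>0 > 0" and inflow: "\<And>x. x \<in> sphere c r \<Longrightarrow> inner (f x) (x - c) \<le> - \<kappa>\<^sub>0"
    and g: "g > 0" "\<And>w. norm (\<Gamma> *v w) \<le> g * norm w"
begin

lemma matrix_vector_mult_sum_scaleR:
  fixes G :: "real ^ 'q ^ 'q"
  shows "G *v (\<Sum>i\<in>I. a i *\<^sub>R y i) = (\<Sum>i\<in>I. a i *\<^sub>R (G *v y i))"
  by (simp add: linear_sum[OF matrix_vector_mul_linear] matrix_vector_mult_scaleR)

lemma n_ge_2: "n \<ge> 2"
  using net unfolding network_def by simp

lemma norm_adjacency_sum_le:
  fixes y :: "nat \<Rightarrow> 'a::real_normed_vector"
  assumes "i < n" "\<And>j. j < n \<Longrightarrow> norm (y j) \<le> B"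
  shows "norm (\<Sum>j<n. A $$ (i, j) *\<^sub>R y j) \<le> real n * B"
proof -
  have "norm (\<Sum>j<n. A $$ (i, j) *\<^sub>R y j) \<le> (\<Sum>j<n. B)"
  proof (rule sum_norm_le)
    fix j assume "j \<in> {..<n}"
    then show "norm (A $$ (i, j) *\<^sub>R y j) \<le> B"
      using mult_right_mono[OF adjacency_entry(2)[OF net assms(1), of j] norm_ge_zero[of "y j"]]
        assms(2)[of j] by simp
  qed
  then show ?thesis by simp
qed

lemma norm_mode_le:
  fixes y :: "nat \<Rightarrow> 'a::real_normed_vector"
  assumes "k < n" "\<And>i. i < n \<Longrightarrow> norm (y i) \<le> B"
  shows "norm (\<Sum>i<n. e k i *\<^sub>R y i) \<le> real n * B"
proof -
  have "norm (\<Sum>i<n. e k i *\<^sub>R y i) \<le> (\<Sum>i<n. B)"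
  proof (rule sum_norm_le)
    fix i assume "i \<in> {..<n}"
    then show "norm (e k i *\<^sub>R y i) \<le> B"
      using mult_right_mono[OF eigenvector_entry_le_1[OF net eb assms(1), of i] norm_ge_zero[of "y i"]]
        assms(2)[of i] by simp
  qed
  then show ?thesis by simp
qed

text \<open>Precomposing \<open>f\<close> with the nearest-point projection onto the closed ball
  makes it globally Lipschitz. Confinement keeps the solution of the modified equation in the ball,
  where both fields agree.\<close>

lemma coupled_solution_exists:
  fixes W :: "real ^ 'q \<Rightarrow> real ^ 'q" and T L \<sigma> r1 :: real
  defines "M \<equiv> real (n * n) * exp (real (n * n) * (\<Lambda> + 2 * \<alpha> * L) * T)"
  assumes W: "\<And>x y. norm (W x - W y) \<le> L * norm (x - y)" "W 0 = 0" and L: "L \<ge> 0"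
    and z0: "\<And>i. i < n \<Longrightarrow> z0 i \<in> ball c r" "\<And>i j. i < n \<Longrightarrow> j < n \<Longrightarrow> norm (z0 j - z0 i) \<le> \<sigma>"
    and \<sigma>: "\<sigma> \<ge> 0" and r1: "\<alpha> * (real n * (L * r1)) * r < \<kappa>\<^sub>0" "M * \<sigma> < r1"
  obtains x where "\<And>i. i < n \<Longrightarrow> x i 0 = z0 i"
    "\<And>i t. i < n \<Longrightarrow> t \<in> {0..<T} \<Longrightarrow> (x i has_vector_derivative
      f (x i t) + \<alpha> *\<^sub>R (\<Sum>j<n. A $$ (i, j) *\<^sub>R W (x j t - x i t))) (at t within {0..<T})"
    "\<And>i t. i < n \<Longrightarrow> t \<in> {0..<T} \<Longrightarrow> x i t \<in> ball c r"
    "\<And>i j t. i < n \<Longrightarrow> j < n \<Longrightarrow> t \<in> {0..<T} \<Longrightarrow> norm (x j t - x i t) \<le> M * \<sigma>"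
proof -
  define F where "F = (\<lambda>x. f (closest_point (cball c r) x))"
  have ne: "cball c r \<noteq> {}" using r by simp
  have Flip: "norm (F x - F y) \<le> \<Lambda> * norm (x - y)" for x y
  proof -
    have "norm (F x - F y) \<le> \<Lambda> * norm (closest_point (cball c r) x - closest_point (cball c r) y)"
      unfolding F_def using closest_point_in_set[OF closed_cball ne] by (intro f_lipschitz) auto
    also have "\<dots> \<le> \<Lambda> * norm (x - y)"
      using closest_point_lipschitz[OF convex_cball closed_cball ne, of x y] \<Lambda>
      by (intro mult_left_mono) (auto simp: dist_norm)
    finally show ?thesis .
  qed
  have Ff: "F x = f x" if "x \<in> cball c r" for x
    unfolding F_def using closest_point_self[OF that] by simp
  obtain x where x0: "\<And>i. i < n \<Longrightarrow> x i 0 = z0 i"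
    and xd: "\<And>i t. i < n \<Longrightarrow> t \<ge> 0 \<Longrightarrow> (x i has_vector_derivative
      F (x i t) + (\<Sum>j<n. (\<alpha> * A $$ (i, j)) *\<^sub>R W (x j t - x i t))) (at t within {0..})"
    by (rule network_ode_solution_exists[OF Flip W(1), of n z0 "\<lambda>i j. \<alpha> * A $$ (i, j)"]) (rule that)
  define v where "v = (\<lambda>i t. F (x i t) + \<alpha> *\<^sub>R (\<Sum>j<n. A $$ (i, j) *\<^sub>R W (x j t - x i t)))"
  have der: "(x i has_vector_derivative v i t) (at t within {0..<T})" if "i < n" "t \<in> {0..<T}" for i t
  proof -
    have "t \<ge> 0" "{0..<T} \<subseteq> {0..}" using that(2) by auto
    then have "(x i has_vector_derivative F (x i t) + (\<Sum>j<n. (\<alpha> * A $$ (i, j)) *\<^sub>R W (x j t - x i t)))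
        (at t within {0..<T})"
      by (rule has_vector_derivative_within_subset[OF xd[OF that(1)]])
    also have "F (x i t) + (\<Sum>j<n. (\<alpha> * A $$ (i, j)) *\<^sub>R W (x j t - x i t)) = v i t"
      unfolding v_def scaleR_sum_right scaleR_scaleR ..
    finally show ?thesis .
  qed
  have Wn: "norm (W w) \<le> L * norm w" for w using W(1)[of w 0] W(2) by simp
  have conf: "\<forall>i<n. x i t \<in> ball c r \<and> (\<forall>j<n. norm (x j t - x i t) \<le> M * \<sigma>)" if "t \<in> {0..<T}" for t
    unfolding M_def
  proof (rule network_coupled_confinement[OF net \<alpha> L \<Lambda> r f_lipschitz inflow r1(1) der _ _ \<sigma> _ _ r1(2)[unfolded M_def] that,
        where q = "\<lambda>i j t. W (x j t - x i t)"])
    show "v i t = f (x i t) + \<alpha> *\<^sub>R (\<Sum>j<n. A $$ (i, j) *\<^sub>R W (x j t - x i t))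
      \<and> (\<forall>j<n. norm (W (x j t - x i t)) \<le> L * norm (x j t - x i t))"
      if "i < n" "\<forall>k<n. x k t \<in> cball c r" for i t
    proof (intro conjI allI impI Wn)
      have "F (x i t) = f (x i t)" using that by (intro Ff) blast
      then show "v i t = f (x i t) + \<alpha> *\<^sub>R (\<Sum>j<n. A $$ (i, j) *\<^sub>R W (x j t - x i t))"
        unfolding v_def by (simp only:)
    qed
    show "x i 0 \<in> ball c r" if "i < n" for i using x0[OF that] z0(1)[OF that] by simp
    show "norm (x j 0 - x i 0) \<le> \<sigma>" if "i < n" "j < n" for i j
      using x0 z0(2) that by simp
  qed simp_all
  show thesis
  proof (rule that[of x, OF x0])
    fix i t assume i: "i < n" and t: "t \<in> {0..<T}"
    show xb: "x i t \<in> ball c r" using conf[OF t] i by blast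
    then have "F (x i t) = f (x i t)" by (intro Ff) (simp add: less_imp_le)
    then show "(x i has_vector_derivative
      f (x i t) + \<alpha> *\<^sub>R (\<Sum>j<n. A $$ (i, j) *\<^sub>R W (x j t - x i t))) (at t within {0..<T})"
      using der[OF i t] unfolding v_def by simp
    show "norm (x j t - x i t) \<le> M * \<sigma>" if "j < n" for j using conf[OF t] i that by blast
  qed
qed

text \<open>Up to small multiples of \<sigma>, the projections of \<open>x\<close> and
  \<open>u\<close> onto mode \<open>k\<close> solve linear equations with the operators
  \<open>J t + a\<close> and \<open>J t\<close>, where \<open>J t\<close> is the Jacobian minus
  \<open>\<alpha> * \<mu> k\<close> times \<Gamma>. The scalar
  \<open>a = \<alpha> * \<epsilon> * \<mu> k\<close> splits off as \<open>exp (a * t)\<close>;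
  afterwards both curves obey the same equation from the same initial value, and Gronwall's
  inequality compares them.\<close>

lemma mode_growth:
  fixes W :: "real ^ 'q \<Rightarrow> real ^ 'q" and \<tau> \<kappa> \<kappa>\<^sub>1 \<sigma> M \<epsilon> m :: real
  defines "b \<equiv> \<Lambda> + \<alpha> * m * g"
  assumes k: "k < n" "\<mu> k \<noteq> 0" "\<mu> k \<le> m" and \<tau>: "\<tau> \<ge> 0" and \<epsilon>: "\<epsilon> \<ge> 0"
    and nonneg: "\<kappa> \<ge> 0" "\<kappa>\<^sub>1 \<ge> 0" "M \<ge> 0" "\<sigma> \<ge> 0"
    and xd: "\<And>i t. i < n \<Longrightarrow> t \<in> {0..\<tau>} \<Longrightarrow> (x i has_vector_derivative
      f (x i t) + \<alpha> *\<^sub>R (\<Sum>j<n. A $$ (i, j) *\<^sub>R W (x j t - x i t))) (at t within {0..\<tau>})"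
    and ud: "\<And>i t. i < n \<Longrightarrow> t \<in> {0..\<tau>} \<Longrightarrow> (u i has_vector_derivative v i t) (at t within {0..\<tau>})"
    and v: "\<And>i t. i < n \<Longrightarrow> t \<in> {0..\<tau>} \<Longrightarrow>
      norm (v i t - (f (z i t) + \<alpha> *\<^sub>R (\<Sum>j<n. A $$ (i, j) *\<^sub>R (\<Gamma> *v (z j t - z i t))))) \<le> \<kappa> * \<sigma>"
    and init: "\<And>i. i < n \<Longrightarrow> x i 0 = u i 0"
    and inball: "\<And>i t. i < n \<Longrightarrow> t \<in> {0..\<tau>} \<Longrightarrow> x i t \<in> cball c r \<and> z i t \<in> cball c r"
    and near: "\<And>i t. i < n \<Longrightarrow> t \<in> {0..\<tau>} \<Longrightarrow>
      norm (x i t - z 0 t) \<le> M * \<sigma> \<and> norm (z i t - z 0 t) \<le> M * \<sigma> \<and> norm (u i t - z i t) \<le> \<kappa> * \<sigma>"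
    and lin: "\<And>x y. x \<in> cball c r \<Longrightarrow> y \<in> cball c r \<Longrightarrow> norm (y - x) \<le> M * \<sigma> \<Longrightarrow>
      norm (f y - f x - jacobian f (at x) *v (y - x)) \<le> \<kappa>\<^sub>1 * norm (y - x)"
    and W: "\<And>i j t. i < n \<Longrightarrow> j < n \<Longrightarrow> t \<in> {0..\<tau>} \<Longrightarrow>
      norm (W (x j t - x i t) - (\<Gamma> *v (x j t - x i t) - \<epsilon> *\<^sub>R (x j t - x i t))) \<le> \<kappa> * \<sigma>"
  defines "C \<equiv> 2 * (real n * (\<kappa>\<^sub>1 * (M * \<sigma>))) + \<alpha> * (real n * (real n * (\<kappa> * \<sigma>)))
    + real n * (\<kappa> * \<sigma>) + b * (real n * (\<kappa> * \<sigma>))"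
  shows "exp (\<alpha> * \<epsilon> * \<mu> k * \<tau>) * (norm (\<Sum>i<n. e k i *\<^sub>R u i \<tau>) - C / b * exp (b * \<tau>))
    \<le> norm (\<Sum>i<n. e k i *\<^sub>R x i \<tau>)"
proof -
  define \<psi> where "\<psi> = (\<lambda>y :: nat \<Rightarrow> real ^ 'q. \<Sum>i<n. e k i *\<^sub>R y i)"
  \<comment> \<open>A single Jacobian, along node 0 of \<open>z\<close>, serves all nodes; only then
    does it commute with the projection onto a mode.\<close>
  define D where "D = (\<lambda>t. jacobian f (at (z 0 t)))"
  define J where "J = (\<lambda>t w. D t *v w - (\<alpha> * \<mu> k) *\<^sub>R (\<Gamma> *v w))"
  have \<mu>0: "\<mu> k \<ge> 0" using eigenvalue_nonneg[OF net eb k(1)] .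
  have m0: "m \<ge> 0" using \<mu>0 k(3) by simp
  have b: "b > 0" unfolding b_def using \<Lambda> \<alpha> m0 g by (simp add: add_pos_nonneg)
  have n0: "0 < n" using n_ge_2 by simp
  have esum: "(\<Sum>i<n. e k i) = 0" by (rule eigenvector_sum_0[OF net eb k(1,2)])
  have J_diff: "J t (w - w') = J t w - J t w'" for t w w'
    unfolding J_def by (simp add: matrix_vector_mult_diff_distrib algebra_simps)
  have J_scale: "J t (s *\<^sub>R w) = s *\<^sub>R J t w" for t s w
    unfolding J_def by (simp add: matrix_vector_mult_scaleR algebra_simps)
  have J_le: "norm (J t w) \<le> b * norm w" if t: "t \<in> {0..\<tau>}" for t w
  proof -
    have "norm (J t w) \<le> norm (D t *v w) + norm ((\<alpha> * \<mu> k) *\<^sub>R (\<Gamma> *v w))"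
      unfolding J_def by (rule norm_triangle_ineq4)
    also have "norm (D t *v w) \<le> \<Lambda> * norm w"
      unfolding D_def using inball[OF n0 t] by (intro jacobian_bound) blast
    also have "norm ((\<alpha> * \<mu> k) *\<^sub>R (\<Gamma> *v w)) = \<alpha> * \<mu> k * norm (\<Gamma> *v w)" using \<alpha> \<mu>0 by simp
    also have "\<dots> \<le> \<alpha> * m * (g * norm w)"
      using \<alpha> \<mu>0 k(3) g m0 by (intro mult_mono) auto
    finally show ?thesis unfolding b_def by (simp add: algebra_simps)
  qed
  have linsum: "norm ((\<Sum>i<n. e k i *\<^sub>R f (y i)) - D t *v \<psi> y) \<le> real n * (\<kappa>\<^sub>1 * (M * \<sigma>))"
    if t: "t \<in> {0..\<tau>}" and y: "\<And>i. i < n \<Longrightarrow> y i \<in> cball c r \<and> norm (y i - z 0 t) \<le> M * \<sigma>" for t y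
  proof -
    have "(\<Sum>i<n. e k i *\<^sub>R (f (y i) - f (z 0 t) - D t *v (y i - z 0 t)))
        = (\<Sum>i<n. e k i *\<^sub>R f (y i)) - (\<Sum>i<n. e k i) *\<^sub>R f (z 0 t)
          - ((\<Sum>i<n. e k i *\<^sub>R (D t *v y i)) - (\<Sum>i<n. e k i) *\<^sub>R (D t *v z 0 t))"
      by (simp add: matrix_vector_mult_diff_distrib scaleR_diff_right sum_subtractf scaleR_sum_left)
    also have "\<dots> = (\<Sum>i<n. e k i *\<^sub>R f (y i)) - D t *v \<psi> y"
      unfolding esum \<psi>_def by (simp add: matrix_vector_mult_sum_scaleR)
    finally have eq: "(\<Sum>i<n. e k i *\<^sub>R f (y i)) - D t *v \<psi> y
        = (\<Sum>i<n. e k i *\<^sub>R (f (y i) - f (z 0 t) - D t *v (y i - z 0 t)))" ..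
    have le: "norm (f (y i) - f (z 0 t) - D t *v (y i - z 0 t)) \<le> \<kappa>\<^sub>1 * (M * \<sigma>)" if "i < n" for i
    proof -
      have "norm (f (y i) - f (z 0 t) - D t *v (y i - z 0 t)) \<le> \<kappa>\<^sub>1 * norm (y i - z 0 t)"
        unfolding D_def using y[OF that] inball[OF n0 t] by (intro lin) auto
      also have "\<dots> \<le> \<kappa>\<^sub>1 * (M * \<sigma>)" using y[OF that] nonneg by (intro mult_left_mono) auto
      finally show ?thesis .
    qed
    show ?thesis unfolding eq by (rule norm_mode_le[OF k(1) le])
  qed
  have \<Gamma>sum: "(\<Sum>i<n. e k i *\<^sub>R (\<Sum>j<n. A $$ (i, j) *\<^sub>R (\<Gamma> *v (y j - y i)))) = - \<mu> k *\<^sub>R (\<Gamma> *v \<psi> y)" for y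
    using eigenvector_coupling_sum[OF net eb k(1), of "\<lambda>i. \<Gamma> *v y i"]
    unfolding \<psi>_def by (simp add: matrix_vector_mult_diff_distrib matrix_vector_mult_sum_scaleR)
  have Isum: "(\<Sum>i<n. e k i *\<^sub>R (\<Sum>j<n. A $$ (i, j) *\<^sub>R (y j - y i))) = - \<mu> k *\<^sub>R \<psi> y" for y
    unfolding \<psi>_def by (rule eigenvector_coupling_sum[OF net eb k(1)])
  define x' where "x' = (\<lambda>t. \<Sum>i<n. e k i *\<^sub>R (f (x i t) + \<alpha> *\<^sub>R (\<Sum>j<n. A $$ (i, j) *\<^sub>R W (x j t - x i t))))"
  define u' where "u' = (\<lambda>t. \<Sum>i<n. e k i *\<^sub>R v i t)"
  define X where "X = (\<lambda>t. \<psi> (\<lambda>i. x i t))"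
  define Y where "Y = (\<lambda>t. \<psi> (\<lambda>i. u i t))"
  have Xd: "(X has_vector_derivative x' t) (at t within {0..\<tau>})" if "t \<in> {0..\<tau>}" for t
    unfolding X_def \<psi>_def x'_def
    by (intro has_vector_derivative_sum bounded_linear.has_vector_derivative[OF bounded_linear_scaleR_right] xd that) simp
  have Yd: "(Y has_vector_derivative u' t) (at t within {0..\<tau>})" if "t \<in> {0..\<tau>}" for t
    unfolding Y_def \<psi>_def u'_def
    by (intro has_vector_derivative_sum bounded_linear.has_vector_derivative[OF bounded_linear_scaleR_right] ud that) simp
  define a where "a = \<alpha> * \<epsilon> * \<mu> k"
  have a0: "a \<ge> 0" unfolding a_def using \<alpha> \<epsilon> \<mu>0 by simp
  \<comment> \<open>Two errors: the linearisation of \<open>f\<close>, and the deviation of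
    \<open>W\<close> from \<Gamma> minus \<epsilon> times the identity.\<close>
  have Rx: "norm (x' t - (J t (X t) + a *\<^sub>R X t)) \<le> real n * (\<kappa>\<^sub>1 * (M * \<sigma>)) + \<alpha> * (real n * (real n * (\<kappa> * \<sigma>)))"
    if t: "t \<in> {0..\<tau>}" for t
  proof -
    define w where "w = (\<lambda>i j. W (x j t - x i t) - (\<Gamma> *v (x j t - x i t) - \<epsilon> *\<^sub>R (x j t - x i t)))"
    define P where "P = (\<lambda>i. \<Sum>j<n. A $$ (i, j) *\<^sub>R w i j)"
    define Q where "Q = (\<lambda>i. \<Sum>j<n. A $$ (i, j) *\<^sub>R (\<Gamma> *v (x j t - x i t)))"
    define R where "R = (\<lambda>i. \<Sum>j<n. A $$ (i, j) *\<^sub>R (x j t - x i t))"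
    have "(\<Sum>j<n. A $$ (i, j) *\<^sub>R W (x j t - x i t)) = P i + Q i - \<epsilon> *\<^sub>R R i" for i
      unfolding P_def Q_def R_def w_def scaleR_sum_right sum.distrib[symmetric] sum_subtractf[symmetric]
      by (intro sum.cong refl) (simp add: algebra_simps)
    then have "x' t = (\<Sum>i<n. e k i *\<^sub>R (f (x i t) + \<alpha> *\<^sub>R (P i + Q i - \<epsilon> *\<^sub>R R i)))"
      unfolding x'_def by simp
    also have "\<dots> = (\<Sum>i<n. e k i *\<^sub>R f (x i t)) + \<alpha> *\<^sub>R ((\<Sum>i<n. e k i *\<^sub>R P i)
        + (\<Sum>i<n. e k i *\<^sub>R Q i) - \<epsilon> *\<^sub>R (\<Sum>i<n. e k i *\<^sub>R R i))"
      by (simp add: scaleR_add_right scaleR_diff_right sum.distrib sum_subtractf scaleR_sum_right mult_ac)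
    also have "(\<Sum>i<n. e k i *\<^sub>R Q i) = - \<mu> k *\<^sub>R (\<Gamma> *v X t)"
      unfolding Q_def X_def by (rule \<Gamma>sum)
    also have "(\<Sum>i<n. e k i *\<^sub>R R i) = - \<mu> k *\<^sub>R X t"
      unfolding R_def X_def by (rule Isum)
    finally have x't: "x' t = (\<Sum>i<n. e k i *\<^sub>R f (x i t)) + \<alpha> *\<^sub>R ((\<Sum>i<n. e k i *\<^sub>R P i)
        + - \<mu> k *\<^sub>R (\<Gamma> *v X t) - \<epsilon> *\<^sub>R (- \<mu> k *\<^sub>R X t))" .
    have "x' t - (J t (X t) + a *\<^sub>R X t) = ((\<Sum>i<n. e k i *\<^sub>R f (x i t)) - D t *v X t)
        + \<alpha> *\<^sub>R (\<Sum>i<n. e k i *\<^sub>R P i)"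
      unfolding x't J_def a_def by (simp add: algebra_simps)
    also have "norm \<dots> \<le> real n * (\<kappa>\<^sub>1 * (M * \<sigma>)) + \<alpha> * (real n * (real n * (\<kappa> * \<sigma>)))"
    proof (rule norm_triangle_mono)
      show "norm ((\<Sum>i<n. e k i *\<^sub>R f (x i t)) - D t *v X t) \<le> real n * (\<kappa>\<^sub>1 * (M * \<sigma>))"
        unfolding X_def using linsum[OF t, of "\<lambda>i. x i t"] inball near t by blast
      have "norm (\<Sum>i<n. e k i *\<^sub>R P i) \<le> real n * (real n * (\<kappa> * \<sigma>))"
        using W t unfolding P_def w_def by (intro norm_mode_le[OF k(1)] norm_adjacency_sum_le) auto
      then show "norm (\<alpha> *\<^sub>R (\<Sum>i<n. e k i *\<^sub>R P i)) \<le> \<alpha> * (real n * (real n * (\<kappa> * \<sigma>)))"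
        using \<alpha> by simp
    qed
    finally show ?thesis .
  qed
  \<comment> \<open>Three errors: the defect of \<open>u\<close>, the linearisation of
    \<open>f\<close> along \<open>z\<close>, and the gap between \<open>u\<close> and
    \<open>z\<close> fed through \<open>J\<close>.\<close>
  have Ru: "norm (u' t - J t (Y t)) \<le> real n * (\<kappa> * \<sigma>) + real n * (\<kappa>\<^sub>1 * (M * \<sigma>)) + b * (real n * (\<kappa> * \<sigma>))"
    if t: "t \<in> {0..\<tau>}" for t
  proof -
    define w where "w = (\<lambda>i. v i t - (f (z i t) + \<alpha> *\<^sub>R (\<Sum>j<n. A $$ (i, j) *\<^sub>R (\<Gamma> *v (z j t - z i t)))))"
    define Z where "Z = \<psi> (\<lambda>i. z i t)"
    define Q where "Q = (\<lambda>i. \<Sum>j<n. A $$ (i, j) *\<^sub>R (\<Gamma> *v (z j t - z i t)))"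
    have "v i t = w i + f (z i t) + \<alpha> *\<^sub>R Q i" for i
      unfolding w_def Q_def by simp
    then have "u' t = (\<Sum>i<n. e k i *\<^sub>R w i) + (\<Sum>i<n. e k i *\<^sub>R f (z i t))
        + \<alpha> *\<^sub>R (\<Sum>i<n. e k i *\<^sub>R Q i)"
      unfolding u'_def by (simp add: scaleR_add_right sum.distrib scaleR_sum_right mult_ac)
    also have "(\<Sum>i<n. e k i *\<^sub>R Q i) = - \<mu> k *\<^sub>R (\<Gamma> *v Z)"
      unfolding Q_def Z_def by (rule \<Gamma>sum)
    finally have u't: "u' t = (\<Sum>i<n. e k i *\<^sub>R w i) + (\<Sum>i<n. e k i *\<^sub>R f (z i t))
        + \<alpha> *\<^sub>R (- \<mu> k *\<^sub>R (\<Gamma> *v Z))" .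
    have "u' t - J t (Y t) = (\<Sum>i<n. e k i *\<^sub>R w i) + ((\<Sum>i<n. e k i *\<^sub>R f (z i t)) - D t *v Z) + J t (Z - Y t)"
      unfolding u't J_diff by (simp add: J_def)
    also have "norm \<dots> \<le> real n * (\<kappa> * \<sigma>) + real n * (\<kappa>\<^sub>1 * (M * \<sigma>)) + b * (real n * (\<kappa> * \<sigma>))"
    proof (intro norm_triangle_mono)
      show "norm (\<Sum>i<n. e k i *\<^sub>R w i) \<le> real n * (\<kappa> * \<sigma>)"
        using v t unfolding w_def by (intro norm_mode_le[OF k(1)]) auto
      show "norm ((\<Sum>i<n. e k i *\<^sub>R f (z i t)) - D t *v Z) \<le> real n * (\<kappa>\<^sub>1 * (M * \<sigma>))"
        unfolding Z_def using linsum[OF t, of "\<lambda>i. z i t"] inball near t by blast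
      have "Z - Y t = (\<Sum>i<n. e k i *\<^sub>R (z i t - u i t))"
        unfolding Z_def Y_def \<psi>_def by (simp add: scaleR_diff_right sum_subtractf)
      then have "norm (Z - Y t) \<le> real n * (\<kappa> * \<sigma>)"
        using norm_mode_le[OF k(1), of "\<lambda>i. z i t - u i t" "\<kappa> * \<sigma>"] near t by (simp add: norm_minus_commute)
      then show "norm (J t (Z - Y t)) \<le> b * (real n * (\<kappa> * \<sigma>))"
        using J_le[OF t, of "Z - Y t"] b by (meson mult_left_mono less_imp_le order_trans)
    qed
    finally show ?thesis .
  qed
  \<comment> \<open>Removes the scalar growth from \<open>X\<close>. As \<open>E t \<le> 1\<close>,
    the errors in the equation of \<open>X\<close> are not amplified.\<close>
  define E where "E = (\<lambda>t. exp (- (a * t)))"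
  define w where "w = (\<lambda>t. E t *\<^sub>R X t - Y t)"
  define w' where "w' = (\<lambda>t. E t *\<^sub>R (x' t - a *\<^sub>R X t) - u' t)"
  have wd: "(w has_vector_derivative w' t) (at t within {0..\<tau>})" if t: "t \<in> {0..\<tau>}" for t
  proof -
    have "(E has_real_derivative - a * E t) (at t within {0..\<tau>})"
      unfolding E_def by (auto intro!: derivative_eq_intros)
    from has_vector_derivative_scaleR[OF this Xd[OF t]]
    have "((\<lambda>t. E t *\<^sub>R X t) has_vector_derivative (E t *\<^sub>R x' t + (- a * E t) *\<^sub>R X t)) (at t within {0..\<tau>})" .
    from has_vector_derivative_diff[OF this Yd[OF t]] show ?thesis
      unfolding w_def w'_def by (simp add: algebra_simps)
  qed
  have w'_le: "norm (w' t) \<le> b * norm (w t) + C" if t: "t \<in> {0..\<tau>}" for t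
  proof -
    have E1: "0 \<le> E t" "E t \<le> 1" unfolding E_def using a0 t by auto
    have w't: "w' t = J t (w t) + E t *\<^sub>R (x' t - (J t (X t) + a *\<^sub>R X t)) - (u' t - J t (Y t))"
      unfolding w'_def w_def J_diff J_scale by (simp add: algebra_simps)
    have "norm (w' t) \<le> norm (J t (w t)) + norm (E t *\<^sub>R (x' t - (J t (X t) + a *\<^sub>R X t))) + norm (u' t - J t (Y t))"
      unfolding w't by (rule order_trans[OF norm_triangle_ineq4 add_right_mono[OF norm_triangle_ineq]])
    moreover have "norm (E t *\<^sub>R (x' t - (J t (X t) + a *\<^sub>R X t))) \<le> norm (x' t - (J t (X t) + a *\<^sub>R X t))"
      using E1 by (simp add: mult_left_le_one_le)
    ultimately show ?thesis using J_le[OF t, of "w t"] Rx[OF t] Ru[OF t] unfolding C_def by linarith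
  qed
  have C0: "C \<ge> 0" unfolding C_def using nonneg \<alpha> b by simp
  have "(\<Sum>l\<in>{()}. norm (w \<tau>)) \<le> ((\<Sum>l\<in>{()}. norm (w 0)) + C / b) * exp (card {()} * b * (\<tau> - 0))"
    by (rule gronwall_family[where w = "\<lambda>_. w" and w' = "\<lambda>_. w'"])
      (use b C0 \<tau> wd w'_le in auto)
  moreover have "w 0 = 0"
    unfolding w_def E_def X_def Y_def \<psi>_def using init by simp
  ultimately have "norm (w \<tau>) \<le> C / b * exp (b * \<tau>)" by simp
  moreover have "norm (Y \<tau>) \<le> norm (E \<tau> *\<^sub>R X \<tau>) + norm (w \<tau>)"
    unfolding w_def using norm_triangle_sub[of "Y \<tau>" "E \<tau> *\<^sub>R X \<tau>"] by (simp add: norm_minus_commute)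
  moreover have "norm (E \<tau> *\<^sub>R X \<tau>) = norm (X \<tau>) / exp (a * \<tau>)"
    unfolding E_def by (simp add: exp_minus divide_inverse)
  ultimately have "norm (Y \<tau>) - C / b * exp (b * \<tau>) \<le> norm (X \<tau>) / exp (a * \<tau>)" by linarith
  then have "exp (a * \<tau>) * (norm (Y \<tau>) - C / b * exp (b * \<tau>)) \<le> norm (X \<tau>)"
    by (simp add: pos_le_divide_eq mult.commute)
  then show ?thesis unfolding a_def X_def Y_def \<psi>_def .
qed

text \<open>\<open>\<kappa>\<close>, \<open>\<rho>\<close> and \<open>Mx\<close> are quantified
  before \<epsilon>, \<sigma> and \<open>W\<close>, because the final coupling function is assembled
  from scales chosen in terms of these constants. \<open>W\<close> has to resemble \<Gamma> minus
  \<epsilon> only up to length \<open>Mx * \<sigma>\<close>, which bounds all differences that the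
  solution meets.\<close>

lemma hump_growth:
  fixes \<tau> M \<theta> L :: real
  assumes \<tau>: "\<tau> > 0" and M: "M \<ge> 0" and \<theta>: "\<theta> > 0" and L: "L \<ge> 0"
  shows "\<exists>\<kappa>>0. \<exists>\<rho>>0. \<exists>Mx>0. \<forall>\<epsilon>\<ge>0. \<forall>\<sigma> z u W. 0 < \<sigma> \<and> \<sigma> \<le> \<rho> \<and> shadowing n A f \<Gamma> \<alpha> c r \<tau> M \<kappa> \<sigma> z u
    \<and> (\<forall>x y. norm (W x - W y) \<le> L * norm (x - y)) \<and> W 0 = 0
    \<and> (\<forall>w. norm w \<le> Mx * \<sigma> \<longrightarrow> norm (W w - (\<Gamma> *v w - \<epsilon> *\<^sub>R w)) \<le> \<kappa> * \<sigma>) \<longrightarrow>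
    (\<exists>x. (\<forall>i<n. x i 0 = z i 0) \<and> network_solution n A f W (\<lambda>_ _ _. 0) \<alpha> {0..<\<tau> + 1} x
      \<and> (\<forall>k<n. \<mu> k \<noteq> 0 \<longrightarrow> exp (\<alpha> * \<epsilon> * \<mu> k * \<tau>) * (norm (\<Sum>i<n. e k i *\<^sub>R u i \<tau>) - \<theta> * \<sigma>)
          \<le> norm (\<Sum>i<n. e k i *\<^sub>R x i \<tau>)))"
proof -
  \<comment> \<open>The extra unit of time puts the closed interval up to \<tau> inside the
    half-open domain of the solution.\<close>
  define Mx where "Mx = real (n * n) * exp (real (n * n) * (\<Lambda> + 2 * \<alpha> * L) * (\<tau> + 1))"
  define r1 where "r1 = \<kappa>\<^sub>0 / (\<alpha> * (real n * L) * r + 1)"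
  define m where "m = (\<Sum>k<n. \<mu> k)"
  define b where "b = \<Lambda> + \<alpha> * m * g"
  \<comment> \<open>\<open>C1\<close> bounds the inhomogeneity in a crude comparison of
    \<open>x\<close> with \<open>u\<close>, and \<open>M2 * \<sigma>\<close> the resulting distance
    of \<open>x\<close> from node 0 of \<open>z\<close>. Both are fixed before
    \<open>\<kappa>\<close>, using only \<open>\<kappa> \<le> 1\<close>.\<close>
  define C1 where "C1 = \<Lambda> + \<alpha> * (real n * (L * Mx + g * M)) + 1"
  define M2 where "M2 = C1 / \<Lambda> * exp (real n * \<Lambda> * \<tau>) + 1 + M"
  \<comment> \<open>Linearisation errors get one half of the tolerance
    \<open>\<theta> * \<sigma>\<close>, the errors proportional to \<open>\<kappa>\<close> the other
    half.\<close>
  define \<kappa>\<^sub>1 where "\<kappa>\<^sub>1 = \<theta> * b * exp (- (b * \<tau>)) / (4 * (real n * M2))"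
  define D where "D = \<alpha> * (real n * real n) + real n + b * real n"
  define \<kappa> where "\<kappa> = min 1 (\<theta> * b * exp (- (b * \<tau>)) / (2 * D))"
  have n: "real n > 0" using n_ge_2 by simp
  have n0: "0 < n" using n_ge_2 by simp
  have Mx: "Mx > 0" unfolding Mx_def using n by simp
  have den: "\<alpha> * (real n * L) * r + 1 > 0" using \<alpha> L r by (simp add: add_nonneg_pos)
  have r1: "r1 > 0" unfolding r1_def using \<kappa>\<^sub>0 den by simp
  have r1_small: "\<alpha> * (real n * (L * r1)) * r < \<kappa>\<^sub>0"
  proof -
    have "r1 * (\<alpha> * (real n * L) * r) < r1 * (\<alpha> * (real n * L) * r + 1)" using r1 by simp
    also have "\<dots> = \<kappa>\<^sub>0" unfolding r1_def using den by simp
    finally show ?thesis by (simp add: mult_ac)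
  qed
  have \<mu>m: "\<mu> k \<le> m" if "k < n" for k
    unfolding m_def using that eigenvalue_nonneg[OF net eb] by (intro member_le_sum) auto
  have m: "m \<ge> 0" unfolding m_def using eigenvalue_nonneg[OF net eb] by (intro sum_nonneg) auto
  have b: "b > 0" unfolding b_def using \<Lambda> \<alpha> m g by (simp add: add_pos_nonneg)
  have C1: "C1 > 0" unfolding C1_def using \<Lambda> \<alpha> L Mx g M by (simp add: add_pos_nonneg)
  have M2: "M2 > 0" "M \<le> M2" unfolding M2_def using C1 \<Lambda> M by (simp_all add: add_pos_nonneg)
  have \<kappa>\<^sub>1: "\<kappa>\<^sub>1 > 0" unfolding \<kappa>\<^sub>1_def using \<theta> b n M2 by simp
  have D: "D > 0" unfolding D_def using \<alpha> n b by (simp add: add_pos_pos)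
  have \<kappa>: "\<kappa> > 0" "\<kappa> \<le> 1" unfolding \<kappa>_def using \<theta> b D by auto
  obtain d where d: "d > 0" "\<And>x y. x \<in> cball c r \<Longrightarrow> y \<in> cball c r \<Longrightarrow> norm (y - x) < d \<Longrightarrow>
      norm (f y - f x - jacobian f (at x) *v (y - x)) \<le> \<kappa>\<^sub>1 * norm (y - x)"
    using f_uniform[OF \<kappa>\<^sub>1] by auto
  define \<rho> where "\<rho> = min (r1 / (2 * Mx)) (d / (2 * M2))"
  have \<rho>: "\<rho> > 0" unfolding \<rho>_def using r1 Mx d M2 by simp
  show ?thesis
  proof (rule exI[of _ \<kappa>], rule conjI[OF \<kappa>(1)], rule exI[of _ \<rho>], rule conjI[OF \<rho>],
      rule exI[of _ Mx], rule conjI[OF Mx], intro allI impI, elim conjE)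
    fix \<epsilon> \<sigma> z u and W :: "real ^ 'q \<Rightarrow> real ^ 'q"
    assume \<epsilon>: "\<epsilon> \<ge> 0" and \<sigma>: "0 < \<sigma>" "\<sigma> \<le> \<rho>" and sh: "shadowing n A f \<Gamma> \<alpha> c r \<tau> M \<kappa> \<sigma> z u"
      and W: "\<forall>x y. norm (W x - W y) \<le> L * norm (x - y)" "W 0 = 0"
      and Wn: "\<forall>w. norm w \<le> Mx * \<sigma> \<longrightarrow> norm (W w - (\<Gamma> *v w - \<epsilon> *\<^sub>R w)) \<le> \<kappa> * \<sigma>"
    have z0: "\<And>i. i < n \<Longrightarrow> z i 0 \<in> ball c r" "\<And>i. i < n \<Longrightarrow> u i 0 = z i 0"
        "\<And>i j. i < n \<Longrightarrow> j < n \<Longrightarrow> norm (z j 0 - z i 0) \<le> \<sigma>"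
      and zt: "\<And>i t. i < n \<Longrightarrow> t \<in> {0..\<tau>} \<Longrightarrow> z i t \<in> cball c r"
        "\<And>i t. i < n \<Longrightarrow> t \<in> {0..\<tau>} \<Longrightarrow> norm (u i t - z i t) \<le> \<kappa> * \<sigma>"
        "\<And>i j t. i < n \<Longrightarrow> j < n \<Longrightarrow> t \<in> {0..\<tau>} \<Longrightarrow> norm (z j t - z i t) \<le> M * \<sigma>"
      using sh unfolding shadowing_def by blast+
    obtain v where ud: "\<And>i t. i < n \<Longrightarrow> t \<in> {0..\<tau>} \<Longrightarrow> (u i has_vector_derivative v i t) (at t within {0..\<tau>})"
      and v: "\<And>i t. i < n \<Longrightarrow> t \<in> {0..\<tau>} \<Longrightarrow>
        norm (v i t - (f (z i t) + \<alpha> *\<^sub>R (\<Sum>j<n. A $$ (i, j) *\<^sub>R (\<Gamma> *v (z j t - z i t))))) \<le> \<kappa> * \<sigma>"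
      using sh unfolding shadowing_def by blast
    have "Mx * \<sigma> \<le> Mx * (r1 / (2 * Mx))" using \<sigma> Mx unfolding \<rho>_def by (intro mult_left_mono) auto
    also have "\<dots> < r1" using Mx r1 by simp
    finally have small: "Mx * \<sigma> < r1" .
    have "M2 * \<sigma> \<le> M2 * (d / (2 * M2))" using \<sigma> M2 unfolding \<rho>_def by (intro mult_left_mono) auto
    also have "\<dots> < d" using M2 d by simp
    finally have small2: "M2 * \<sigma> < d" .
    have Wlip: "norm (W x - W y) \<le> L * norm (x - y)" for x y using W(1) by blast
    have \<sigma>0: "\<sigma> \<ge> 0" using \<sigma> by simp
    obtain x where x0: "\<And>i. i < n \<Longrightarrow> x i 0 = z i 0"
      and xd: "\<And>i t. i < n \<Longrightarrow> t \<in> {0..<\<tau> + 1} \<Longrightarrow> (x i has_vector_derivative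
        f (x i t) + \<alpha> *\<^sub>R (\<Sum>j<n. A $$ (i, j) *\<^sub>R W (x j t - x i t))) (at t within {0..<\<tau> + 1})"
      and xb: "\<And>i t. i < n \<Longrightarrow> t \<in> {0..<\<tau> + 1} \<Longrightarrow> x i t \<in> ball c r"
      and xx: "\<And>i j t. i < n \<Longrightarrow> j < n \<Longrightarrow> t \<in> {0..<\<tau> + 1} \<Longrightarrow> norm (x j t - x i t) \<le> Mx * \<sigma>"
      by (rule coupled_solution_exists[where T = "\<tau> + 1" and L = L and ?z0.0 = "\<lambda>i. z i 0", folded Mx_def,
            OF Wlip W(2) L z0(1) z0(3) \<sigma>0 r1_small small]) (assumption, assumption, assumption, rule that)
    have I: "t \<in> {0..<\<tau> + 1}" if "t \<in> {0..\<tau>}" for t using that by auto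
    have xd': "(x i has_vector_derivative
        f (x i t) + \<alpha> *\<^sub>R (\<Sum>j<n. A $$ (i, j) *\<^sub>R W (x j t - x i t))) (at t within {0..\<tau>})"
      if "i < n" "t \<in> {0..\<tau>}" for i t
      by (rule has_vector_derivative_within_subset[OF xd[OF that(1) I[OF that(2)]]]) auto
    have Wle: "norm (W w) \<le> L * norm w" for w using Wlip[of w 0] W(2) by simp
    \<comment> \<open>Closeness of order \<sigma> suffices here: it places \<open>x\<close> in the
      neighbourhood of \<open>z 0\<close> in which the linearisation of \<open>f\<close> is
      accurate.\<close>
    have xu: "norm (x i t - u i t) \<le> C1 / \<Lambda> * exp (real n * \<Lambda> * \<tau>) * \<sigma>" if i: "i < n" and t: "t \<in> {0..\<tau>}" for i t
    proof -
      let ?x' = "\<lambda>i s. f (x i s) + \<alpha> *\<^sub>R (\<Sum>j<n. A $$ (i, j) *\<^sub>R W (x j s - x i s))"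
      have "(\<Sum>i\<in>{..<n}. norm (x i t - u i t))
          \<le> ((\<Sum>i\<in>{..<n}. norm (x i 0 - u i 0)) + C1 * \<sigma> / \<Lambda>) * exp (real (card {..<n}) * \<Lambda> * (t - 0))"
      proof (rule gronwall_family[where w' = "\<lambda>i s. ?x' i s - v i s"])
        fix i s assume "i \<in> {..<n}" and st: "s \<in> {0..t}"
        then have i: "i < n" and s: "s \<in> {0..\<tau>}" and sub: "{0..t} \<subseteq> {0..\<tau>}" using t by auto
        show "((\<lambda>t. x i t - u i t) has_vector_derivative ?x' i s - v i s) (at s within {0..t})"
          by (rule has_vector_derivative_within_subset[OF has_vector_derivative_diff[OF xd'[OF i s] ud[OF i s]] sub])
        have 1: "norm (f (x i s) - f (z i s)) \<le> \<Lambda> * norm (x i s - u i s) + \<Lambda> * \<sigma>"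
        proof -
          have "norm (f (x i s) - f (z i s)) \<le> \<Lambda> * norm (x i s - z i s)"
            using xb[OF i I[OF s]] zt(1)[OF i s] by (intro f_lipschitz) auto
          also have "norm (x i s - z i s) \<le> norm (x i s - u i s) + norm (u i s - z i s)"
            by (rule norm_diff_triangle_le[OF order_refl order_refl])
          also have "norm (u i s - z i s) \<le> 1 * \<sigma>"
            using zt(2)[OF i s] mult_right_mono[OF \<kappa>(2) \<sigma>0] by linarith
          finally show ?thesis using \<Lambda> by (simp add: algebra_simps)
        qed
        have 2: "norm (\<Sum>j<n. A $$ (i, j) *\<^sub>R (W (x j s - x i s) - \<Gamma> *v (z j s - z i s))) \<le> real n * ((L * Mx + g * M) * \<sigma>)"
        proof (rule norm_adjacency_sum_le[OF i])
          fix j assume j: "j < n"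
          have "norm (W (x j s - x i s)) \<le> L * (Mx * \<sigma>)"
            using Wle[of "x j s - x i s"] mult_left_mono[OF xx[OF i j I[OF s]] L] by linarith
          moreover have "norm (\<Gamma> *v (z j s - z i s)) \<le> g * (M * \<sigma>)"
            using g(2)[of "z j s - z i s"] mult_left_mono[OF zt(3)[OF i j s] less_imp_le[OF g(1)]] by linarith
          ultimately show "norm (W (x j s - x i s) - \<Gamma> *v (z j s - z i s)) \<le> (L * Mx + g * M) * \<sigma>"
            using norm_triangle_ineq4[of "W (x j s - x i s)" "\<Gamma> *v (z j s - z i s)"] by (simp add: algebra_simps)
        qed
        have 3: "norm (v i s - (f (z i s) + \<alpha> *\<^sub>R (\<Sum>j<n. A $$ (i, j) *\<^sub>R (\<Gamma> *v (z j s - z i s))))) \<le> 1 * \<sigma>"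
          using v[OF i s] mult_right_mono[OF \<kappa>(2) \<sigma>0] by linarith
        have "?x' i s - v i s = (f (x i s) - f (z i s))
            + \<alpha> *\<^sub>R (\<Sum>j<n. A $$ (i, j) *\<^sub>R (W (x j s - x i s) - \<Gamma> *v (z j s - z i s)))
            - (v i s - (f (z i s) + \<alpha> *\<^sub>R (\<Sum>j<n. A $$ (i, j) *\<^sub>R (\<Gamma> *v (z j s - z i s)))))"
          by (simp add: scaleR_diff_right sum_subtractf)
        also have "norm \<dots> \<le> (\<Lambda> * norm (x i s - u i s) + \<Lambda> * \<sigma>) + \<alpha> * (real n * ((L * Mx + g * M) * \<sigma>)) + 1 * \<sigma>"
        proof (rule order_trans[OF norm_triangle_ineq4 add_mono[OF norm_triangle_mono[OF 1] 3]])
          show "norm (\<alpha> *\<^sub>R (\<Sum>j<n. A $$ (i, j) *\<^sub>R (W (x j s - x i s) - \<Gamma> *v (z j s - z i s))))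
            \<le> \<alpha> * (real n * ((L * Mx + g * M) * \<sigma>))"
            using mult_left_mono[OF 2, of \<alpha>] \<alpha> by simp
        qed
        also have "\<dots> = \<Lambda> * norm (x i s - u i s) + C1 * \<sigma>" unfolding C1_def by (simp add: algebra_simps)
        also have "\<dots> \<le> \<Lambda> * (\<Sum>l\<in>{..<n}. norm (x l s - u l s)) + C1 * \<sigma>"
          using \<Lambda> i by (intro add_right_mono mult_left_mono member_le_sum[of i "{..<n}" "\<lambda>l. norm (x l s - u l s)"]) auto
        finally show "norm (?x' i s - v i s) \<le> \<Lambda> * (\<Sum>l\<in>{..<n}. norm (x l s - u l s)) + C1 * \<sigma>" .
      qed (use \<Lambda> C1 \<sigma> t in auto)
      also have "\<dots> = C1 * \<sigma> / \<Lambda> * exp (real n * \<Lambda> * t)" using x0 z0 by simp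
      also have "\<dots> \<le> C1 * \<sigma> / \<Lambda> * exp (real n * \<Lambda> * \<tau>)"
        using C1 \<sigma> \<Lambda> t n by (intro mult_left_mono) auto
      finally have S: "(\<Sum>i\<in>{..<n}. norm (x i t - u i t)) \<le> C1 * \<sigma> / \<Lambda> * exp (real n * \<Lambda> * \<tau>)" .
      have "norm (x i t - u i t) \<le> (\<Sum>i\<in>{..<n}. norm (x i t - u i t))"
        using i by (intro member_le_sum) auto
      then show ?thesis using S by (simp add: mult_ac)
    qed
    have near: "norm (x i t - z 0 t) \<le> M2 * \<sigma> \<and> norm (z i t - z 0 t) \<le> M2 * \<sigma> \<and> norm (u i t - z i t) \<le> \<kappa> * \<sigma>"
      if i: "i < n" and t: "t \<in> {0..\<tau>}" for i t
    proof (intro conjI)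
      show uz: "norm (u i t - z i t) \<le> \<kappa> * \<sigma>" by (rule zt(2)[OF i t])
      have zz: "norm (z i t - z 0 t) \<le> M * \<sigma>" by (rule zt(3)[OF n0 i t])
      then show "norm (z i t - z 0 t) \<le> M2 * \<sigma>"
        using mult_right_mono[OF M2(2) \<sigma>0] by linarith
      have "norm (x i t - z 0 t) \<le> norm (x i t - u i t) + norm (u i t - z i t) + norm (z i t - z 0 t)"
        using norm_triangle_ineq[of "x i t - u i t" "u i t - z i t"] norm_triangle_ineq[of "x i t - z i t" "z i t - z 0 t"]
        by simp
      also have "\<dots> \<le> C1 / \<Lambda> * exp (real n * \<Lambda> * \<tau>) * \<sigma> + 1 * \<sigma> + M * \<sigma>"
        using xu[OF i t] uz zz mult_right_mono[OF \<kappa>(2) \<sigma>0] by linarith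
      finally show "norm (x i t - z 0 t) \<le> M2 * \<sigma>" unfolding M2_def by (simp add: algebra_simps)
    qed
    define E where "E = 2 * (real n * (\<kappa>\<^sub>1 * (M2 * \<sigma>))) + \<alpha> * (real n * (real n * (\<kappa> * \<sigma>)))
        + real n * (\<kappa> * \<sigma>) + b * (real n * (\<kappa> * \<sigma>))"
    have Csmall: "E / b * exp (b * \<tau>) \<le> \<theta> * \<sigma>"
    proof -
      have "2 * (real n * (\<kappa>\<^sub>1 * (M2 * \<sigma>))) = \<sigma> * (\<theta> * b * exp (- (b * \<tau>)) / 2)"
        unfolding \<kappa>\<^sub>1_def using n M2 by (simp add: field_simps)
      moreover have "\<alpha> * (real n * (real n * (\<kappa> * \<sigma>))) + real n * (\<kappa> * \<sigma>) + b * (real n * (\<kappa> * \<sigma>)) = \<sigma> * (\<kappa> * D)"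
        unfolding D_def by (simp add: algebra_simps)
      moreover have "\<sigma> * (\<kappa> * D) \<le> \<sigma> * (\<theta> * b * exp (- (b * \<tau>)) / 2)"
      proof (rule mult_left_mono[OF _ \<sigma>0])
        have "\<kappa> \<le> \<theta> * b * exp (- (b * \<tau>)) / (2 * D)" unfolding \<kappa>_def by simp
        then have "\<kappa> * D \<le> \<theta> * b * exp (- (b * \<tau>)) / (2 * D) * D" using D by (intro mult_right_mono) auto
        then show "\<kappa> * D \<le> \<theta> * b * exp (- (b * \<tau>)) / 2" using D by simp
      qed
      ultimately have "E \<le> \<sigma> * (\<theta> * b * exp (- (b * \<tau>)))"
        unfolding E_def by linarith
      then have "E / b * exp (b * \<tau>)
        \<le> \<sigma> * (\<theta> * b * exp (- (b * \<tau>))) / b * exp (b * \<tau>)"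
        using b by (intro mult_right_mono divide_right_mono) auto
      also have "\<dots> = \<theta> * \<sigma>" using b by (simp add: exp_minus)
      finally show ?thesis .
    qed
    have sol: "network_solution n A f W (\<lambda>_ _ _. 0) \<alpha> {0..<\<tau> + 1} x"
      using xd unfolding network_solution_def coupling_def by simp
    have modes: "exp (\<alpha> * \<epsilon> * \<mu> k * \<tau>) * (norm (\<Sum>i<n. e k i *\<^sub>R u i \<tau>) - \<theta> * \<sigma>)
        \<le> norm (\<Sum>i<n. e k i *\<^sub>R x i \<tau>)" if k: "k < n" "\<mu> k \<noteq> 0" for k
    proof -
      have "exp (\<alpha> * \<epsilon> * \<mu> k * \<tau>) * (norm (\<Sum>i<n. e k i *\<^sub>R u i \<tau>) - E / b * exp (b * \<tau>))
          \<le> norm (\<Sum>i<n. e k i *\<^sub>R x i \<tau>)"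
        unfolding E_def b_def
      proof (rule mode_growth[where W = W and v = v and z = z])
        show "norm (W (x j t - x i t) - (\<Gamma> *v (x j t - x i t) - \<epsilon> *\<^sub>R (x j t - x i t))) \<le> \<kappa> * \<sigma>"
          if "i < n" "j < n" "t \<in> {0..\<tau>}" for i j t
          using Wn xx[OF that(1,2) I[OF that(3)]] by blast
        show "x i t \<in> cball c r \<and> z i t \<in> cball c r" if "i < n" "t \<in> {0..\<tau>}" for i t
          using xb[OF that(1) I[OF that(2)]] zt(1)[OF that] by auto
        show "norm (f y - f w - jacobian f (at w) *v (y - w)) \<le> \<kappa>\<^sub>1 * norm (y - w)"
          if "w \<in> cball c r" "y \<in> cball c r" "norm (y - w) \<le> M2 * \<sigma>" for w y
          using that small2 by (intro d(2)) auto
        show "x i 0 = u i 0" if "i < n" for i using x0 z0 that by simp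
      qed (use k \<mu>m \<tau> \<epsilon> \<kappa> \<kappa>\<^sub>1 M2 \<sigma> in \<open>auto intro: xd' ud v near[THEN conjunct1]
          near[THEN conjunct2, THEN conjunct1] near[THEN conjunct2, THEN conjunct2]\<close>)
      moreover have "exp (\<alpha> * \<epsilon> * \<mu> k * \<tau>) * (norm (\<Sum>i<n. e k i *\<^sub>R u i \<tau>) - \<theta> * \<sigma>)
          \<le> exp (\<alpha> * \<epsilon> * \<mu> k * \<tau>) * (norm (\<Sum>i<n. e k i *\<^sub>R u i \<tau>) - E / b * exp (b * \<tau>))"
        using Csmall by (intro mult_left_mono) auto
      ultimately show ?thesis by linarith
    qed
    show "\<exists>x. (\<forall>i<n. x i 0 = z i 0) \<and> network_solution n A f W (\<lambda>_ _ _. 0) \<alpha> {0..<\<tau> + 1} x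
      \<and> (\<forall>k<n. \<mu> k \<noteq> 0 \<longrightarrow> exp (\<alpha> * \<epsilon> * \<mu> k * \<tau>) * (norm (\<Sum>i<n. e k i *\<^sub>R u i \<tau>) - \<theta> * \<sigma>)
          \<le> norm (\<Sum>i<n. e k i *\<^sub>R x i \<tau>))"
      using x0 sol modes by blast
  qed
qed

section \<open>Slow approximate trajectories contradict stability\<close>

lemma dominant_mode:
  fixes y :: "nat \<Rightarrow> real ^ 'q"
  assumes ij: "i < n" "j < n" and B: "norm (y j - y i) > B"
  obtains k where "k < n" "\<mu> k \<noteq> 0" "norm (\<Sum>l<n. e k l *\<^sub>R y l) > B / (2 * real n)"
proof (rule ccontr)
  assume "\<not> thesis"
  then have small: "norm (\<Sum>l<n. e k l *\<^sub>R y l) \<le> B / (2 * real n)" if "k < n" "\<mu> k \<noteq> 0" for k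
    using that \<open>\<And>k. k < n \<Longrightarrow> \<mu> k \<noteq> 0 \<Longrightarrow> B / (2 * real n) < norm (\<Sum>l<n. e k l *\<^sub>R y l) \<Longrightarrow> thesis\<close>
    by (meson not_le)
  obtain k0 where k0: "k0 < n" "\<mu> k0 \<noteq> 0"
    using nonzero_eigenvalue_exists[OF net eb] by blast
  have B0: "B / (2 * real n) \<ge> 0" using small[OF k0] norm_ge_zero order_trans by blast
  have "y j - y i = (\<Sum>k<n. (e k j - e k i) *\<^sub>R (\<Sum>l<n. e k l *\<^sub>R y l))"
    using eigenbasis_expansion[OF net eb ij(1), of y] eigenbasis_expansion[OF net eb ij(2), of y]
    by (simp add: scaleR_diff_left sum_subtractf)
  \<comment> \<open>At most \<open>n\<close> modes contribute, each with a coefficient of modulus at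
    most 2; constant modes cancel in the difference.\<close>
  also have "norm \<dots> \<le> (\<Sum>k<n. 2 * (B / (2 * real n)))"
  proof (rule sum_norm_le)
    fix k assume "k \<in> {..<n}"
    then have k: "k < n" by simp
    show "norm ((e k j - e k i) *\<^sub>R (\<Sum>l<n. e k l *\<^sub>R y l)) \<le> 2 * (B / (2 * real n))"
    proof (cases "\<mu> k = 0")
      case True
      then show ?thesis using eigenvalue_0_constant[OF net eb k True ij] B0 by simp
    next
      case False
      have "\<bar>e k j - e k i\<bar> \<le> 2"
        using eigenvector_entry_le_1[OF net eb k ij(1)] eigenvector_entry_le_1[OF net eb k ij(2)] by linarith
      then have "\<bar>e k j - e k i\<bar> * norm (\<Sum>l<n. e k l *\<^sub>R y l) \<le> 2 * (B / (2 * real n))"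
        using small[OF k False] by (intro mult_mono) auto
      then show ?thesis by simp
    qed
  qed
  also have "\<dots> = B" using n_ge_2 by simp
  finally show False using B by simp
qed

lemma mode_le_spread:
  fixes y :: "nat \<Rightarrow> real ^ 'q"
  assumes k: "k < n" "\<mu> k \<noteq> 0" and B: "\<And>i j. i < n \<Longrightarrow> j < n \<Longrightarrow> norm (y j - y i) \<le> B"
  shows "norm (\<Sum>l<n. e k l *\<^sub>R y l) \<le> real n * B"
proof -
  have "(\<Sum>l<n. e k l *\<^sub>R (y l - y 0)) = (\<Sum>l<n. e k l *\<^sub>R y l) - (\<Sum>l<n. e k l) *\<^sub>R y 0"
    by (simp add: scaleR_diff_right sum_subtractf scaleR_sum_left)
  then have "(\<Sum>l<n. e k l *\<^sub>R y l) = (\<Sum>l<n. e k l *\<^sub>R (y l - y 0))"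
    using eigenvector_sum_0[OF net eb k] by simp
  then show ?thesis
    using norm_mode_le[OF k(1), of "\<lambda>l. y l - y 0" B] B n_ge_2 by simp
qed

text \<open>Counterexamples are collected at the times \<open>\<tau> m\<close>, and one coupling
  function is built that amplifies all of them. \<open>M\<close> is a function of the time because
  the confinement constant to be inserted grows with the period, and the period is only delivered by
  this lemma.\<close>

lemma strict_contraction:
  fixes M :: "real \<Rightarrow> real"
  assumes pers: "\<And>H. (\<And>x. H differentiable (at x)) \<Longrightarrow> jacobian H (at 0) = \<Gamma> \<Longrightarrow> H 0 = 0 \<Longrightarrow>
      sync_locally_exp_stable n A f (ball c r) H (\<lambda>_ _ _. 0) \<alpha> \<nu>"
    and M: "\<And>\<tau>. M \<tau> \<ge> 0"
  shows "\<exists>\<tau>>0. \<exists>\<kappa>>0. \<exists>\<rho>>0. \<forall>\<sigma> z u. 0 < \<sigma> \<and> \<sigma> \<le> \<rho> \<and> shadowing n A f \<Gamma> \<alpha> c r \<tau> (M \<tau>) \<kappa> \<sigma> z u \<longrightarrow>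
    (\<forall>i<n. \<forall>j<n. norm (u j \<tau> - u i \<tau>) \<le> exp (- \<nu> * \<tau>) * \<sigma> / 2)"
proof (rule ccontr)
  assume neg: "\<not> ?thesis"
  have n: "real n > 0" "0 < n" using n_ge_2 by auto
  define L where "L = g + 3"
  have L: "L \<ge> 0" unfolding L_def using g by simp
  \<comment> \<open>\<open>2 ^ m\<close> compensates the weakening by \<open>2^-m\<close>, and
    \<open>Suc m\<close> makes the gain \<open>exp (\<alpha> * \<mu>\<^sub>0 * real (Suc m))\<close>
    unbounded.\<close>
  define \<tau> where "\<tau> = (\<lambda>m. real (Suc m) * 2 ^ m)"
  \<comment> \<open>With \<open>E = exp (- \<nu> * \<tau> m) * \<sigma>\<close>, a spread above
    \<open>E / 2\<close> forces a mode above \<open>E / (4 * n)\<close>; the tolerance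
    \<open>E / (8 * n)\<close> leaves half of it.\<close>
  define \<theta> where "\<theta> = (\<lambda>m. exp (- \<nu> * \<tau> m) / (8 * real n))"
  have \<tau>: "\<tau> m > 0" and \<theta>: "\<theta> m > 0" for m unfolding \<tau>_def \<theta>_def using n by simp_all
  define grows where "grows = (\<lambda>m \<kappa> \<rho> Mx. \<forall>\<epsilon>\<ge>0. \<forall>\<sigma> z u W. 0 < \<sigma> \<and> \<sigma> \<le> \<rho>
    \<and> shadowing n A f \<Gamma> \<alpha> c r (\<tau> m) (M (\<tau> m)) \<kappa> \<sigma> z u
    \<and> (\<forall>x y. norm (W x - W y) \<le> L * norm (x - y)) \<and> W 0 = 0
    \<and> (\<forall>w. norm w \<le> Mx * \<sigma> \<longrightarrow> norm (W w - (\<Gamma> *v w - \<epsilon> *\<^sub>R w)) \<le> \<kappa> * \<sigma>) \<longrightarrow>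
    (\<exists>x. (\<forall>i<n. x i 0 = z i 0) \<and> network_solution n A f W (\<lambda>_ _ _. 0) \<alpha> {0..<\<tau> m + 1} x
      \<and> (\<forall>k<n. \<mu> k \<noteq> 0 \<longrightarrow> exp (\<alpha> * \<epsilon> * \<mu> k * \<tau> m) * (norm (\<Sum>i<n. e k i *\<^sub>R u i (\<tau> m)) - \<theta> m * \<sigma>)
          \<le> norm (\<Sum>i<n. e k i *\<^sub>R x i (\<tau> m)))))"
  have "\<exists>\<kappa>>0. \<exists>\<rho>>0. \<exists>Mx>0. grows m \<kappa> \<rho> Mx" for m
    unfolding grows_def by (rule hump_growth[OF \<tau> M \<theta> L])
  then have "\<forall>m. \<exists>p. fst p > 0 \<and> fst (snd p) > 0 \<and> snd (snd p) > 0 \<and> grows m (fst p) (fst (snd p)) (snd (snd p))"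
    by (simp add: split_paired_Ex)
  from choice[OF this] obtain p where p: "\<And>m. fst (p m) > 0 \<and> fst (snd (p m)) > 0 \<and> snd (snd (p m)) > 0
      \<and> grows m (fst (p m)) (fst (snd (p m))) (snd (snd (p m)))"
    by auto
  define \<kappa> \<rho> Mx where "\<kappa> = (\<lambda>m. fst (p m))" and "\<rho> = (\<lambda>m. fst (snd (p m)))" and "Mx = (\<lambda>m. snd (snd (p m)))"
  have pos: "\<kappa> m > 0" "\<rho> m > 0" "Mx m > 0" and grow: "grows m (\<kappa> m) (\<rho> m) (Mx m)" for m
    using p[of m] unfolding \<kappa>_def \<rho>_def Mx_def by auto
  \<comment> \<open>The bound \<open>1 / real (Suc m)\<close> sends the initial spreads to 0, hence
    below the radius \<open>\<rho>\<^sub>0\<close> of the stability statement, which is not known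
    until the coupling function has been built.\<close>
  define bad where "bad = (\<lambda>m \<sigma> z u. 0 < \<sigma> \<and> \<sigma> \<le> \<rho> m \<and> \<sigma> \<le> 1 / real (Suc m)
    \<and> shadowing n A f \<Gamma> \<alpha> c r (\<tau> m) (M (\<tau> m)) (\<kappa> m) \<sigma> z u
    \<and> (\<exists>i<n. \<exists>j<n. norm (u j (\<tau> m) - u i (\<tau> m)) > exp (- \<nu> * \<tau> m) * \<sigma> / 2))"
  have bad: "\<exists>\<sigma> z u. \<sigma> \<le> s \<and> bad m \<sigma> z u" if "s > 0" for m s
  proof -
    define s' where "s' = min s (min (\<rho> m) (1 / real (Suc m)))"
    have s': "s' > 0" unfolding s'_def using that pos[of m] by simp
    have "\<not> (\<forall>\<sigma> z u. 0 < \<sigma> \<and> \<sigma> \<le> s' \<and> shadowing n A f \<Gamma> \<alpha> c r (\<tau> m) (M (\<tau> m)) (\<kappa> m) \<sigma> z u \<longrightarrow>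
      (\<forall>i<n. \<forall>j<n. norm (u j (\<tau> m) - u i (\<tau> m)) \<le> exp (- \<nu> * \<tau> m) * \<sigma> / 2))" (is "\<not> ?all")
    proof
      assume all: ?all
      show False
        by (rule notE[OF neg], rule exI[of _ "\<tau> m"], rule conjI[OF \<tau>], rule exI[of _ "\<kappa> m"],
            rule conjI[OF pos(1)], rule exI[of _ s'], rule conjI[OF s'], rule all)
    qed
    then obtain \<sigma> z u i j where "0 < \<sigma>" "\<sigma> \<le> s'" "shadowing n A f \<Gamma> \<alpha> c r (\<tau> m) (M (\<tau> m)) (\<kappa> m) \<sigma> z u"
      "i < n" "j < n" "\<not> norm (u j (\<tau> m) - u i (\<tau> m)) \<le> exp (- \<nu> * \<tau> m) * \<sigma> / 2"
      by (auto simp only: not_all not_imp)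
    then show ?thesis unfolding bad_def s'_def by (intro exI[of _ \<sigma>] exI[of _ z] exI[of _ u]) (auto simp: not_le)
  qed
  \<comment> \<open>In a pair, \<open>fst\<close> is the hump scale \<open>h m\<close> and
    \<open>snd\<close> the size \<open>\<sigma> m\<close> of a bad curve. \<open>P\<close> keeps the
    error of the humps from \<open>m\<close> on below \<open>\<kappa> m * \<sigma> m / 2\<close>,
    and \<open>Q\<close> does the same for the cubic error of the earlier, coarser ones.\<close>
  define P where "P = (\<lambda>m (s :: real \<times> real). fst s > 0 \<and> fst s \<le> \<kappa> m * snd s / 2 \<and> (\<exists>z u. bad m (snd s) z u))"
  define Q where "Q = (\<lambda>m (s :: real \<times> real) (s' :: real \<times> real). fst s' \<le> fst s
    \<and> (Mx (Suc m)) ^ 3 * (snd s')\<^sup>2 \<le> \<kappa> (Suc m) * (fst s)\<^sup>2 / 2)"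
  have ex0: "\<exists>s. P 0 s"
  proof -
    obtain \<sigma> z u where b: "bad 0 \<sigma> z u" using bad[of 1 0] by auto
    then show ?thesis unfolding P_def using pos(1)[of 0]
      by (intro exI[of _ "(\<kappa> 0 * \<sigma> / 2, \<sigma>)"]) (auto simp: bad_def)
  qed
  have exS: "\<exists>s'. P (Suc m) s' \<and> Q m s s'" if "P m s" for m s
  proof -
    have s: "fst s > 0" using that unfolding P_def by simp
    define X where "X = \<kappa> (Suc m) * (fst s)\<^sup>2 / (2 * (Mx (Suc m)) ^ 3)"
    have X: "X > 0" unfolding X_def using pos[of "Suc m"] s by simp
    have "sqrt X > 0" using X by simp
    from bad[OF this, of "Suc m"] obtain \<sigma> z u where \<sigma>: "\<sigma> \<le> sqrt X" and b: "bad (Suc m) \<sigma> z u" by blast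
    then have \<sigma>0: "\<sigma> > 0" unfolding bad_def by simp
    have "\<sigma>\<^sup>2 \<le> X" using power_mono[OF \<sigma>, of 2] \<sigma>0 X by simp
    then have "(Mx (Suc m)) ^ 3 * \<sigma>\<^sup>2 \<le> (Mx (Suc m)) ^ 3 * X"
      using pos[of "Suc m"] by (intro mult_left_mono) auto
    also have "\<dots> = \<kappa> (Suc m) * (fst s)\<^sup>2 / 2" unfolding X_def using pos[of "Suc m"] by simp
    finally show ?thesis
      unfolding P_def Q_def using b \<sigma>0 s pos(1)[of "Suc m"]
      by (intro exI[of _ "(min (fst s) (\<kappa> (Suc m) * \<sigma> / 2), \<sigma>)"]) auto
  qed
  obtain S where S: "\<And>m. P m (S m)" "\<And>m. Q m (S m) (S (Suc m))"
    using dependent_nat_choice[of P Q, OF ex0 exS] by blast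
  define h where "h = (\<lambda>m. fst (S m))"
  define \<sigma> where "\<sigma> = (\<lambda>m. snd (S m))"
  have h: "h m > 0" and h\<kappa>: "h m \<le> \<kappa> m * \<sigma> m / 2" and badS: "\<exists>z u. bad m (\<sigma> m) z u" for m
    using S(1)[of m] unfolding P_def h_def \<sigma>_def by auto
  have hdec: "h (Suc m) \<le> h m" and hQ: "(Mx (Suc m)) ^ 3 * (\<sigma> (Suc m))\<^sup>2 \<le> \<kappa> (Suc m) * (h m)\<^sup>2 / 2" for m
    using S(2)[of m] unfolding Q_def h_def \<sigma>_def by auto
  have hmono: "h k \<le> h m" if "m \<le> k" for m k
    using lift_Suc_antimono_le[of h, OF hdec that] .
  obtain G :: "real ^ 'q \<Rightarrow> real ^ 'q" where G: "\<And>w. G differentiable (at w)" "(G has_derivative (\<lambda>_. 0)) (at 0)" "G 0 = 0"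
      "\<And>x y. norm (G x - G y) \<le> 3 * norm (x - y)"
      "\<And>m w a b. (\<And>k. k \<ge> m \<Longrightarrow> h k \<le> a) \<Longrightarrow> (\<And>k. k < m \<Longrightarrow> b \<le> h k) \<Longrightarrow> a \<ge> 0 \<Longrightarrow> b > 0 \<Longrightarrow>
        norm (G w - (1/2)^m *\<^sub>R w) \<le> a + norm w ^ 3 / b\<^sup>2"
    using gliding_hump_perturbation[of h, OF h] by metis
  define H where "H = (\<lambda>w. \<Gamma> *v w - G w)"
  have Hd: "H differentiable (at w)" for w
    unfolding H_def
    by (rule differentiable_diff[OF bounded_linear_imp_differentiable[OF matrix_vector_mul_bounded_linear] G(1)])
  have "(H has_derivative (\<lambda>h. \<Gamma> *v h - 0)) (at 0)"
    unfolding H_def by (intro has_derivative_diff bounded_linear_imp_has_derivative G(2)) auto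
  then have "frechet_derivative H (at 0) = (*v) \<Gamma>"
    by (subst frechet_derivative_at[symmetric]) auto
  then have HJ: "jacobian H (at 0) = \<Gamma>" unfolding jacobian_def by simp
  have H0: "H 0 = 0" unfolding H_def using G(3) by simp
  have Hlip: "norm (H x - H y) \<le> L * norm (x - y)" for x y
  proof -
    have "H x - H y = \<Gamma> *v (x - y) - (G x - G y)"
      unfolding H_def by (simp add: matrix_vector_mult_diff_distrib)
    also have "norm \<dots> \<le> g * norm (x - y) + 3 * norm (x - y)"
      by (rule order_trans[OF norm_triangle_ineq4 add_mono[OF g(2) G(4)]])
    finally show ?thesis unfolding L_def by (simp add: algebra_simps)
  qed
  have "sync_locally_exp_stable n A f (ball c r) H (\<lambda>_ _ _. 0) \<alpha> \<nu>" by (rule pers[OF Hd HJ H0])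
  then obtain \<rho>\<^sub>0 C where \<rho>\<^sub>0: "\<rho>\<^sub>0 > 0" and C: "C > 0" and stable: "\<And>T x t i j.
      network_solution n A f H (\<lambda>_ _ _. 0) \<alpha> {0..<T} x \<Longrightarrow> \<forall>i<n. x i 0 \<in> ball c r \<Longrightarrow>
      \<forall>i<n. \<forall>j<n. norm (x j 0 - x i 0) \<le> \<rho>\<^sub>0 \<Longrightarrow> t \<in> {0..<T} \<Longrightarrow> i < n \<Longrightarrow> j < n \<Longrightarrow>
      norm (x j t - x i t) \<le> C * exp (- \<nu> * t) * spread n (\<lambda>k. x k 0)"
    by (rule sync_locally_exp_stable_from_0) (rule that)
  define \<mu>\<^sub>0 where "\<mu>\<^sub>0 = Min (insert 1 (\<mu> ` {k. k < n \<and> \<mu> k \<noteq> 0}))"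
  have \<mu>\<^sub>0: "\<mu>\<^sub>0 > 0"
    unfolding \<mu>\<^sub>0_def using eigenvalue_nonneg[OF net eb]
    by (subst Min_gr_iff) (auto simp: order.strict_iff_order)
  have \<mu>\<^sub>0_le: "\<mu>\<^sub>0 \<le> \<mu> k" if "k < n" "\<mu> k \<noteq> 0" for k
    unfolding \<mu>\<^sub>0_def using that by (intro Min_le) auto
  \<comment> \<open>\<open>N1\<close> makes the gain beat \<open>C\<close>, and \<open>N2\<close>
    brings the initial spread below \<open>\<rho>\<^sub>0\<close>. The index \<open>m\<close> is a
    successor because \<open>Q\<close> refers to the preceding scale.\<close>
  obtain N1 :: nat where N1: "8 * real n * (real n * C) / (\<alpha> * \<mu>\<^sub>0) < real N1" using reals_Archimedean2 by blast
  obtain N2 :: nat where N2: "1 / \<rho>\<^sub>0 < real N2" using reals_Archimedean2 by blast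
  define m' where "m' = N1 + N2"
  define m where "m = Suc m'"
  obtain z u where b: "bad m (\<sigma> m) z u" using badS by blast
  then have \<sigma>: "0 < \<sigma> m" "\<sigma> m \<le> \<rho> m" "\<sigma> m \<le> 1 / real (Suc m)"
    and sh: "shadowing n A f \<Gamma> \<alpha> c r (\<tau> m) (M (\<tau> m)) (\<kappa> m) (\<sigma> m) z u" unfolding bad_def by auto
  obtain i j where ij: "i < n" "j < n" and far: "norm (u j (\<tau> m) - u i (\<tau> m)) > exp (- \<nu> * \<tau> m) * \<sigma> m / 2"
    using b unfolding bad_def by blast
  have Hclose: "norm (H w - (\<Gamma> *v w - (1/2)^m *\<^sub>R w)) \<le> \<kappa> m * \<sigma> m" if w: "norm w \<le> Mx m * \<sigma> m" for w
  proof -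
    have "norm (H w - (\<Gamma> *v w - (1/2)^m *\<^sub>R w)) = norm (G w - (1/2)^m *\<^sub>R w)"
      unfolding H_def by (simp add: norm_minus_commute algebra_simps)
    also have "\<dots> \<le> h m + norm w ^ 3 / (h m')\<^sup>2"
      using hmono h less_imp_le[OF h] unfolding m_def by (intro G(5)) auto
    also have "norm w ^ 3 / (h m')\<^sup>2 \<le> (Mx m * \<sigma> m) ^ 3 / (h m')\<^sup>2"
      using w by (intro divide_right_mono power_mono) auto
    also have "(Mx m * \<sigma> m) ^ 3 / (h m')\<^sup>2 = \<sigma> m * ((Mx m) ^ 3 * (\<sigma> m)\<^sup>2 / (h m')\<^sup>2)"
      by (simp add: power_mult_distrib power3_eq_cube power2_eq_square)
    also have "\<dots> \<le> \<sigma> m * (\<kappa> m / 2)"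
      using hQ[of m'] h[of m'] \<sigma>(1) unfolding m_def[symmetric]
      by (intro mult_left_mono) (simp_all add: pos_divide_le_eq)
    finally show ?thesis using h\<kappa>[of m] by (simp add: mult_ac)
  qed
  obtain x where x0: "\<forall>i<n. x i 0 = z i 0" and sol: "network_solution n A f H (\<lambda>_ _ _. 0) \<alpha> {0..<\<tau> m + 1} x"
    and modes: "\<forall>k<n. \<mu> k \<noteq> 0 \<longrightarrow> exp (\<alpha> * (1/2)^m * \<mu> k * \<tau> m) * (norm (\<Sum>i<n. e k i *\<^sub>R u i (\<tau> m)) - \<theta> m * \<sigma> m)
        \<le> norm (\<Sum>i<n. e k i *\<^sub>R x i (\<tau> m))"
    using grow[of m, unfolded grows_def, rule_format, of "(1/2)^m" "\<sigma> m" z u H] \<sigma>(1,2) sh Hlip H0 Hclose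
    by auto
  have z0: "\<forall>i<n. x i 0 \<in> ball c r" "\<And>i j. i < n \<Longrightarrow> j < n \<Longrightarrow> norm (x j 0 - x i 0) \<le> \<sigma> m"
    using sh x0 unfolding shadowing_def by auto
  have "1 / real (Suc m) \<le> \<rho>\<^sub>0"
  proof -
    have "1 / \<rho>\<^sub>0 \<le> real (Suc m)" using N2 unfolding m_def m'_def by simp
    then show ?thesis using \<rho>\<^sub>0 by (simp add: divide_le_eq mult.commute)
  qed
  then have "\<forall>i<n. \<forall>j<n. norm (x j 0 - x i 0) \<le> \<rho>\<^sub>0" using z0(2) \<sigma>(3) by (meson order_trans)
  from stable[OF sol z0(1) this]
  have dec: "norm (x j (\<tau> m) - x i (\<tau> m)) \<le> C * exp (- \<nu> * \<tau> m) * spread n (\<lambda>k. x k 0)" if "i < n" "j < n" for i j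
    using that \<tau>[of m] by simp
  have "spread n (\<lambda>k. x k 0) \<le> \<sigma> m" using z0(2) by (intro spread_le[OF n(2)])
  then have "C * exp (- \<nu> * \<tau> m) * spread n (\<lambda>k. x k 0) \<le> C * exp (- \<nu> * \<tau> m) * \<sigma> m"
    using C by (simp add: mult_left_mono)
  with dec have dec: "norm (x j (\<tau> m) - x i (\<tau> m)) \<le> C * exp (- \<nu> * \<tau> m) * \<sigma> m" if "i < n" "j < n" for i j
    using that order_trans by blast
  obtain k where k: "k < n" "\<mu> k \<noteq> 0"
    and big: "norm (\<Sum>l<n. e k l *\<^sub>R u l (\<tau> m)) > (exp (- \<nu> * \<tau> m) * \<sigma> m / 2) / (2 * real n)"
    using dominant_mode[OF ij far] by blast
  define E where "E = exp (- \<nu> * \<tau> m) * \<sigma> m"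
  have E: "E > 0" unfolding E_def using \<sigma> by simp
  have \<epsilon>\<tau>: "(1/2)^m * \<tau> m = real (Suc m)"
    unfolding \<tau>_def by (simp add: power_one_over)
  have "exp (\<alpha> * (1/2)^m * \<mu> k * \<tau> m) = exp (\<alpha> * \<mu> k * real (Suc m))"
    unfolding \<epsilon>\<tau>[symmetric] by (simp add: mult_ac)
  also have "\<dots> \<ge> exp (\<alpha> * \<mu>\<^sub>0 * real (Suc m))"
    using \<alpha> \<mu>\<^sub>0_le[OF k] by simp
  finally have ge: "exp (\<alpha> * (1/2)^m * \<mu> k * \<tau> m) \<ge> exp (\<alpha> * \<mu>\<^sub>0 * real (Suc m))" .
  have "\<theta> m * \<sigma> m = E / (8 * real n)" unfolding \<theta>_def E_def by simp
  then have "norm (\<Sum>l<n. e k l *\<^sub>R u l (\<tau> m)) - \<theta> m * \<sigma> m \<ge> E / (8 * real n)"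
    using big unfolding E_def[symmetric] by (simp add: field_simps)
  then have "exp (\<alpha> * \<mu>\<^sub>0 * real (Suc m)) * (E / (8 * real n))
      \<le> exp (\<alpha> * (1/2)^m * \<mu> k * \<tau> m) * (norm (\<Sum>l<n. e k l *\<^sub>R u l (\<tau> m)) - \<theta> m * \<sigma> m)"
    using ge E n by (intro mult_mono) auto
  also have "\<dots> \<le> norm (\<Sum>l<n. e k l *\<^sub>R x l (\<tau> m))" using modes k by blast
  also have "\<dots> \<le> real n * (C * E)"
    by (rule mode_le_spread[OF k]) (use dec in \<open>simp add: E_def mult.assoc\<close>)
  finally have "exp (\<alpha> * \<mu>\<^sub>0 * real (Suc m)) \<le> 8 * real n * (real n * C)"
    using E n by (simp add: field_simps)
  moreover have "8 * real n * (real n * C) < \<alpha> * \<mu>\<^sub>0 * real (Suc m)"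
  proof -
    have "8 * real n * (real n * C) / (\<alpha> * \<mu>\<^sub>0) < real (Suc m)" using N1 unfolding m_def m'_def by simp
    then show ?thesis using \<alpha> \<mu>\<^sub>0 by (simp add: pos_divide_less_eq mult_ac)
  qed
  moreover have "\<alpha> * \<mu>\<^sub>0 * real (Suc m) \<le> exp (\<alpha> * \<mu>\<^sub>0 * real (Suc m))"
    using exp_ge_add_one_self[of "\<alpha> * \<mu>\<^sub>0 * real (Suc m)"] by linarith
  ultimately show False by linarith
qed

end

subsection \<open>Averaging\<close>

lemma bounded_bilinear_matrix_vector_mult:
  "bounded_bilinear (\<lambda>(B :: real ^ 'q ^ 'q) x. B *v x)"
proof
  show "\<exists>K. \<forall>(B :: real ^ 'q ^ 'q) x. norm (B *v x) \<le> norm B * norm x * K"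
    using norm_matrix_vector_le_norm
    by (intro exI[of _ "real CARD('q) * real CARD('q)"] allI) (simp add: mult_ac)
qed (simp_all add: matrix_vector_mult_add_rdistrib matrix_vector_right_distrib scaleR_matrix_vector_assoc
      matrix_vector_mult_scaleR)

lemma network_solution_subset:
  assumes "network_solution n A f H P \<alpha> I x" "J \<subseteq> I"
  shows "network_solution n A f H P \<alpha> J x"
  using assms has_vector_derivative_within_subset unfolding network_solution_def by (meson subsetD)

context coupled_network
begin

text \<open>Subtracting \<open>\<alpha> \<Sum>\<^sub>j A\<^sub>i\<^sub>j Q\<^sub>i\<^sub>j (z\<^sub>j - z\<^sub>i)\<close>, where \<open>Q\<^sub>i\<^sub>j\<close> is the small integral of \<open>R\<^sub>i\<^sub>j\<close>, cancels the
  large perturbation \<open>R\<^sub>i\<^sub>j\<close> from the derivative of \<open>z\<^sub>i\<close>.\<close>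

lemma averaged_shadowing:
  fixes z :: "nat \<Rightarrow> real \<Rightarrow> real ^ 'q" and R :: "nat \<Rightarrow> nat \<Rightarrow> real \<Rightarrow> real ^ 'q ^ 'q"
    and t\<^sub>1 \<tau> M \<sigma> \<kappa> \<kappa>\<^sub>1 q B :: real
  defines "V \<equiv> \<Lambda> * M + 2 * (\<alpha> * (real n * (B * M)))"
  assumes sol: "network_solution n A f H R \<alpha> {t\<^sub>1..t\<^sub>1 + \<tau>} z"
    and \<tau>: "\<tau> > 0" and \<sigma>: "\<sigma> \<ge> 0" and M: "M \<ge> 0" and B: "B \<ge> 0" and \<kappa>\<^sub>1: "\<kappa>\<^sub>1 \<ge> 0"
    and R: "\<And>i j. i < n \<Longrightarrow> j < n \<Longrightarrow> continuous_on UNIV (R i j)"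
    and init: "\<And>i. i < n \<Longrightarrow> z i t\<^sub>1 \<in> ball c r" "\<And>i j. i < n \<Longrightarrow> j < n \<Longrightarrow> norm (z j t\<^sub>1 - z i t\<^sub>1) \<le> \<sigma>"
    and zt: "\<And>i t. i < n \<Longrightarrow> t \<in> {t\<^sub>1..t\<^sub>1 + \<tau>} \<Longrightarrow> z i t \<in> cball c r"
      "\<And>i j t. i < n \<Longrightarrow> j < n \<Longrightarrow> t \<in> {t\<^sub>1..t\<^sub>1 + \<tau>} \<Longrightarrow> norm (z j t - z i t) \<le> M * \<sigma>"
    and H: "\<And>w. norm w \<le> M * \<sigma> \<Longrightarrow> norm (H w - \<Gamma> *v w) \<le> \<kappa>\<^sub>1 * norm w"
    and cpl: "\<And>i j t w. i < n \<Longrightarrow> j < n \<Longrightarrow> t \<in> {t\<^sub>1..t\<^sub>1 + \<tau>} \<Longrightarrow> norm w \<le> M * \<sigma> \<Longrightarrow>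
      norm (H w + R i j t *v w) \<le> B * norm w"
    and Q: "\<And>i j t w. i < n \<Longrightarrow> j < n \<Longrightarrow> t \<in> {t\<^sub>1..t\<^sub>1 + \<tau>} \<Longrightarrow> norm (integral {t\<^sub>1..t} (R i j) *v w) \<le> q * norm w"
    and q: "q \<ge> 0" "\<alpha> * (real n * (q * M)) \<le> \<kappa>" "\<alpha> * (real n * (\<kappa>\<^sub>1 * M)) + \<alpha> * (real n * (q * V)) \<le> \<kappa>"
  obtains u where "shadowing n A f \<Gamma> \<alpha> c r \<tau> M \<kappa> \<sigma> (\<lambda>i s. z i (t\<^sub>1 + s)) u"
    "\<And>i s. i < n \<Longrightarrow> s \<in> {0..\<tau>} \<Longrightarrow> norm (u i s - z i (t\<^sub>1 + s)) \<le> \<kappa> * \<sigma>"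
proof -
  define I where "I = {t\<^sub>1..t\<^sub>1 + \<tau>}"
  define Qi where "Qi = (\<lambda>i j t. integral {t\<^sub>1..t} (R i j))"
  define v where "v = (\<lambda>i t. f (z i t) + \<alpha> *\<^sub>R (\<Sum>j<n. A $$ (i, j) *\<^sub>R (H (z j t - z i t) + R i j t *v (z j t - z i t))))"
  define y where "y = (\<lambda>i t. z i t - \<alpha> *\<^sub>R (\<Sum>j<n. A $$ (i, j) *\<^sub>R (Qi i j t *v (z j t - z i t))))"
  define y' where "y' = (\<lambda>i t. v i t - \<alpha> *\<^sub>R (\<Sum>j<n. A $$ (i, j) *\<^sub>R
    (Qi i j t *v (v j t - v i t) + R i j t *v (z j t - z i t))))"
  have zd: "(z i has_vector_derivative v i t) (at t within I)" if "i < n" "t \<in> I" for i t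
    using sol that unfolding network_solution_def v_def I_def coupling_def by blast
  have yd: "(y i has_vector_derivative y' i t) (at t within I)" if i: "i < n" and t: "t \<in> I" for i t
    unfolding y_def y'_def
  proof (intro has_vector_derivative_diff zd[OF i t] has_vector_derivative_sum
      bounded_linear.has_vector_derivative[OF bounded_linear_scaleR_right])
    fix j assume "j \<in> {..<n}"
    then have j: "j < n" by simp
    have "(Qi i j has_vector_derivative R i j t) (at t within I)"
      unfolding Qi_def I_def using R[OF i j] t I_def
      by (intro integral_has_vector_derivative) (auto elim: continuous_on_subset)
    from bounded_bilinear.has_vector_derivative[OF bounded_bilinear_matrix_vector_mult this
        has_vector_derivative_diff[OF zd[OF j t] zd[OF i t]]]
    show "((\<lambda>t. Qi i j t *v (z j t - z i t)) has_vector_derivative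
        Qi i j t *v (v j t - v i t) + R i j t *v (z j t - z i t)) (at t within I)" .
  qed
  have M\<sigma>: "M * \<sigma> \<ge> 0" using M \<sigma> by simp
  have dz: "norm (z j t - z i t) \<le> M * \<sigma>" if "i < n" "j < n" "t \<in> I" for i j t
    using zt(2) that unfolding I_def by blast
  have vdiff: "norm (v j t - v i t) \<le> V * \<sigma>" if i: "i < n" and j: "j < n" and t: "t \<in> I" for i j t
  proof -
    have s: "norm (\<alpha> *\<^sub>R (\<Sum>j<n. A $$ (i, j) *\<^sub>R (H (z j t - z i t) + R i j t *v (z j t - z i t))))
        \<le> \<alpha> * (real n * (B * (M * \<sigma>)))" if i: "i < n" for i
    proof -
      have "norm (\<Sum>j<n. A $$ (i, j) *\<^sub>R (H (z j t - z i t) + R i j t *v (z j t - z i t))) \<le> real n * (B * (M * \<sigma>))"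
      proof (rule norm_adjacency_sum_le[OF i])
        fix j assume j: "j < n"
        show "norm (H (z j t - z i t) + R i j t *v (z j t - z i t)) \<le> B * (M * \<sigma>)"
          using cpl[OF i j t[unfolded I_def] dz[OF i j t]] mult_left_mono[OF dz[OF i j t] B] by linarith
      qed
      then show ?thesis using \<alpha> by simp
    qed
    have "norm (f (z j t) - f (z i t)) \<le> \<Lambda> * norm (z j t - z i t)"
      using zt(1) i j t unfolding I_def by (intro f_lipschitz) auto
    also have "\<dots> \<le> \<Lambda> * (M * \<sigma>)" using dz[OF i j t] \<Lambda> by (intro mult_left_mono) auto
    finally have "norm (f (z j t) - f (z i t)) \<le> \<Lambda> * (M * \<sigma>)" .
    then have "norm (v j t - v i t) \<le> \<Lambda> * (M * \<sigma>) + (\<alpha> * (real n * (B * (M * \<sigma>))) + \<alpha> * (real n * (B * (M * \<sigma>))))"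
      unfolding v_def add_diff_add
      by (intro norm_triangle_mono order_trans[OF norm_triangle_ineq4 add_mono[OF s[OF j] s[OF i]]])
    then show ?thesis unfolding V_def by (simp add: algebra_simps)
  qed
  have defect: "norm (y' i t - (f (z i t) + \<alpha> *\<^sub>R (\<Sum>j<n. A $$ (i, j) *\<^sub>R (\<Gamma> *v (z j t - z i t))))) \<le> \<kappa> * \<sigma>"
    if i: "i < n" and t: "t \<in> I" for i t
  proof -
    define Ha where "Ha = (\<Sum>j<n. A $$ (i, j) *\<^sub>R H (z j t - z i t))"
    define Ra where "Ra = (\<Sum>j<n. A $$ (i, j) *\<^sub>R (R i j t *v (z j t - z i t)))"
    define Ga where "Ga = (\<Sum>j<n. A $$ (i, j) *\<^sub>R (\<Gamma> *v (z j t - z i t)))"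
    define Qa where "Qa = (\<Sum>j<n. A $$ (i, j) *\<^sub>R (Qi i j t *v (v j t - v i t)))"
    have "v i t = f (z i t) + \<alpha> *\<^sub>R (Ha + Ra)"
      unfolding v_def Ha_def Ra_def by (simp add: scaleR_add_right sum.distrib)
    moreover have "y' i t = v i t - \<alpha> *\<^sub>R (Qa + Ra)"
      unfolding y'_def Qa_def Ra_def by (simp add: scaleR_add_right sum.distrib)
    \<comment> \<open>The large term \<open>Ra\<close> has cancelled. What remains is the
      nonlinearity of \<open>H\<close> and the small integrals applied to velocity differences,
      which are themselves of order \<sigma>.\<close>
    ultimately have "y' i t - (f (z i t) + \<alpha> *\<^sub>R Ga) = \<alpha> *\<^sub>R (Ha - Ga) - \<alpha> *\<^sub>R Qa"
      by (simp add: algebra_simps)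
    also have "norm \<dots> \<le> \<alpha> * (real n * (\<kappa>\<^sub>1 * (M * \<sigma>))) + \<alpha> * (real n * (q * (V * \<sigma>)))"
    proof (rule order_trans[OF norm_triangle_ineq4 add_mono])
      have "norm (\<Sum>j<n. A $$ (i, j) *\<^sub>R (H (z j t - z i t) - \<Gamma> *v (z j t - z i t))) \<le> real n * (\<kappa>\<^sub>1 * (M * \<sigma>))"
      proof (rule norm_adjacency_sum_le[OF i])
        fix j assume j: "j < n"
        show "norm (H (z j t - z i t) - \<Gamma> *v (z j t - z i t)) \<le> \<kappa>\<^sub>1 * (M * \<sigma>)"
          using H[OF dz[OF i j t]] mult_left_mono[OF dz[OF i j t] \<kappa>\<^sub>1] by linarith
      qed
      then have "norm (Ha - Ga) \<le> real n * (\<kappa>\<^sub>1 * (M * \<sigma>))"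
        unfolding Ha_def Ga_def by (simp add: scaleR_diff_right sum_subtractf)
      then show "norm (\<alpha> *\<^sub>R (Ha - Ga)) \<le> \<alpha> * (real n * (\<kappa>\<^sub>1 * (M * \<sigma>)))" using \<alpha> by simp
      have "norm Qa \<le> real n * (q * (V * \<sigma>))"
        unfolding Qa_def
      proof (rule norm_adjacency_sum_le[OF i])
        fix j assume j: "j < n"
        show "norm (Qi i j t *v (v j t - v i t)) \<le> q * (V * \<sigma>)"
          unfolding Qi_def using Q[OF i j t[unfolded I_def], of "v j t - v i t"] mult_left_mono[OF vdiff[OF i j t] q(1)]
          by linarith
      qed
      then show "norm (\<alpha> *\<^sub>R Qa) \<le> \<alpha> * (real n * (q * (V * \<sigma>)))" using \<alpha> by simp
    qed
    also have "\<dots> = (\<alpha> * (real n * (\<kappa>\<^sub>1 * M)) + \<alpha> * (real n * (q * V))) * \<sigma>" by (simp add: algebra_simps)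
    also have "\<dots> \<le> \<kappa> * \<sigma>" by (rule mult_right_mono[OF q(3) \<sigma>])
    finally show ?thesis unfolding Ga_def .
  qed
  have close: "norm (y i t - z i t) \<le> \<kappa> * \<sigma>" if i: "i < n" and t: "t \<in> I" for i t
  proof -
    have "norm (\<Sum>j<n. A $$ (i, j) *\<^sub>R (Qi i j t *v (z j t - z i t))) \<le> real n * (q * (M * \<sigma>))"
    proof (rule norm_adjacency_sum_le[OF i])
      fix j assume j: "j < n"
      show "norm (Qi i j t *v (z j t - z i t)) \<le> q * (M * \<sigma>)"
        unfolding Qi_def using Q[OF i j t[unfolded I_def], of "z j t - z i t"] mult_left_mono[OF dz[OF i j t] q(1)]
        by linarith
    qed
    then have "norm (y i t - z i t) \<le> \<alpha> * (real n * (q * (M * \<sigma>)))"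
      unfolding y_def using \<alpha> by simp
    also have "\<dots> = (\<alpha> * (real n * (q * M))) * \<sigma>" by simp
    also have "\<dots> \<le> \<kappa> * \<sigma>" by (rule mult_right_mono[OF q(2) \<sigma>])
    finally show ?thesis .
  qed
  have shift: "t\<^sub>1 + s \<in> I" if "s \<in> {0..\<tau>}" for s using that unfolding I_def by simp
  have ysd: "((\<lambda>s. y i (t\<^sub>1 + s)) has_vector_derivative y' i (t\<^sub>1 + s)) (at s within {0..\<tau>})"
    if "i < n" "s \<in> {0..\<tau>}" for i s
  proof -
    have "((+) t\<^sub>1 has_vector_derivative 1) (at s within {0..\<tau>})"
      by (auto intro!: derivative_eq_intros)
    moreover have "(+) t\<^sub>1 ` {0..\<tau>} = I" unfolding I_def by simp
    ultimately have "((y i \<circ> (+) t\<^sub>1) has_vector_derivative 1 *\<^sub>R y' i (t\<^sub>1 + s)) (at s within {0..\<tau>})"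
      using yd[OF that(1) shift[OF that(2)]] by (intro vector_diff_chain_within) auto
    then show ?thesis by (simp add: o_def)
  qed
  \<comment> \<open>The integrals start at \<open>t\<^sub>1\<close>, so the correction vanishes
    there and the initial values agree, as \<open>shadowing\<close> demands.\<close>
  have "y i t\<^sub>1 = z i t\<^sub>1" for i unfolding y_def Qi_def by simp
  then have "shadowing n A f \<Gamma> \<alpha> c r \<tau> M \<kappa> \<sigma> (\<lambda>i s. z i (t\<^sub>1 + s)) (\<lambda>i s. y i (t\<^sub>1 + s))"
    unfolding shadowing_def
    using init zt(1)[OF _ shift[unfolded I_def]] dz[OF _ _ shift] close[OF _ shift] ysd defect[OF _ shift]
    by (intro conjI allI impI ballI exI[of _ "\<lambda>i s. y' i (t\<^sub>1 + s)"]) simp_all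
  then show thesis using close[OF _ shift] by (rule that)
qed

end

section \<open>Iteration over successive periods\<close>

lemma shadowing_mono:
  assumes "shadowing n A f \<Gamma> \<alpha> c r \<tau> M \<kappa>' \<sigma> z u" "\<kappa>' \<le> \<kappa>" "\<sigma> \<ge> 0"
  shows "shadowing n A f \<Gamma> \<alpha> c r \<tau> M \<kappa> \<sigma> z u"
proof -
  have le: "a \<le> \<kappa> * \<sigma>" if "a \<le> \<kappa>' * \<sigma>" for a
    using that mult_right_mono[OF assms(2,3)] by linarith
  from assms(1) obtain v where v: "\<forall>i<n. \<forall>t\<in>{0..\<tau>}. (u i has_vector_derivative v i t) (at t within {0..\<tau>})
        \<and> norm (v i t - (f (z i t) + \<alpha> *\<^sub>R (\<Sum>j<n. A $$ (i, j) *\<^sub>R (\<Gamma> *v (z j t - z i t))))) \<le> \<kappa>' * \<sigma>"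
    unfolding shadowing_def by blast
  show ?thesis
    using assms(1) v le unfolding shadowing_def by (intro conjI exI[of _ v]) auto
qed

text \<open>\<sigma> is any positive bound of the spread rather than the spread itself, so that the
  contracted bound can be handed on to the next period; staying in \<open>U\<close> is included for
  the same purpose. The last clause concerns periods that fit into the interval of
  existence.\<close>

definition contracting_step ::
    "nat \<Rightarrow> real mat \<Rightarrow> (real ^ 'q \<Rightarrow> real ^ 'q) \<Rightarrow> (real ^ 'q) set \<Rightarrow> (real ^ 'q \<Rightarrow> real ^ 'q) \<Rightarrow>
     (nat \<Rightarrow> nat \<Rightarrow> real \<Rightarrow> real ^ 'q ^ 'q) \<Rightarrow> real \<Rightarrow> real \<Rightarrow> real \<Rightarrow> real \<Rightarrow> real \<Rightarrow> bool" where
  "contracting_step n A f U H R \<alpha> \<nu> \<tau> M \<rho> \<longleftrightarrow>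
    (\<forall>t\<^sub>1\<ge>0. \<forall>T z \<sigma>. 0 < \<sigma> \<and> \<sigma> \<le> \<rho> \<and> network_solution n A f H R \<alpha> {t\<^sub>1..<T} z
      \<and> (\<forall>i<n. z i t\<^sub>1 \<in> U) \<and> (\<forall>i<n. \<forall>j<n. norm (z j t\<^sub>1 - z i t\<^sub>1) \<le> \<sigma>) \<longrightarrow>
      (\<forall>t\<in>{t\<^sub>1..<T}. t \<le> t\<^sub>1 + \<tau> \<longrightarrow> (\<forall>i<n. z i t \<in> U \<and> (\<forall>j<n. norm (z j t - z i t) \<le> M * \<sigma>)))
      \<and> (t\<^sub>1 + \<tau> < T \<longrightarrow> (\<forall>i<n. \<forall>j<n. norm (z j (t\<^sub>1 + \<tau>) - z i (t\<^sub>1 + \<tau>)) \<le> exp (- \<nu> * \<tau>) * \<sigma>)))"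

lemma contracting_stepD:
  assumes "contracting_step n A f U H R \<alpha> \<nu> \<tau> M \<rho>" and "t\<^sub>1 \<ge> 0" "0 < \<sigma>" "\<sigma> \<le> \<rho>"
    and "network_solution n A f H R \<alpha> {t\<^sub>1..<T} z" "\<And>i. i < n \<Longrightarrow> z i t\<^sub>1 \<in> U"
      "\<And>i j. i < n \<Longrightarrow> j < n \<Longrightarrow> norm (z j t\<^sub>1 - z i t\<^sub>1) \<le> \<sigma>"
  shows "\<And>i t. i < n \<Longrightarrow> t \<in> {t\<^sub>1..<T} \<Longrightarrow> t \<le> t\<^sub>1 + \<tau> \<Longrightarrow> z i t \<in> U"
    and "\<And>i j t. i < n \<Longrightarrow> j < n \<Longrightarrow> t \<in> {t\<^sub>1..<T} \<Longrightarrow> t \<le> t\<^sub>1 + \<tau> \<Longrightarrow> norm (z j t - z i t) \<le> M * \<sigma>"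
    and "\<And>i j. i < n \<Longrightarrow> j < n \<Longrightarrow> t\<^sub>1 + \<tau> < T \<Longrightarrow> norm (z j (t\<^sub>1 + \<tau>) - z i (t\<^sub>1 + \<tau>)) \<le> exp (- \<nu> * \<tau>) * \<sigma>"
proof -
  have "0 < \<sigma> \<and> \<sigma> \<le> \<rho> \<and> network_solution n A f H R \<alpha> {t\<^sub>1..<T} z
      \<and> (\<forall>i<n. z i t\<^sub>1 \<in> U) \<and> (\<forall>i<n. \<forall>j<n. norm (z j t\<^sub>1 - z i t\<^sub>1) \<le> \<sigma>)"
    using assms(3-) by simp
  with assms(1)[unfolded contracting_step_def, THEN spec, THEN mp, OF assms(2), THEN spec, THEN spec, THEN spec]
  have *: "(\<forall>t\<in>{t\<^sub>1..<T}. t \<le> t\<^sub>1 + \<tau> \<longrightarrow> (\<forall>i<n. z i t \<in> U \<and> (\<forall>j<n. norm (z j t - z i t) \<le> M * \<sigma>)))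
      \<and> (t\<^sub>1 + \<tau> < T \<longrightarrow> (\<forall>i<n. \<forall>j<n. norm (z j (t\<^sub>1 + \<tau>) - z i (t\<^sub>1 + \<tau>)) \<le> exp (- \<nu> * \<tau>) * \<sigma>))"
    by (rule mp)
  show "\<And>i t. i < n \<Longrightarrow> t \<in> {t\<^sub>1..<T} \<Longrightarrow> t \<le> t\<^sub>1 + \<tau> \<Longrightarrow> z i t \<in> U"
    and "\<And>i j t. i < n \<Longrightarrow> j < n \<Longrightarrow> t \<in> {t\<^sub>1..<T} \<Longrightarrow> t \<le> t\<^sub>1 + \<tau> \<Longrightarrow> norm (z j t - z i t) \<le> M * \<sigma>"
    and "\<And>i j. i < n \<Longrightarrow> j < n \<Longrightarrow> t\<^sub>1 + \<tau> < T \<Longrightarrow> norm (z j (t\<^sub>1 + \<tau>) - z i (t\<^sub>1 + \<tau>)) \<le> exp (- \<nu> * \<tau>) * \<sigma>"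
    using * by blast+
qed

text \<open>Each whole period contributes the factor \<open>exp (- \<nu> * \<tau>)\<close> with no
  constant in front, so nothing accumulates. The unfinished period costs \<open>M\<close>, and
  \<open>exp (\<nu> * \<tau>)\<close> makes up for the time it has lasted.\<close>

lemma contracting_step_imp_stable:
  assumes step: "contracting_step n A f U H R \<alpha> \<nu> \<tau> M \<rho>"
    and \<nu>: "\<nu> > 0" and \<tau>: "\<tau> > 0" and M: "M > 0" and \<rho>: "\<rho> > 0" and n: "n > 0"
  shows "sync_locally_exp_stable n A f U H R \<alpha> \<nu>"
proof -
  define C where "C = M * exp (\<nu> * \<tau>)"
  have C: "C > 0" unfolding C_def using M by simp
  have main: "norm (x j t - x i t) \<le> C * exp (- \<nu> * (t - t\<^sub>0)) * spread n (\<lambda>k. x k t\<^sub>0)"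
    if t0: "t\<^sub>0 \<ge> 0" and sol: "network_solution n A f H R \<alpha> {t\<^sub>0..<T} x"
      and U: "\<forall>i<n. x i t\<^sub>0 \<in> U" and small: "\<forall>i<n. \<forall>j<n. norm (x j t\<^sub>0 - x i t\<^sub>0) \<le> \<rho>"
      and t: "t \<in> {t\<^sub>0..<T}" and ij: "i < n" "j < n" for t\<^sub>0 T x t i j
  proof -
    have est: "norm (x j t - x i t) \<le> C * exp (- \<nu> * (t - t\<^sub>0)) * \<sigma>"
      if \<sigma>: "0 < \<sigma>" "\<sigma> \<le> \<rho>" "spread n (\<lambda>k. x k t\<^sub>0) \<le> \<sigma>" for \<sigma>
    proof -
      have decay: "t\<^sub>0 + real k * \<tau> < T \<Longrightarrow> (\<forall>i<n. x i (t\<^sub>0 + real k * \<tau>) \<in> U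
          \<and> (\<forall>j<n. norm (x j (t\<^sub>0 + real k * \<tau>) - x i (t\<^sub>0 + real k * \<tau>)) \<le> exp (- \<nu> * (real k * \<tau>)) * \<sigma>))" for k
      proof (induction k)
        case 0
        have "norm (x j t\<^sub>0 - x i t\<^sub>0) \<le> \<sigma>" if "i < n" "j < n" for i j
          using le_spread[OF that, of "\<lambda>k. x k t\<^sub>0"] \<sigma>(3) by linarith
        then show ?case using U by simp
      next
        case (Suc k)
        define t\<^sub>1 where "t\<^sub>1 = t\<^sub>0 + real k * \<tau>"
        have t1: "t\<^sub>1 \<ge> t\<^sub>0" "t\<^sub>1 + \<tau> = t\<^sub>0 + real (Suc k) * \<tau>"
          unfolding t\<^sub>1_def using \<tau> by (simp_all add: algebra_simps)
        have "t\<^sub>1 < T" using Suc.prems \<tau> t1(2) by linarith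
        note IH = Suc.IH[folded t\<^sub>1_def, OF this]
        define \<sigma>' where "\<sigma>' = exp (- \<nu> * (real k * \<tau>)) * \<sigma>"
        have "exp (- \<nu> * (real k * \<tau>)) \<le> 1" using \<nu> \<tau> by simp
        then have "\<sigma>' \<le> 1 * \<sigma>" unfolding \<sigma>'_def using \<sigma>(1) by (intro mult_right_mono) auto
        then have "\<sigma>' \<le> \<rho>" using \<sigma>(2) by linarith
        moreover have "0 < \<sigma>'" unfolding \<sigma>'_def using \<sigma>(1) by simp
        ultimately have \<sigma>': "0 < \<sigma>'" "\<sigma>' \<le> \<rho>" by blast+
        have sol1: "network_solution n A f H R \<alpha> {t\<^sub>1..<T} x"
          by (rule network_solution_subset[OF sol]) (use t1 in auto)
        have t10: "t\<^sub>1 \<ge> 0" using t1 t0 by linarith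
        have T1: "t\<^sub>1 + \<tau> < T" using Suc.prems t1(2) by simp
        have I1: "\<And>i. i < n \<Longrightarrow> x i t\<^sub>1 \<in> U" "\<And>i j. i < n \<Longrightarrow> j < n \<Longrightarrow> norm (x j t\<^sub>1 - x i t\<^sub>1) \<le> \<sigma>'"
          using IH unfolding \<sigma>'_def by auto
        note step' = contracting_stepD[OF step t10 \<sigma>' sol1 I1]
        have "exp (- \<nu> * \<tau>) * \<sigma>' = exp (- \<nu> * (real (Suc k) * \<tau>)) * \<sigma>"
          unfolding \<sigma>'_def by (simp add: algebra_simps flip: exp_add)
        then show ?case
          using step'(1)[of _ "t\<^sub>1 + \<tau>"] step'(3) T1 \<tau> unfolding t1(2)[symmetric] by auto
      qed
      define k where "k = nat \<lfloor>(t - t\<^sub>0) / \<tau>\<rfloor>"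
      define t\<^sub>1 where "t\<^sub>1 = t\<^sub>0 + real k * \<tau>"
      have "0 \<le> (t - t\<^sub>0) / \<tau>" using t \<tau> by simp
      then have "real k \<le> (t - t\<^sub>0) / \<tau>" "(t - t\<^sub>0) / \<tau> < real k + 1"
        unfolding k_def by linarith+
      then have k: "real k * \<tau> \<le> t - t\<^sub>0" "t - t\<^sub>0 < real k * \<tau> + \<tau>"
        using \<tau> by (simp_all add: field_simps)
      then have t1: "t\<^sub>0 \<le> t\<^sub>1" "t\<^sub>1 \<le> t" "t \<le> t\<^sub>1 + \<tau>" "t\<^sub>1 < T"
        unfolding t\<^sub>1_def using t \<tau> by auto
      define \<sigma>' where "\<sigma>' = exp (- \<nu> * (real k * \<tau>)) * \<sigma>"
      have "exp (- \<nu> * (real k * \<tau>)) \<le> 1" using \<nu> \<tau> by simp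
      then have "\<sigma>' \<le> 1 * \<sigma>" unfolding \<sigma>'_def using \<sigma>(1) by (intro mult_right_mono) auto
      then have "\<sigma>' \<le> \<rho>" using \<sigma>(2) by linarith
        moreover have "0 < \<sigma>'" unfolding \<sigma>'_def using \<sigma>(1) by simp
        ultimately have \<sigma>': "0 < \<sigma>'" "\<sigma>' \<le> \<rho>" by blast+
      have sol1: "network_solution n A f H R \<alpha> {t\<^sub>1..<T} x"
        by (rule network_solution_subset[OF sol]) (use t1 in auto)
      have t10: "t\<^sub>1 \<ge> 0" using t1 t0 by linarith
      have I1: "\<And>i. i < n \<Longrightarrow> x i t\<^sub>1 \<in> U" "\<And>i j. i < n \<Longrightarrow> j < n \<Longrightarrow> norm (x j t\<^sub>1 - x i t\<^sub>1) \<le> \<sigma>'"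
        using decay[of k] t1(4) unfolding \<sigma>'_def t\<^sub>1_def by auto
      have "norm (x j t - x i t) \<le> M * \<sigma>'"
        using contracting_stepD(2)[OF step t10 \<sigma>' sol1 I1 ij] t1 t by simp
      also have "\<dots> \<le> M * (exp (\<nu> * \<tau>) * exp (- \<nu> * (t - t\<^sub>0)) * \<sigma>)"
      proof -
        have "- \<nu> * (real k * \<tau>) \<le> \<nu> * \<tau> + - \<nu> * (t - t\<^sub>0)"
          using mult_left_mono[OF less_imp_le[OF k(2)], of \<nu>] \<nu> by (simp add: algebra_simps)
        then have "exp (- \<nu> * (real k * \<tau>)) \<le> exp (\<nu> * \<tau>) * exp (- \<nu> * (t - t\<^sub>0))"
          by (simp flip: exp_add)
        then show ?thesis unfolding \<sigma>'_def using M \<sigma>(1) by (intro mult_left_mono mult_right_mono) auto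
      qed
      finally show ?thesis unfolding C_def by (simp add: mult_ac)
    qed
    define s where "s = spread n (\<lambda>k. x k t\<^sub>0)"
    define K where "K = C * exp (- \<nu> * (t - t\<^sub>0))"
    have K: "K > 0" unfolding K_def using C by simp
    have s: "s \<le> \<rho>" unfolding s_def using small by (intro spread_le[OF n]) auto
    have s0: "s \<ge> 0" unfolding s_def using le_spread[OF ij(1) ij(1), of "\<lambda>k. x k t\<^sub>0"] by simp
    have "norm (x j t - x i t) \<le> K * s"
    proof (cases "s = 0")
      case False
      then show ?thesis using est[of s] s s0 unfolding s_def[symmetric] K_def by simp
    next
      case True
      \<comment> \<open>A contracting step needs a positive bound; for spread 0 the estimate is the
        limit of those with small positive bounds.\<close>
      have "norm (x j t - x i t) \<le> 0 + \<epsilon>" if "\<epsilon> > 0" for \<epsilon>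
      proof -
        have "norm (x j t - x i t) \<le> K * min \<rho> (\<epsilon> / K)"
          unfolding K_def by (rule est[folded s_def]) (use \<rho> K that True in \<open>auto simp: K_def\<close>)
        also have "\<dots> \<le> K * (\<epsilon> / K)" using K by (intro mult_left_mono) auto
        finally show ?thesis using K by simp
      qed
      then show ?thesis using True field_le_epsilon[of "norm (x j t - x i t)" 0] by simp
    qed
    then show ?thesis unfolding s_def K_def .
  qed
  show ?thesis
    unfolding sync_locally_exp_stable_def
    by (intro conjI \<nu> exI[of _ \<rho>] \<rho> exI[of _ C] C allI impI ballI) (elim conjE, rule main, assumption+)
qed

context coupled_network
begin

text \<open>The thresholds serve every starting time \<open>t\<^sub>1\<close>, because fast
  oscillation, the bound \<open>p\<close> and the constants of the ball are uniform in time. This is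
  what permits iteration.\<close>

lemma fast_oscillation_contracting_step:
  fixes H :: "real ^ 'q \<Rightarrow> real ^ 'q" and P :: "nat \<Rightarrow> nat \<Rightarrow> real \<Rightarrow> real ^ 'q ^ 'q" and p \<nu> :: real
  assumes pers: "\<And>H. (\<And>x. H differentiable (at x)) \<Longrightarrow> jacobian H (at 0) = \<Gamma> \<Longrightarrow> H 0 = 0 \<Longrightarrow>
      sync_locally_exp_stable n A f (ball c r) H (\<lambda>_ _ _. 0) \<alpha> \<nu>"
    and Hd: "\<And>\<kappa>. \<kappa> > 0 \<Longrightarrow> \<exists>d>0. \<forall>w. norm w \<le> d \<longrightarrow> norm (H w - \<Gamma> *v w) \<le> \<kappa> * norm w"
    and Pc: "\<And>i j. i < n \<Longrightarrow> j < n \<Longrightarrow> continuous_on UNIV (P i j)"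
    and Pb: "\<And>i j t w. i < n \<Longrightarrow> j < n \<Longrightarrow> t \<ge> 0 \<Longrightarrow> norm (P i j t *v w) \<le> p * norm w" and p: "p \<ge> 0"
    and osc: "\<And>i j. i < n \<Longrightarrow> j < n \<Longrightarrow> oscillates_fast (P i j)"
  obtains \<tau> M \<omega>\<^sub>0 \<rho> where "\<tau> > 0" "M > 0" "\<rho> > 0"
    "\<And>\<omega> :: nat \<Rightarrow> nat \<Rightarrow> real. \<forall>i<n. \<forall>j<n. \<omega> i j > \<omega>\<^sub>0 \<Longrightarrow>
      contracting_step n A f (ball c r) H (\<lambda>i j t. P i j (\<omega> i j * t)) \<alpha> \<nu> \<tau> M \<rho>"
proof -
  have n: "real n > 0" using n_ge_2 by simp
  \<comment> \<open>\<open>g + 1\<close> bounds \<open>H\<close> near 0 (the 1 because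
    \<open>\<kappa>\<^sub>1 \<le> 1\<close>), and \<open>p\<close> bounds the perturbation, which
    enters without any smallness.\<close>
  define B where "B = g + 1 + p"
  have B: "B \<ge> 0" unfolding B_def using g p by simp
  define Mf where "Mf = (\<lambda>\<tau>. real (n * n) * exp (real (n * n) * (\<Lambda> + 2 * \<alpha> * B) * (\<tau> + 1)))"
  have Mf: "Mf \<tau> \<ge> 0" for \<tau> unfolding Mf_def by simp
  have "\<exists>\<tau>>0. \<exists>\<kappa>>0. \<exists>\<rho>>0. \<forall>\<sigma> z u. 0 < \<sigma> \<and> \<sigma> \<le> \<rho>
      \<and> shadowing n A f \<Gamma> \<alpha> c r \<tau> (Mf \<tau>) \<kappa> \<sigma> z u \<longrightarrow>
    (\<forall>i<n. \<forall>j<n. norm (u j \<tau> - u i \<tau>) \<le> exp (- \<nu> * \<tau>) * \<sigma> / 2)"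
    by (rule strict_contraction[where M = Mf, OF _ Mf], rule pers)
  then obtain \<tau> \<kappa> \<rho>\<^sub>s where \<tau>: "\<tau> > 0" and \<kappa>: "\<kappa> > 0"
    and \<rho>\<^sub>s: "\<rho>\<^sub>s > 0"
    and contr: "\<forall>\<sigma> z u. 0 < \<sigma> \<and> \<sigma> \<le> \<rho>\<^sub>s \<and> shadowing n A f \<Gamma> \<alpha> c r \<tau> (Mf \<tau>) \<kappa> \<sigma> z u \<longrightarrow>
      (\<forall>i<n. \<forall>j<n. norm (u j \<tau> - u i \<tau>) \<le> exp (- \<nu> * \<tau>) * \<sigma> / 2)"
    by (elim exE conjE) (rule that)
  define M where "M = Mf \<tau>"
  have M: "M > 0" unfolding M_def Mf_def using n by simp
  \<comment> \<open>The corrections at the two nodes may each use a quarter of the target, beside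
    the half that the strict contraction consumes.\<close>
  define \<kappa>' where "\<kappa>' = min \<kappa> (exp (- \<nu> * \<tau>) / 4)"
  have \<kappa>': "\<kappa>' > 0" "\<kappa>' \<le> \<kappa>" "\<kappa>' \<le> exp (- \<nu> * \<tau>) / 4" unfolding \<kappa>'_def using \<kappa> by auto
  define V where "V = \<Lambda> * M + 2 * (\<alpha> * (real n * (B * M)))"
  have V: "V \<ge> 0" unfolding V_def using \<Lambda> M \<alpha> B by simp
  \<comment> \<open>Splits \<open>\<kappa>'\<close> evenly between the nonlinearity of
    \<open>H\<close> and the averaging error; the added 1 keeps the denominator positive.\<close>
  have frac: "\<kappa>' / (2 * (a + 1)) * b \<le> \<kappa>' / 2" if "0 \<le> b" "b \<le> a" for a b :: real
  proof -
    have "\<kappa>' / (2 * (a + 1)) * b \<le> \<kappa>' / (2 * (a + 1)) * (a + 1)"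
      using that \<kappa>' by (intro mult_left_mono) auto
    also have "\<dots> = \<kappa>' / 2" using that by (simp add: field_simps)
    finally show ?thesis .
  qed
  define \<kappa>\<^sub>1 where "\<kappa>\<^sub>1 = min 1 (\<kappa>' / (2 * (\<alpha> * (real n * M) + 1)))"
  have \<alpha>nM: "\<alpha> * (real n * M) \<ge> 0" using \<alpha> M by simp
  have \<kappa>\<^sub>1: "\<kappa>\<^sub>1 > 0" "\<kappa>\<^sub>1 \<le> 1" "\<alpha> * (real n * (\<kappa>\<^sub>1 * M)) \<le> \<kappa>' / 2"
  proof -
    show "\<kappa>\<^sub>1 > 0" unfolding \<kappa>\<^sub>1_def using \<kappa>' \<alpha>nM by (simp add: add_nonneg_pos)
    show "\<kappa>\<^sub>1 \<le> 1" unfolding \<kappa>\<^sub>1_def by simp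
    have "\<kappa>\<^sub>1 * (\<alpha> * (real n * M)) \<le> \<kappa>' / (2 * (\<alpha> * (real n * M) + 1)) * (\<alpha> * (real n * M))"
      unfolding \<kappa>\<^sub>1_def using \<alpha>nM by (intro mult_right_mono) auto
    also have "\<dots> \<le> \<kappa>' / 2" by (rule frac[OF \<alpha>nM order_refl])
    also have "\<kappa>\<^sub>1 * (\<alpha> * (real n * M)) = \<alpha> * (real n * (\<kappa>\<^sub>1 * M))" by simp
    finally show "\<alpha> * (real n * (\<kappa>\<^sub>1 * M)) \<le> \<kappa>' / 2" .
  qed
  define D where "D = \<alpha> * (real n * V) + \<alpha> * (real n * M)"
  have D: "0 \<le> \<alpha> * (real n * V)" "\<alpha> * (real n * V) \<le> D" "\<alpha> * (real n * M) \<le> D" "D \<ge> 0"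
    unfolding D_def using \<alpha> V M by simp_all
  define q where "q = \<kappa>' / (2 * (D + 1))"
  have q: "q > 0" "\<alpha> * (real n * (q * V)) \<le> \<kappa>' / 2" "\<alpha> * (real n * (q * M)) \<le> \<kappa>' / 2"
    unfolding q_def using \<kappa>' D frac[OF D(1,2)] frac[OF \<alpha>nM D(3)] by (simp_all add: mult_ac)
  obtain d where d: "d > 0" "\<And>w. norm w \<le> d \<Longrightarrow> norm (H w - \<Gamma> *v w) \<le> \<kappa>\<^sub>1 * norm w"
    using Hd[OF \<kappa>\<^sub>1(1)] by blast
  define r1 where "r1 = min d (\<kappa>\<^sub>0 / (\<alpha> * (real n * B) * r + 1))"
  have den: "\<alpha> * (real n * B) * r \<ge> 0" using \<alpha> B r by simp
  have r1: "r1 > 0" "r1 \<le> d" "r1 \<le> \<kappa>\<^sub>0 / (\<alpha> * (real n * B) * r + 1)"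
    unfolding r1_def using d(1) \<kappa>\<^sub>0 den by (auto simp: add_nonneg_pos)
  have r1_small: "\<alpha> * (real n * (B * r1)) * r < \<kappa>\<^sub>0"
  proof -
    have "r1 * (\<alpha> * (real n * B) * r) < r1 * (\<alpha> * (real n * B) * r + 1)" using r1 by simp
    also have "\<dots> \<le> \<kappa>\<^sub>0" using r1(3) den by (simp add: pos_le_divide_eq)
    finally show ?thesis by (simp add: mult_ac)
  qed
  define \<rho> where "\<rho> = min \<rho>\<^sub>s (r1 / (2 * M))"
  have \<rho>: "\<rho> > 0" unfolding \<rho>_def using \<rho>\<^sub>s r1 M by simp
  define m where "m = real CARD('q) * real CARD('q)"
  have m: "m > 0" unfolding m_def by simp
  have "\<forall>i j. \<exists>w. i < n \<longrightarrow> j < n \<longrightarrow> (\<forall>\<omega>>w. \<forall>t\<^sub>1 t\<^sub>2. t\<^sub>1 < t\<^sub>2 \<and> t\<^sub>2 < t\<^sub>1 + (\<tau> + 1) \<longrightarrow>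
      row_sum_norm (integral {t\<^sub>1..t\<^sub>2} (\<lambda>t. P i j (\<omega> * t))) \<le> q / m)"
  proof (intro allI)
    fix i j
    \<comment> \<open>The window exceeds \<tau> because the oscillation estimate excludes its far
      end; \<open>m\<close> converts row sum norms into Euclidean bounds.\<close>
    have "q / m > 0" "\<tau> + 1 > 0" using q m \<tau> by auto
    then show "\<exists>w. i < n \<longrightarrow> j < n \<longrightarrow> (\<forall>\<omega>>w. \<forall>t\<^sub>1 t\<^sub>2. t\<^sub>1 < t\<^sub>2 \<and> t\<^sub>2 < t\<^sub>1 + (\<tau> + 1) \<longrightarrow>
      row_sum_norm (integral {t\<^sub>1..t\<^sub>2} (\<lambda>t. P i j (\<omega> * t))) \<le> q / m)"
      using osc[of i j] unfolding oscillates_fast_def by blast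
  qed
  then obtain w where w: "\<And>i j \<omega> t\<^sub>1 t\<^sub>2. i < n \<Longrightarrow> j < n \<Longrightarrow> \<omega> > w i j \<Longrightarrow> t\<^sub>1 < t\<^sub>2 \<Longrightarrow> t\<^sub>2 < t\<^sub>1 + (\<tau> + 1) \<Longrightarrow>
      row_sum_norm (integral {t\<^sub>1..t\<^sub>2} (\<lambda>t. P i j (\<omega> * t))) \<le> q / m"
    by metis
  \<comment> \<open>A sum of absolute values dominates every \<open>w i j\<close> and is
    nonnegative: frequencies above it are positive and keep \<open>\<omega> i j * t\<close> among
    the nonnegative times, where the bound \<open>p\<close> holds.\<close>
  define \<omega>\<^sub>0 where "\<omega>\<^sub>0 = (\<Sum>i<n. \<Sum>j<n. \<bar>w i j\<bar>)"
  have \<omega>\<^sub>0: "\<omega>\<^sub>0 \<ge> 0" unfolding \<omega>\<^sub>0_def by (intro sum_nonneg) auto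
  have w\<omega>: "w i j \<le> \<omega>\<^sub>0" if "i < n" "j < n" for i j
  proof -
    have "\<bar>w i j\<bar> \<le> (\<Sum>j<n. \<bar>w i j\<bar>)" using that by (intro member_le_sum) auto
    also have "\<dots> \<le> \<omega>\<^sub>0" unfolding \<omega>\<^sub>0_def
      using that by (intro member_le_sum[of i "{..<n}" "\<lambda>i. \<Sum>j<n. \<bar>w i j\<bar>"]) (auto intro: sum_nonneg)
    finally show ?thesis by linarith
  qed
  show thesis
  proof (rule that[OF \<tau> M \<rho>])
    fix \<omega> :: "nat \<Rightarrow> nat \<Rightarrow> real"
    assume \<omega>: "\<forall>i<n. \<forall>j<n. \<omega> i j > \<omega>\<^sub>0"
    define R where "R = (\<lambda>i j t. P i j (\<omega> i j * t))"
    have Rb: "norm (R i j t *v x) \<le> p * norm x" if "i < n" "j < n" "t \<ge> 0" for i j t x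
    proof -
      have "\<omega> i j > \<omega>\<^sub>0" using \<omega> that by blast
      then show ?thesis unfolding R_def using that \<omega>\<^sub>0 by (intro Pb) auto
    qed
    have cpl: "norm (H x + R i j t *v x) \<le> B * norm x" if "i < n" "j < n" "t \<ge> 0" "norm x \<le> d" for i j t x
    proof -
      have "norm (H x + R i j t *v x) \<le> norm (H x - \<Gamma> *v x) + norm (\<Gamma> *v x) + norm (R i j t *v x)"
        using norm_triangle_ineq[of "H x" "R i j t *v x"] norm_triangle_sub[of "H x" "\<Gamma> *v x"] by linarith
      also have "norm (H x - \<Gamma> *v x) \<le> 1 * norm x"
        using d(2)[OF that(4)] mult_right_mono[OF \<kappa>\<^sub>1(2) norm_ge_zero[of x]] by linarith
      finally show ?thesis using g(2)[of x] Rb[OF that(1-3), of x] unfolding B_def by (simp add: algebra_simps)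
    qed
    have "contracting_step n A f (ball c r) H R \<alpha> \<nu> \<tau> M \<rho>"
      unfolding contracting_step_def
    proof (intro allI impI, elim conjE)
      fix t\<^sub>1 T z \<sigma>
      assume t1: "t\<^sub>1 \<ge> 0" and \<sigma>: "0 < \<sigma>" "\<sigma> \<le> \<rho>" and sol: "network_solution n A f H R \<alpha> {t\<^sub>1..<T} z"
        and zU: "\<forall>i<n. z i t\<^sub>1 \<in> ball c r" and z\<sigma>: "\<forall>i<n. \<forall>j<n. norm (z j t\<^sub>1 - z i t\<^sub>1) \<le> \<sigma>"
      have "M * \<sigma> \<le> M * (r1 / (2 * M))" using \<sigma> M unfolding \<rho>_def by (intro mult_left_mono) auto
      also have "\<dots> < r1" using M r1 by simp
      finally have small: "M * \<sigma> < r1" .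
      have \<sigma>0: "\<sigma> \<ge> 0" using \<sigma> by simp
      \<comment> \<open>Cutting off one time unit after the period bounds the window for Gronwall's
        inequality and still covers \<open>t\<^sub>1 + \<tau>\<close> whenever the solution lasts
        beyond it.\<close>
      define T' where "T' = min T (t\<^sub>1 + (\<tau> + 1))"
      have sol': "network_solution n A f H R \<alpha> {t\<^sub>1..<T'} z"
        by (rule network_solution_subset[OF sol]) (auto simp: T'_def)
      have conf: "\<forall>i<n. z i t \<in> ball c r \<and> (\<forall>j<n. norm (z j t - z i t) \<le> M * \<sigma>)" if t: "t \<in> {t\<^sub>1..<T'}" for t
        unfolding M_def Mf_def
      proof (rule network_coupled_confinement[where q = "\<lambda>i j t. H (z j t - z i t) + R i j t *v (z j t - z i t)"
            and v = "\<lambda>i t. f (z i t) + \<alpha> *\<^sub>R (\<Sum>j<n. A $$ (i, j) *\<^sub>R (H (z j t - z i t) + R i j t *v (z j t - z i t)))",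
            OF net \<alpha> B \<Lambda> r f_lipschitz inflow r1_small _ _ _ \<sigma>0 _ _ small[unfolded M_def Mf_def] t])
        fix i t assume i: "i < n" and t: "t \<in> {t\<^sub>1..<T'}"
        show "(z i has_vector_derivative f (z i t) + \<alpha> *\<^sub>R (\<Sum>j<n. A $$ (i, j) *\<^sub>R
            (H (z j t - z i t) + R i j t *v (z j t - z i t)))) (at t within {t\<^sub>1..<T'})"
          using sol' i t unfolding network_solution_def coupling_def by blast
        assume "\<forall>k<n. \<forall>l<n. norm (z l t - z k t) \<le> r1"
        then have "norm (H (z j t - z i t) + R i j t *v (z j t - z i t)) \<le> B * norm (z j t - z i t)" if "j < n" for j
          using that i t t1 r1(2) by (intro cpl) force+
        then show "f (z i t) + \<alpha> *\<^sub>R (\<Sum>j<n. A $$ (i, j) *\<^sub>R (H (z j t - z i t) + R i j t *v (z j t - z i t)))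
            = f (z i t) + \<alpha> *\<^sub>R (\<Sum>j<n. A $$ (i, j) *\<^sub>R (H (z j t - z i t) + R i j t *v (z j t - z i t)))
            \<and> (\<forall>j<n. norm (H (z j t - z i t) + R i j t *v (z j t - z i t)) \<le> B * norm (z j t - z i t))"
          by blast
      qed (use zU z\<sigma> in \<open>auto simp: T'_def\<close>)
      have end_step: "norm (z j (t\<^sub>1 + \<tau>) - z i (t\<^sub>1 + \<tau>)) \<le> exp (- \<nu> * \<tau>) * \<sigma>"
        if T: "t\<^sub>1 + \<tau> < T" and ij: "i < n" "j < n" for i j
      proof -
        have I: "t \<in> {t\<^sub>1..<T'}" if "t \<in> {t\<^sub>1..t\<^sub>1 + \<tau>}" for t using that T unfolding T'_def by auto
        obtain u where sh: "shadowing n A f \<Gamma> \<alpha> c r \<tau> M \<kappa>' \<sigma> (\<lambda>i s. z i (t\<^sub>1 + s)) u"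
          and uz: "\<And>i s. i < n \<Longrightarrow> s \<in> {0..\<tau>} \<Longrightarrow> norm (u i s - z i (t\<^sub>1 + s)) \<le> \<kappa>' * \<sigma>"
        proof (rule averaged_shadowing[where z = z and R = R and H = H and t\<^sub>1 = t\<^sub>1 and \<tau> = \<tau> and M = M and \<sigma> = \<sigma>
              and \<kappa> = \<kappa>' and \<kappa>\<^sub>1 = \<kappa>\<^sub>1 and q = q and B = B])
          show "network_solution n A f H R \<alpha> {t\<^sub>1..t\<^sub>1 + \<tau>} z"
            by (rule network_solution_subset[OF sol']) (use I in blast)
          show "continuous_on UNIV (R i j)" if "i < n" "j < n" for i j
            unfolding R_def by (intro continuous_on_compose2[OF Pc[OF that]] continuous_intros) auto
          show "z i t \<in> cball c r" if "i < n" "t \<in> {t\<^sub>1..t\<^sub>1 + \<tau>}" for i t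
            using conf[OF I[OF that(2)]] that(1) ball_subset_cball by blast
          show "norm (z j t - z i t) \<le> M * \<sigma>" if "i < n" "j < n" "t \<in> {t\<^sub>1..t\<^sub>1 + \<tau>}" for i j t
            using conf[OF I[OF that(3)]] that(1,2) by blast
          show "norm (H x - \<Gamma> *v x) \<le> \<kappa>\<^sub>1 * norm x" if "norm x \<le> M * \<sigma>" for x
            using that small r1(2) by (intro d(2)) linarith
          show "norm (H x + R i j t *v x) \<le> B * norm x"
            if "i < n" "j < n" "t \<in> {t\<^sub>1..t\<^sub>1 + \<tau>}" "norm x \<le> M * \<sigma>" for i j t x
            using that small r1(2) t1 by (intro cpl) auto
          show "norm (integral {t\<^sub>1..t} (R i j) *v x) \<le> q * norm x"
            if ij: "i < n" "j < n" and t: "t \<in> {t\<^sub>1..t\<^sub>1 + \<tau>}" for i j t x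
          proof (cases "t = t\<^sub>1")
            case True
            then show ?thesis using q(1) by simp
          next
            case False
            have "\<omega> i j > \<omega>\<^sub>0" using \<omega> ij by blast
            then have "row_sum_norm (integral {t\<^sub>1..t} (R i j)) \<le> q / m"
              unfolding R_def using False t w\<omega>[OF ij] by (intro w[OF ij]) auto
            then have "m * row_sum_norm (integral {t\<^sub>1..t} (R i j)) * norm x \<le> m * (q / m) * norm x"
              using m by (intro mult_right_mono mult_left_mono) auto
            then show ?thesis
              using norm_matrix_vector_le_row_sum_norm[of "integral {t\<^sub>1..t} (R i j)" x] m
              unfolding m_def[symmetric] by simp
          qed
          show "\<alpha> * (real n * (q * M)) \<le> \<kappa>'" using q(3) \<kappa>'(1) by linarith
          show "\<alpha> * (real n * (\<kappa>\<^sub>1 * M)) + \<alpha> * (real n * (q * (\<Lambda> * M + 2 * (\<alpha> * (real n * (B * M)))))) \<le> \<kappa>'"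
            using \<kappa>\<^sub>1(3) q(2) unfolding V_def by linarith
        qed (use \<tau> \<sigma>0 M B \<kappa>\<^sub>1 q zU z\<sigma> in auto)
        have "\<sigma> \<le> \<rho>\<^sub>s" using \<sigma>(2) unfolding \<rho>_def by simp
        moreover have "shadowing n A f \<Gamma> \<alpha> c r \<tau> (Mf \<tau>) \<kappa> \<sigma> (\<lambda>i s. z i (t\<^sub>1 + s)) u"
          using shadowing_mono[OF sh \<kappa>'(2) \<sigma>0] unfolding M_def .
        ultimately have "norm (u j \<tau> - u i \<tau>) \<le> exp (- \<nu> * \<tau>) * \<sigma> / 2"
          using contr \<sigma>(1) ij by blast
        moreover have "norm (u i \<tau> - z i (t\<^sub>1 + \<tau>)) \<le> \<kappa>' * \<sigma>" "norm (u j \<tau> - z j (t\<^sub>1 + \<tau>)) \<le> \<kappa>' * \<sigma>"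
          using uz ij \<tau> by auto
        moreover have "\<kappa>' * \<sigma> \<le> exp (- \<nu> * \<tau>) / 4 * \<sigma>" by (rule mult_right_mono[OF \<kappa>'(3) \<sigma>0])
        moreover have "norm (z j (t\<^sub>1 + \<tau>) - z i (t\<^sub>1 + \<tau>))
            \<le> norm (u j \<tau> - u i \<tau>) + norm (u i \<tau> - z i (t\<^sub>1 + \<tau>)) + norm (u j \<tau> - z j (t\<^sub>1 + \<tau>))"
        proof -
          have "z j (t\<^sub>1 + \<tau>) - z i (t\<^sub>1 + \<tau>) = (u j \<tau> - u i \<tau>) + (u i \<tau> - z i (t\<^sub>1 + \<tau>)) - (u j \<tau> - z j (t\<^sub>1 + \<tau>))"
            by simp
          then show ?thesis
            by (metis order_trans[OF norm_triangle_ineq4 add_right_mono[OF norm_triangle_ineq]])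
        qed
        ultimately show ?thesis by linarith
      qed
      show "(\<forall>t\<in>{t\<^sub>1..<T}. t \<le> t\<^sub>1 + \<tau> \<longrightarrow> (\<forall>i<n. z i t \<in> ball c r \<and> (\<forall>j<n. norm (z j t - z i t) \<le> M * \<sigma>)))
        \<and> (t\<^sub>1 + \<tau> < T \<longrightarrow> (\<forall>i<n. \<forall>j<n. norm (z j (t\<^sub>1 + \<tau>) - z i (t\<^sub>1 + \<tau>)) \<le> exp (- \<nu> * \<tau>) * \<sigma>))"
      proof (intro conjI ballI impI)
        fix t assume "t \<in> {t\<^sub>1..<T}" "t \<le> t\<^sub>1 + \<tau>"
        then have "t \<in> {t\<^sub>1..<T'}" unfolding T'_def by auto
        then show "\<forall>i<n. z i t \<in> ball c r \<and> (\<forall>j<n. norm (z j t - z i t) \<le> M * \<sigma>)" by (rule conf)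
      qed (use end_step in blast)
    qed
    then show "contracting_step n A f (ball c r) H (\<lambda>i j t. P i j (\<omega> i j * t)) \<alpha> \<nu> \<tau> M \<rho>"
      unfolding R_def .
  qed
qed

end

section \<open>Assembly of the constants\<close>

lemma differentiable_at_0_linear_approximation:
  fixes H :: "real ^ 'q \<Rightarrow> real ^ 'q"
  assumes "H differentiable (at 0)" "H 0 = 0" "\<kappa> > 0"
  shows "\<exists>d>0. \<forall>w. norm w \<le> d \<longrightarrow> norm (H w - jacobian H (at 0) *v w) \<le> \<kappa> * norm w"
proof -
  have "(H has_derivative (*v) (jacobian H (at 0))) (at 0)"
    by (rule iffD1[OF jacobian_works assms(1)])
  then obtain d where d: "d > 0" "\<And>w. norm (w - 0) < d \<Longrightarrow>
      norm (H w - H 0 - jacobian H (at 0) *v (w - 0)) \<le> \<kappa> * norm (w - 0)"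
    using assms(3) unfolding has_derivative_at_alt by blast
  show ?thesis
    using d assms(2) by (intro exI[of _ "d / 2"]) auto
qed

text \<open>The size of the perturbations enters through the bound \<open>p\<close> and so
  influences the period, the radius of attraction and the required frequencies, but not the rate,
  which is that of the persistence statement at \<delta> = 0.\<close>

theorem theorem2p5:
  fixes f H :: "real ^ 'q \<Rightarrow> real ^ 'q"
    and U :: "(real ^ 'q) set"
    and \<Gamma> :: "real ^ 'q ^ 'q"
    and P :: "nat \<Rightarrow> nat \<Rightarrow> real \<Rightarrow> real ^ 'q ^ 'q"
    and A :: "real mat"
    and n :: nat
    and \<rho> \<delta> \<eta> K :: real
  assumes "network n A"
    and "node_dynamics f U \<rho>"
    and "coupling_assumption n H \<Gamma> P \<delta>"
    and "persistence_constants f U \<Gamma> \<eta> K"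
    and "\<And>i j. i < n \<Longrightarrow> j < n \<Longrightarrow> zero_mean_periodic (P i j)"
    and "\<And>i j. i < n \<Longrightarrow> j < n \<Longrightarrow> oscillates_fast (P i j)"
  shows "\<forall>\<alpha>>0. \<alpha> > \<eta> / (lambda2 A * spectral_min \<Gamma>) \<longrightarrow>
    (\<exists>\<omega>\<^sub>0. \<forall>\<omega> :: nat \<Rightarrow> nat \<Rightarrow> real. (\<forall>i<n. \<forall>j<n. \<omega> i j > \<omega>\<^sub>0) \<longrightarrow>
      sync_locally_exp_stable n A f U H (\<lambda>i j t. P i j (\<omega> i j * t)) \<alpha>
        (\<alpha> * lambda2 A * spectral_min \<Gamma> - \<eta>))"
proof (intro allI impI)
  fix \<alpha> :: real
  assume \<alpha>: "\<alpha> > 0" and \<alpha>\<eta>: "\<alpha> > \<eta> / (lambda2 A * spectral_min \<Gamma>)"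
  define \<nu> where "\<nu> = \<alpha> * lambda2 A * spectral_min \<Gamma> - \<eta>"
  have net: "network n A" by fact
  have n: "n > 0" using net unfolding network_def by simp
  have f: "\<And>x. f differentiable (at x)" "continuous_on UNIV (\<lambda>x. jacobian f (at x))"
    "inflowing_invariant_ball f U"
    using assms(2) unfolding node_dynamics_def by blast+
  have H: "\<And>x. H differentiable (at x)" "jacobian H (at 0) = \<Gamma>" and sm: "spectral_min \<Gamma> > 0"
    and Pc: "\<And>i j. i < n \<Longrightarrow> j < n \<Longrightarrow> continuous_on UNIV (P i j)"
    and P\<delta>: "\<And>i j t. i < n \<Longrightarrow> j < n \<Longrightarrow> t > 0 \<Longrightarrow> row_sum_norm (P i j t) \<le> \<delta>"
    using assms(3) unfolding coupling_assumption_def by blast+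
  have "coupling H P 0 0 0 0 = 0" using assms(3) n unfolding coupling_assumption_def by blast
  then have H0: "H 0 = 0" unfolding coupling_def by simp
  have l2: "lambda2 A * spectral_min \<Gamma> > 0" using lambda2_pos[OF net] sm by simp
  have \<alpha>l: "\<eta> < \<alpha> * (lambda2 A * spectral_min \<Gamma>)" using \<alpha>\<eta> l2 by (simp add: pos_divide_less_eq)
  then have \<nu>: "\<nu> > 0" unfolding \<nu>_def by (simp add: mult.assoc)
  obtain c r where r: "r > 0" and U: "U = ball c r" and inU: "\<And>x. x \<in> sphere c r \<Longrightarrow> inner (f x) (x - c) < 0"
    using f(3) unfolding inflowing_invariant_ball_def by blast
  have pers: "sync_locally_exp_stable n A f (ball c r) W (\<lambda>_ _ _. 0) \<alpha> \<nu>"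
    if W: "\<And>x. W differentiable (at x)" "jacobian W (at 0) = \<Gamma>" "W 0 = 0" for W
  proof -
    have "coupling_assumption n W \<Gamma> (\<lambda>_ _ _. 0) 0"
      unfolding coupling_assumption_def coupling_def row_sum_norm_def using W sm by simp
    moreover have "0 < (lambda2 A * spectral_min \<Gamma> - \<eta> / \<alpha>) / (K * row_sum_norm_mat (laplacian A))"
    proof -
      have "\<eta> / \<alpha> < lambda2 A * spectral_min \<Gamma>" using \<alpha>l \<alpha> by (simp add: pos_divide_less_eq mult.commute)
      moreover have "K > 0" using assms(4) unfolding persistence_constants_def by simp
      ultimately show ?thesis using row_sum_norm_laplacian_pos[OF net] by simp
    qed
    ultimately have "sync_locally_exp_stable n A f U W (\<lambda>_ _ _. 0) \<alpha>
        (\<alpha> * lambda2 A * spectral_min \<Gamma> - \<eta> - \<alpha> * 0 * K * row_sum_norm_mat (laplacian A))"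
      using assms(4) net \<alpha> \<alpha>\<eta> unfolding persistence_constants_def by blast
    then show ?thesis unfolding \<nu>_def U by simp
  qed
  obtain \<Lambda> where \<Lambda>: "\<Lambda> > 0" "\<And>x v. x \<in> cball c r \<Longrightarrow> norm (jacobian f (at x) *v v) \<le> \<Lambda> * norm v"
    "\<And>x y. x \<in> cball c r \<Longrightarrow> y \<in> cball c r \<Longrightarrow> norm (f x - f y) \<le> \<Lambda> * norm (x - y)"
    by (rule compact_convex_C1_lipschitz[OF f(1,2) compact_cball convex_cball]) (rule that)
  have "continuous_on UNIV f"
    using f(1) by (simp add: continuous_at_imp_continuous_on differentiable_imp_continuous_within)
  then obtain \<kappa>\<^sub>0 where \<kappa>\<^sub>0: "\<kappa>\<^sub>0 > 0" "\<And>x. x \<in> sphere c r \<Longrightarrow> inner (f x) (x - c) \<le> - \<kappa>\<^sub>0"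
    by (rule inflowing_uniform[OF _ inU]) (assumption, rule that)
  obtain e \<mu> where eb: "laplacian_eigenbasis n A e \<mu>"
    using laplacian_eigenbasis_exists[OF net] .
  define m where "m = real CARD('q) * real CARD('q)"
  have m: "m > 0" unfolding m_def by simp
  define g where "g = m * norm \<Gamma> + 1"
  have g: "g > 0" unfolding g_def using m by (simp add: add_nonneg_pos)
  have g': "norm (\<Gamma> *v w) \<le> g * norm w" for w
    using norm_matrix_vector_le_norm[of \<Gamma> w] norm_ge_zero[of w]
    unfolding g_def m_def distrib_right mult_1 by linarith
  interpret coupled_network n A e \<mu> f c \<Gamma> r \<Lambda> \<kappa>\<^sub>0 \<alpha> g
  proof
    show "\<exists>d>0. \<forall>x\<in>cball c r. \<forall>y\<in>cball c r. norm (y - x) < d \<longrightarrow>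
      norm (f y - f x - jacobian f (at x) *v (y - x)) \<le> \<kappa> * norm (y - x)" if "\<kappa> > 0" for \<kappa>
      using compact_convex_C1_uniformly_differentiable[OF f(1,2) compact_cball[of c r] convex_cball that]
      by metis
  qed (fact net eb \<alpha> \<Lambda> r \<kappa>\<^sub>0 g g')+
  have Pb: "norm (P i j t *v w) \<le> (m * \<bar>\<delta>\<bar>) * norm w" if ij: "i < n" "j < n" and t: "t \<ge> 0" for i j t w
  proof -
    have "row_sum_norm (P i j t) \<le> \<delta>"
    \<comment> \<open>The bound on the perturbations is assumed at positive times; periodicity
      carries it over to time 0.\<close>
    proof (cases "t = 0")
      case True
      obtain p where "p > 0" "\<forall>t. P i j (t + p) = P i j t"
        using assms(5)[OF ij] unfolding zero_mean_periodic_def by blast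
      then show ?thesis using P\<delta>[OF ij, of p] True by (metis add_0)
    qed (use P\<delta>[OF ij] t in simp)
    then have "m * row_sum_norm (P i j t) * norm w \<le> m * \<bar>\<delta>\<bar> * norm w"
      using m by (intro mult_right_mono mult_left_mono) auto
    then show ?thesis
      using norm_matrix_vector_le_row_sum_norm[of "P i j t" w] unfolding m_def[symmetric] by linarith
  qed
  have Hd: "\<exists>d>0. \<forall>w. norm w \<le> d \<longrightarrow> norm (H w - \<Gamma> *v w) \<le> \<kappa> * norm w" if "\<kappa> > 0" for \<kappa>
    using differentiable_at_0_linear_approximation[OF H(1) H0 that] unfolding H(2) .
  show "\<exists>\<omega>\<^sub>0. \<forall>\<omega> :: nat \<Rightarrow> nat \<Rightarrow> real. (\<forall>i<n. \<forall>j<n. \<omega> i j > \<omega>\<^sub>0) \<longrightarrow>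
      sync_locally_exp_stable n A f U H (\<lambda>i j t. P i j (\<omega> i j * t)) \<alpha>
        (\<alpha> * lambda2 A * spectral_min \<Gamma> - \<eta>)"
  proof (rule fast_oscillation_contracting_step[where H = H and P = P and p = "m * \<bar>\<delta>\<bar>" and \<nu> = \<nu>])
    fix \<tau> M \<omega>\<^sub>0 \<rho>'
    assume "\<tau> > 0" "M > 0" "\<rho>' > 0" and step: "\<And>\<omega> :: nat \<Rightarrow> nat \<Rightarrow> real. \<forall>i<n. \<forall>j<n. \<omega> i j > \<omega>\<^sub>0 \<Longrightarrow>
      contracting_step n A f (ball c r) H (\<lambda>i j t. P i j (\<omega> i j * t)) \<alpha> \<nu> \<tau> M \<rho>'"
    then show ?thesis
      using contracting_step_imp_stable[OF step \<nu>] n unfolding U \<nu>_def by blast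
  qed (use pers Hd Pc Pb m assms(6) in auto)
qed

end
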